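(* Let $n \geq 2$ and let $\tau : \mathbb{C}^n \to \mathbb{C}^n$, $\tau(z) = z + a$ with $a \in \mathbb{C}^n \setminus \{0\}$, be a translation different from the identity. (1) There exists a holomorphic automorphism $F$ of $\mathbb{C}^n$ which is conjugate to a twisted shear and such that the subgroup $\langle \tau, F \rangle$ generated by $\tau$ and $F$ is a free subgroup of the shear group of $\mathbb{C}^n$ which is dense (in the compact-open topology) in the shear group of $\mathbb{C}^n$. (2) There exists a holomorphic automorphism $F$ of $\mathbb{C}^n$ which is conjugate to a twisted overshear and such that the subgroup $\langle \tau, F \rangle$ generated by $\tau$ and $F$ is a free subgroup of the overshear group of $\mathbb{C}^n$ which is dense (in the compact-open topology) in the overshear group of $\mathbb{C}^n$.
   Context: Here $\mathcal{O}(\mathbb{C}^{n-1})$ is the algebra of holomorphic functions on $\mathbb{C}^{n-1}$. A map $G : \mathbb{C}^n \to \mathbb{C}^n$ of the form $G(z_1,\dots,z_n) = (z_1,\dots,z_{n-1}, \exp(f(z_1,\dots,z_{n-1}))\cdot z_n + g(z_1,\dots,z_{n-1}))$ with $f,g \in \mathcal{O}(\mathbb{C}^{n-1})$ is called an overshear in direction of the $n$-th coordinate axis (a shear in direction of the $n$-th coordinate axis if $f \equiv 0$). For $A \in \mathrm{SL}(\mathbb{C}^n)$ the conjugates $A^{-1} \circ G \circ A$ are called overshears (shears if $f \equiv 0$). The shear group (resp. overshear group) is the group of holomorphic automorphisms of $\mathbb{C}^n$ generated by all shears (resp. overshears). Let $I : \mathbb{C}^n \to \mathbb{C}^n$, $I(z_1,\dots,z_n)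 = (z_2,\dots,z_n, -(-1)^n z_1)$. A twisted shear (resp. twisted overshear) is a map of the form $G \circ I$ where $G$ is a shear (resp. overshear). Conjugate means conjugate in the group of holomorphic automorphisms of $\mathbb{C}^n$. *)

theory Defs
  imports "HOL-Analysis.Analysis" "HOL-Algebra.Generated_Groups"
begin

text \<open>
  Points of \<open>\<complex>\<^sup>n\<close> are vectors of type \<open>'n cspace\<close> with \<open>n = CARD('n)\<close>. The finite linear order
  on the index type enumerates the coordinates: \<open>z\<^sub>1\<close> is \<open>z $ first_coord\<close>, \<open>z\<^sub>n\<close> is
  \<open>z $ last_coord\<close>, and the coordinate after \<open>i \<noteq> last_coord\<close> is \<open>next_coord i\<close>.
\<close>

type_synonym 'n cspace = "(complex, 'n) vec"

definition first_coord :: "'n::{finite, linorder}"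
  where "first_coord = Min UNIV"

definition last_coord :: "'n::{finite, linorder}"
  where "last_coord = Max UNIV"

definition next_coord :: "'n::{finite, linorder} \<Rightarrow> 'n"
  where "next_coord i = Min {j. i < j}"


section \<open>Holomorphic automorphisms of complex space\<close>

definition holomorphic_fun :: "('n::finite cspace \<Rightarrow> complex) \<Rightarrow> bool"
  where "holomorphic_fun f \<longleftrightarrow>
    (\<forall>z. \<exists>D. (f has_derivative D) (at z) \<and> (\<forall>c v. D (c *s v) = c * D v))"

definition holomorphic_map :: "('n::finite cspace \<Rightarrow> 'm::finite cspace) \<Rightarrow> bool"
  where "holomorphic_map F \<longleftrightarrow> (\<forall>i. holomorphic_fun (\<lambda>z. F z $ i))"

definition hol_aut :: "('n::finite cspace \<Rightarrow> 'n cspace) monoid"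
  where "hol_aut =
    \<lparr>carrier = {F. bij F \<and> holomorphic_map F \<and> holomorphic_map (inv_into UNIV F)},
     monoid.mult = (\<circ>), one = id\<rparr>"

definition translation :: "'n::finite cspace \<Rightarrow> 'n cspace \<Rightarrow> 'n cspace"
  where "translation a = (\<lambda>z. z + a)"


section \<open>Shears and overshears\<close>

text \<open>
  An element of \<open>\<O>(\<complex>\<^sup>n\<^sup>-\<^sup>1)\<close>, as a function of \<open>(z\<^sub>1, \<dots>, z\<^sub>n\<^sub>-\<^sub>1)\<close>, is identified with its pullback
  along the projection \<open>\<complex>\<^sup>n \<rightarrow> \<complex>\<^sup>n\<^sup>-\<^sup>1\<close> forgetting \<open>z\<^sub>n\<close>.
\<close>

definition hol_fun_without_last :: "('n::{finite, linorder} cspace \<Rightarrow> complex) set"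
  where "hol_fun_without_last =
    {f. holomorphic_fun f \<and> (\<forall>z w. (\<forall>i. i \<noteq> last_coord \<longrightarrow> z $ i = w $ i) \<longrightarrow> f z = f w)}"

definition axis_overshear ::
    "('n cspace \<Rightarrow> complex) \<Rightarrow> ('n cspace \<Rightarrow> complex) \<Rightarrow>
      'n cspace \<Rightarrow> 'n::{finite, linorder} cspace"
  where "axis_overshear f g z =
    (\<chi> i. if i = last_coord then exp (f z) * z $ last_coord + g z else z $ i)"

definition axis_overshears :: "('n cspace \<Rightarrow> 'n::{finite, linorder} cspace) set"
  where "axis_overshears =
    {axis_overshear f g | f g. f \<in> hol_fun_without_last \<and> g \<in> hol_fun_without_last}"

definition axis_shears :: "('n cspace \<Rightarrow> 'n::{finite, linorder} cspace) set"
  where "axis_shears = {axis_overshear (\<lambda>_. 0) g | g. g \<in> hol_fun_without_last}"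

definition SL_conjugates ::
    "('n cspace \<Rightarrow> 'n::finite cspace) set \<Rightarrow> ('n cspace \<Rightarrow> 'n cspace) set"
  where "SL_conjugates S =
    {\<lambda>z. matrix_inv A *v G (A *v z) | (A :: complex ^ 'n ^ 'n) G. det A = 1 \<and> G \<in> S}"

definition overshears :: "('n cspace \<Rightarrow> 'n::{finite, linorder} cspace) set"
  where "overshears = SL_conjugates axis_overshears"

definition shears :: "('n cspace \<Rightarrow> 'n::{finite, linorder} cspace) set"
  where "shears = SL_conjugates axis_shears"

definition overshear_group :: "('n cspace \<Rightarrow> 'n::{finite, linorder} cspace) set"
  where "overshear_group = generate hol_aut overshears"

definition shear_group :: "('n cspace \<Rightarrow> 'n::{finite, linorder} cspace) set"
  where "shear_group = generate hol_aut shears"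

definition twist :: "'n cspace \<Rightarrow> 'n::{finite, linorder} cspace"
  where "twist z =
    (\<chi> i. if i = last_coord then - ((- 1) ^ CARD('n)) * z $ first_coord else z $ next_coord i)"

definition twisted_overshears :: "('n cspace \<Rightarrow> 'n::{finite, linorder} cspace) set"
  where "twisted_overshears = {G \<circ> twist | G. G \<in> overshears}"

definition twisted_shears :: "('n cspace \<Rightarrow> 'n::{finite, linorder} cspace) set"
  where "twisted_shears = {G \<circ> twist | G. G \<in> shears}"


section \<open>Conjugacy and free groups\<close>

definition conjugate_in :: "('a, 'b) monoid_scheme \<Rightarrow> 'a \<Rightarrow> 'a \<Rightarrow> bool"
  where "conjugate_in G x y \<longleftrightarrow>
    x \<in> carrier G \<and> y \<in> carrier G \<and>
    (\<exists>h \<in> carrier G. x = inv\<^bsub>G\<^esub> h \<otimes>\<^bsub>G\<^esub> y \<otimes>\<^bsub>G\<^esub> h)"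

text \<open>
  A word is a list of letters; \<open>(b, True)\<close> stands for \<open>b\<close> and \<open>(b, False)\<close> for the inverse of \<open>b\<close>.
\<close>

definition eval_word :: "('a, 'b) monoid_scheme \<Rightarrow> ('a \<times> bool) list \<Rightarrow> 'a"
  where "eval_word G w =
    foldr (\<lambda>(b, s) x. (if s then b else inv\<^bsub>G\<^esub> b) \<otimes>\<^bsub>G\<^esub> x) w \<one>\<^bsub>G\<^esub>"

definition reduced_word :: "('a \<times> bool) list \<Rightarrow> bool"
  where "reduced_word = successively (\<lambda>p q. fst p = fst q \<longrightarrow> snd p = snd q)"

definition free_basis :: "('a, 'b) monoid_scheme \<Rightarrow> 'a set \<Rightarrow> bool"
  where "free_basis G B \<longleftrightarrow>
    B \<subseteq> carrier G \<and> generate G B = carrier G \<and>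
    (\<forall>w. w \<noteq> [] \<and> fst ` set w \<subseteq> B \<and> reduced_word w \<longrightarrow> eval_word G w \<noteq> \<one>\<^bsub>G\<^esub>)"

definition free_group :: "('a, 'b) monoid_scheme \<Rightarrow> bool"
  where "free_group G \<longleftrightarrow> group G \<and> (\<exists>B. free_basis G B)"


section \<open>Compact-open topology\<close>

text \<open>
  The topology lives on all functions; on a set of continuous maps its subspace topology is the
  usual compact-open topology.
\<close>

definition compact_open_topology :: "('a::topological_space \<Rightarrow> 'b::topological_space) topology"
  where "compact_open_topology =
    topology_generated_by {{f. f ` K \<subseteq> U} | K U. compact K \<and> open U}"

definition dense_in_compact_open ::
    "('a::topological_space \<Rightarrow> 'b::topological_space) set \<Rightarrow> ('a \<Rightarrow> 'b) set \<Rightarrow> bool"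
  where "dense_in_compact_open H S \<longleftrightarrow>
    H \<subseteq> S \<and> subtopology compact_open_topology S closure_of H = S"

end

(* Conjugating by a linear map turns the translation into z + (1, ..., 1). There is a universal
   tuple phi of entire functions: its translates phi(z + m (1, ..., 1)), m a natural number,
   approximate every tuple psi of entire functions locally uniformly (Birkhoff). The generator F is
   built from phi in such a way that conjugating F by a power of the translation replaces phi by
   such a translate. Hence the closure of the group contains the generator F(psi) of every other
   tuple psi, and these generate all (over)shears. Likewise, a relation between the translation and
   F = F(phi) passes to F(psi) for every psi, while for each nontrivial reduced word one can choose
   psi by polynomial interpolation so that the word moves the origin. If F were a
   linear conjugate of a twisted (over)shear, then tau and F tau F^(-1), with tau the translation,
   would generate a solvable group; F is therefore conjugated by a nonlinear map depending on phi. *)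

theory Submission
  imports Defs "HOL-Complex_Analysis.Cauchy_Integral_Formula" "HOL-Real_Asymp.Real_Asymp"
begin

section \<open>Holomorphic functions\<close>

text \<open>Translating the tuple amounts to conjugating the generator only if all fixed ingredients
  commute with diagonal translations. The twist fails through its sign, an overshear through its
  exponential factor. Both are repaired by making the coefficients in the last coordinate sum to 1;
  the corrections are shears in that same coordinate, so they are absorbed into \<open>G\<close> in
  \<open>G \<circ> twist\<close>. The linear change making the translation diagonal may have any
  nonzero determinant, while the groups are generated by conjugates under determinant 1. Hence all
  linear conjugates of coordinate overshears must be shown to lie in these groups. All members of
  the tuple must be approximated along the same translates, although each may depend on certain
  coordinates only. A Gaussian factor in a permitted coordinate makes the sum of translates
  converge. For freeness the nonlinear conjugation must send prescribed points to prescribed points.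
  Interpolation needs distinct nodes, so every suffix of a word gets two complex weights, each of
  them injective on the suffixes of a reduced word. The parameter \<open>o'\<close>, equal to 0 or
  1, treats shears and overshears together.\<close>

lemma holomorphic_fun_const [simp, intro]: "holomorphic_fun (\<lambda>_. c)"
  unfolding holomorphic_fun_def by (intro allI exI[of _ "\<lambda>_. 0"]) auto

lemma holomorphic_fun_nth [simp, intro]: "holomorphic_fun (\<lambda>z. z $ i)"
  unfolding holomorphic_fun_def
  by (intro allI exI[of _ "\<lambda>v. v $ i"])
    (auto intro!: bounded_linear_imp_has_derivative bounded_linear_vec_nth)

lemma holomorphic_fun_add [simp, intro]:
  assumes "holomorphic_fun f" "holomorphic_fun g"
  shows "holomorphic_fun (\<lambda>z. f z + g z)"
  unfolding holomorphic_fun_def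
proof
  fix z
  obtain D E where "(f has_derivative D) (at z)" "\<forall>c v. D (c *s v) = c * D v"
    "(g has_derivative E) (at z)" "\<forall>c v. E (c *s v) = c * E v"
    using assms unfolding holomorphic_fun_def by meson
  then show "\<exists>D. ((\<lambda>z. f z + g z) has_derivative D) (at z) \<and> (\<forall>c v. D (c *s v) = c * D v)"
    by (intro exI[of _ "\<lambda>v. D v + E v"]) (auto intro!: derivative_intros simp: algebra_simps)
qed

lemma holomorphic_fun_mult [simp, intro]:
  assumes "holomorphic_fun f" "holomorphic_fun g"
  shows "holomorphic_fun (\<lambda>z. f z * g z)"
  unfolding holomorphic_fun_def
proof
  fix z
  obtain D E where "(f has_derivative D) (at z)" "\<forall>c v. D (c *s v) = c * D v"
    "(g has_derivative E) (at z)" "\<forall>c v. E (c *s v) = c * E v"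
    using assms unfolding holomorphic_fun_def by meson
  then show "\<exists>D. ((\<lambda>z. f z * g z) has_derivative D) (at z) \<and> (\<forall>c v. D (c *s v) = c * D v)"
    by (intro exI[of _ "\<lambda>v. f z * E v + D v * g z"])
      (auto intro!: has_derivative_mult simp: distrib_left mult.assoc mult.left_commute)
qed

lemma holomorphic_fun_uminus [simp, intro]:
  "holomorphic_fun f \<Longrightarrow> holomorphic_fun (\<lambda>z. - f z)"
  using holomorphic_fun_mult[of "\<lambda>_. - 1" f] by simp

lemma holomorphic_fun_diff [simp, intro]:
  "holomorphic_fun f \<Longrightarrow> holomorphic_fun g \<Longrightarrow> holomorphic_fun (\<lambda>z. f z - g z)"
  using holomorphic_fun_add[of f "\<lambda>z. - g z"] by simp

lemma holomorphic_fun_sum [intro]: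
  "(\<And>i. i \<in> I \<Longrightarrow> holomorphic_fun (f i)) \<Longrightarrow> holomorphic_fun (\<lambda>z. \<Sum>i\<in>I. f i z)"
  by (induction I rule: infinite_finite_induct) auto

lemma holomorphic_fun_power [simp, intro]:
  "holomorphic_fun f \<Longrightarrow> holomorphic_fun (\<lambda>z. f z ^ k)"
  by (induction k) auto

lemma holomorphic_fun_compose_field:
  assumes f: "holomorphic_fun f" and h: "\<And>t. (h has_field_derivative h' t) (at t)"
  shows "holomorphic_fun (\<lambda>z. h (f z))"
  unfolding holomorphic_fun_def
proof
  fix z
  obtain D where D: "(f has_derivative D) (at z)" "\<forall>c v. D (c *s v) = c * D v"
    using f unfolding holomorphic_fun_def by meson
  have "((\<lambda>z. h (f z)) has_derivative (\<lambda>v. h' (f z) * D v)) (at z)"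
    by (rule has_derivative_compose[OF D(1)]) (use h in \<open>auto simp: has_field_derivative_def\<close>)
  then show "\<exists>D. ((\<lambda>z. h (f z)) has_derivative D) (at z) \<and> (\<forall>c v. D (c *s v) = c * D v)"
    using D(2) by (intro exI[of _ "\<lambda>v. h' (f z) * D v"]) auto
qed

lemma holomorphic_fun_exp [simp, intro]:
  "holomorphic_fun f \<Longrightarrow> holomorphic_fun (\<lambda>z. exp (f z))"
  by (rule holomorphic_fun_compose_field[where h' = exp]) (auto intro: DERIV_exp)

lemma holomorphic_fun_poly [simp, intro]:
  "holomorphic_fun f \<Longrightarrow> holomorphic_fun (\<lambda>z. poly q (f z))"
  by (induction q) auto

lemma has_derivative_vecI:
  fixes f :: "'a::real_normed_vector \<Rightarrow> complex ^ 'n"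
  assumes "\<And>i. ((\<lambda>z. f z $ i) has_derivative (\<lambda>v. D v $ i)) (at z)"
  shows "(f has_derivative D) (at z)"
  unfolding has_derivative_componentwise_within[of f]
  using assms by (auto simp: Basis_vec_def inner_axis intro!: has_derivative_inner_left)

lemma holomorphic_fun_compose:
  assumes f: "holomorphic_fun f" and G: "holomorphic_map G"
  shows "holomorphic_fun (\<lambda>z. f (G z))"
  unfolding holomorphic_fun_def
proof
  fix z
  have "\<exists>E. \<forall>i. ((\<lambda>z. G z $ i) has_derivative E i) (at z) \<and> (\<forall>c v. E i (c *s v) = c * E i v)"
    using G unfolding holomorphic_map_def holomorphic_fun_def by (intro choice) blast
  then obtain E where E: "\<And>i. ((\<lambda>z. G z $ i) has_derivative E i) (at z)"
    "\<And>i c v. E i (c *s v) = c * E i v" by blast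
  have GE: "(G has_derivative (\<lambda>v. \<chi> i. E i v)) (at z)"
    by (rule has_derivative_vecI) (use E in simp)
  obtain D where D: "(f has_derivative D) (at (G z))" "\<And>c v. D (c *s v) = c * D v"
    using f unfolding holomorphic_fun_def by meson
  have "(\<chi> i. E i (c *s v)) = c *s (\<chi> i. E i v)" for c v
    by (simp add: vec_eq_iff E(2))
  then show "\<exists>D. ((\<lambda>z. f (G z)) has_derivative D) (at z) \<and> (\<forall>c v. D (c *s v) = c * D v)"
    using has_derivative_compose[OF GE D(1)] D(2)
    by (intro exI[of _ "\<lambda>v. D (\<chi> i. E i v)"]) auto
qed

lemma holomorphic_map_compose [intro]:
  "holomorphic_map F \<Longrightarrow> holomorphic_map G \<Longrightarrow> holomorphic_map (F \<circ> G)"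
  unfolding holomorphic_map_def[of F] holomorphic_map_def[of "F \<circ> G"]
  by (auto intro: holomorphic_fun_compose)

lemma holomorphic_mapI: "(\<And>i. holomorphic_fun (\<lambda>z. F z $ i)) \<Longrightarrow> holomorphic_map F"
  by (simp add: holomorphic_map_def)

lemma holomorphic_fun_continuous: "holomorphic_fun f \<Longrightarrow> isCont f z"
  unfolding holomorphic_fun_def by (meson has_derivative_continuous)

lemma holomorphic_fun_translate:
  "holomorphic_fun f \<Longrightarrow> holomorphic_fun (\<lambda>z. f (z + b))"
  by (rule holomorphic_fun_compose[of f "\<lambda>z. z + b"]) (auto intro!: holomorphic_mapI)

lemma holomorphic_fun_line:
  assumes "holomorphic_fun f"
  shows "((\<lambda>t. f (z + t *s v)) has_field_derivative
          (frechet_derivative f (at (z + t *s v)) v)) (at t)"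
proof -
  obtain D where D: "(f has_derivative D) (at (z + t *s v))" "\<And>c v. D (c *s v) = c * D v"
    using assms unfolding holomorphic_fun_def by meson
  have "((\<lambda>t. z + t *s v) has_derivative (\<lambda>s. s *s v)) (at t)"
    by (rule has_derivative_vecI) (auto intro!: derivative_eq_intros)
  from has_derivative_compose[OF this D(1)]
  have "((\<lambda>t. f (z + t *s v)) has_derivative (\<lambda>s. D v * s)) (at t)"
    by (simp add: D(2) mult.commute)
  moreover have "frechet_derivative f (at (z + t *s v)) = D"
    by (rule frechet_derivative_at[symmetric]) (rule D(1))
  ultimately show ?thesis by (simp add: has_field_derivative_def)
qed

lemma holomorphic_fun_frechet:
  assumes "holomorphic_fun f"
  shows "(f has_derivative frechet_derivative f (at z)) (at z)"
    and "frechet_derivative f (at z) (c *s v) = c * frechet_derivative f (at z) v"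
proof -
  obtain D where D: "(f has_derivative D) (at z)" "\<And>c v. D (c *s v) = c * D v"
    using assms unfolding holomorphic_fun_def by meson
  moreover have "frechet_derivative f (at z) = D"
    by (rule frechet_derivative_at[symmetric]) (rule D(1))
  ultimately show "(f has_derivative frechet_derivative f (at z)) (at z)"
    "frechet_derivative f (at z) (c *s v) = c * frechet_derivative f (at z) v" by simp_all
qed

lemma norm_vector_scalar_mult: "norm (c *s v) = norm c * norm v"
  for v :: "complex ^ 'n"
  by (simp add: norm_vec_def norm_mult L2_set_right_distrib)

text \<open>Cauchy's inequality on the unit disc of the complex line through \<open>z\<close> in the
  direction of \<open>h\<close>. It turns bounds on the terms of a series into bounds on their
  derivatives.\<close>

lemma frechet_derivative_Cauchy_bound:
  assumes f: "holomorphic_fun f" and B: "\<And>w. norm w \<le> norm z + 1 \<Longrightarrow> norm (f w) \<le> B"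
  shows "norm (frechet_derivative f (at z) h) \<le> B * norm h"
proof (cases "h = 0")
  case True
  then show ?thesis using holomorphic_fun_frechet(2)[OF f, of z 0 h] by simp
next
  case False
  define v where "v = complex_of_real (1 / norm h) *s h"
  have h: "h = complex_of_real (norm h) *s v" and v: "norm v = 1"
    using False by (auto simp: v_def norm_vector_scalar_mult vec_eq_iff norm_divide)
  define g where "g t = f (z + t *s v)" for t
  have dg: "(g has_field_derivative (frechet_derivative f (at (z + t *s v)) v)) (at t)" for t
    unfolding g_def using holomorphic_fun_line[OF f] .
  have "norm ((deriv ^^ 1) g 0) \<le> fact 1 * B / 1 ^ 1"
  proof (rule Cauchy_inequality)
    show "g holomorphic_on ball 0 1"
      using dg by (auto simp: holomorphic_on_open)
    show "continuous_on (cball 0 1) g"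
      by (intro continuous_at_imp_continuous_on ballI DERIV_isCont[OF dg])
    fix x :: complex
    assume "cmod (0 - x) = 1"
    then have "norm (z + x *s v) \<le> norm z + 1"
      using norm_triangle_ineq[of z "x *s v"] v by (simp add: norm_vector_scalar_mult)
    then show "norm (g x) \<le> B" unfolding g_def by (rule B)
  qed simp
  then have "norm (frechet_derivative f (at z) v) \<le> B"
    using DERIV_imp_deriv[OF dg[of 0]] by simp
  moreover have "frechet_derivative f (at z) h = complex_of_real (norm h) * frechet_derivative f (at z) v"
    using holomorphic_fun_frechet(2)[OF f, of z "complex_of_real (norm h)" v] h by metis
  ultimately show ?thesis
    by (simp add: norm_mult mult.commute[of B] mult_left_mono)
qed

lemma geometric_half_tail:
  fixes a :: "nat \<Rightarrow> complex"
  assumes "\<And>j. n \<le> j \<Longrightarrow> norm (a j) \<le> (1 / 2) ^ j * c"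
  shows "summable a" and "norm ((\<Sum>j<n. a j) - (\<Sum>j. a j)) \<le> 2 * (1 / 2) ^ n * c"
proof -
  have s: "summable (\<lambda>j. (1 / 2 :: real) ^ (j + n) * c)"
    by (intro summable_mult2 summable_ignore_initial_segment[of "\<lambda>j. (1 / 2 :: real) ^ j"])
      (simp add: summable_geometric)
  have b: "norm (a (j + n)) \<le> (1 / 2) ^ (j + n) * c" for j
    by (rule assms) simp
  have "summable (\<lambda>j. a (j + n))"
    by (rule summable_comparison_test'[OF s]) (use b in auto)
  then show sa: "summable a" by (simp add: summable_iff_shift)
  have "norm ((\<Sum>j<n. a j) - (\<Sum>j. a j)) = norm (\<Sum>j. a (j + n))"
    using suminf_split_initial_segment[OF sa, of n] by (simp add: norm_minus_commute)
  also have "\<dots> \<le> (\<Sum>j. (1 / 2) ^ (j + n) * c)"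
    by (rule norm_suminf_le[OF b s])
  also have "\<dots> = (\<Sum>j. (1 / 2) ^ j * ((1 / 2) ^ n * c))"
    by (simp add: power_add mult.assoc)
  also have "\<dots> = 2 * (1 / 2) ^ n * c"
    by (subst suminf_mult2[symmetric]) (auto simp: suminf_geometric summable_geometric)
  finally show "norm ((\<Sum>j<n. a j) - (\<Sum>j. a j)) \<le> 2 * (1 / 2) ^ n * c" .
qed

text \<open>The Cauchy bound makes the differentiated series converge uniformly on balls, so
  termwise differentiation applies, and complex homogeneity passes to the sum. The starting index
  may depend on the ball, as it must for translates with centres going to infinity.\<close>

lemma holomorphic_fun_suminf:
  assumes hol: "\<And>j. holomorphic_fun (f j)"
    and bd: "\<And>R. \<exists>N. \<forall>j\<ge>N. \<forall>z. norm z \<le> R \<longrightarrow> norm (f j z) \<le> (1 / 2) ^ j"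
  shows "holomorphic_fun (\<lambda>z. \<Sum>j. f j z)"
  unfolding holomorphic_fun_def
proof
  fix z0 :: "complex ^ 'a"
  define D where "D j x = frechet_derivative (f j) (at x)" for j x
  define R where "R = norm z0 + 1"
  \<comment> \<open>The margin 1 beyond \<open>R\<close> is the radius of the disc used by the
    Cauchy bound.\<close>
  obtain N where N: "\<And>j z. N \<le> j \<Longrightarrow> norm z \<le> R + 1 \<Longrightarrow> norm (f j z) \<le> (1 / 2) ^ j"
    using bd by meson
  have DN: "norm (D j x h) \<le> (1 / 2) ^ j * norm h" if "x \<in> ball 0 R" "N \<le> j" for j x h
    unfolding D_def by (rule frechet_derivative_Cauchy_bound[OF hol]) (use that N in auto)
  have sm: "summable (\<lambda>j. D j x h)" if "x \<in> ball 0 R" for x h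
    by (rule geometric_half_tail(1)[of N _ "norm h"]) (use DN that in auto)
  have sf: "summable (\<lambda>j. f j x)" if "x \<in> ball 0 R" for x
    by (rule geometric_half_tail(1)[of N _ 1]) (use N that in auto)
  have z0: "z0 \<in> ball 0 R" by (simp add: R_def)
  have "\<exists>g. \<forall>x\<in>ball 0 R. (\<lambda>n. f n x) sums (g x) \<and>
          (g has_derivative (\<lambda>h. \<Sum>j. D j x h)) (at x within ball 0 R)"
  proof (rule has_derivative_series[where f' = D and x = z0])
    show "(f n has_derivative D n x) (at x within ball 0 R)" for n x
      unfolding D_def by (rule has_derivative_at_withinI) (rule holomorphic_fun_frechet(1)[OF hol])
    show "(\<lambda>n. f n z0) sums (\<Sum>j. f j z0)" using sf[OF z0] by (rule summable_sums)
    fix e :: real assume "0 < e"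
    have "(\<lambda>n. 2 * (1 / 2 :: real) ^ n) \<longlonglongrightarrow> 2 * 0"
      by (intro tendsto_intros LIMSEQ_power_zero) auto
    then have "eventually (\<lambda>n. 2 * (1 / 2 :: real) ^ n < e) sequentially"
      using order_tendstoD(2)[of "\<lambda>n. 2 * (1 / 2 :: real) ^ n" 0 sequentially e] \<open>0 < e\<close> by simp
    then show "\<forall>\<^sub>F n in sequentially. \<forall>x\<in>ball 0 R. \<forall>h.
        norm ((\<Sum>i<n. D i x h) - (\<Sum>j. D j x h)) \<le> e * norm h"
      using eventually_ge_at_top[of N]
    proof eventually_elim
      case (elim n)
      show ?case
      proof (intro ballI allI)
        fix x h :: "complex ^ 'a" assume x: "x \<in> ball 0 R"
        have "norm ((\<Sum>i<n. D i x h) - (\<Sum>j. D j x h)) \<le> 2 * (1 / 2) ^ n * norm h"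
          by (rule geometric_half_tail(2)) (use DN x elim in auto)
        also have "\<dots> \<le> e * norm h" using elim by (intro mult_right_mono) auto
        finally show "norm ((\<Sum>i<n. D i x h) - (\<Sum>j. D j x h)) \<le> e * norm h" .
      qed
    qed
  qed (use z0 in auto)
  then obtain g where g: "\<And>x. x \<in> ball 0 R \<Longrightarrow> (\<lambda>n. f n x) sums (g x)"
    "\<And>x. x \<in> ball 0 R \<Longrightarrow> (g has_derivative (\<lambda>h. \<Sum>j. D j x h)) (at x within ball 0 R)"
    by blast
  have "(g has_derivative (\<lambda>h. \<Sum>j. D j z0 h)) (at z0)"
    using g(2)[OF z0] unfolding at_within_open[OF z0 open_ball] .
  then have "((\<lambda>z. \<Sum>j. f j z) has_derivative (\<lambda>h. \<Sum>j. D j z0 h)) (at z0)"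
    by (rule has_derivative_transform_within_open[where s = "ball 0 R"])
      (use z0 g(1) in \<open>auto intro: sums_unique\<close>)
  moreover have "(\<Sum>j. D j z0 (c *s v)) = c * (\<Sum>j. D j z0 v)" for c v
    using suminf_mult[OF sm[OF z0]] by (simp add: D_def holomorphic_fun_frechet(2)[OF hol])
  ultimately show "\<exists>D. ((\<lambda>z. \<Sum>j. f j z) has_derivative D) (at z0) \<and>
      (\<forall>c v. D (c *s v) = c * D v)" by blast
qed

section \<open>Approximation by polynomials\<close>

text \<open>Cauchy's inequality on the circle of radius \<open>2 * R\<close> bounds the
  \<open>k\<close>-th Taylor term on the disc of radius \<open>R\<close> by
  \<open>(1 / 2) ^ k * M\<close>, which leaves a geometric tail.\<close>

lemma Taylor_polynomial_error:
  assumes hol: "g holomorphic_on UNIV" and R: "0 < R"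
    and M: "\<And>t. norm t \<le> 2 * R \<Longrightarrow> norm (g t) \<le> M" and t: "norm t \<le> R"
  shows "norm ((\<Sum>k<n. (deriv ^^ k) g 0 / fact k * t ^ k) - g t) \<le> 2 * (1 / 2) ^ n * M"
proof -
  have c: "continuous_on A g" for A
    using holomorphic_on_imp_continuous_on[OF hol] continuous_on_subset by blast
  have h: "g holomorphic_on A" for A
    using hol holomorphic_on_subset by blast
  have M0: "0 \<le> M" using order_trans[OF norm_ge_zero M[of 0]] R by simp
  have b: "norm ((deriv ^^ k) g 0 / fact k * t ^ k) \<le> (1 / 2) ^ k * M" for k
  proof -
    have "norm ((deriv ^^ k) g 0) \<le> fact k * M / (2 * R) ^ k"
      by (rule Cauchy_inequality) (use R M h c in auto)
    then have "norm ((deriv ^^ k) g 0) / fact k * norm t ^ k \<le> (fact k * M / (2 * R) ^ k) / fact k * R ^ k"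
      using t R M0 by (intro mult_mono divide_right_mono power_mono) auto
    also have "\<dots> = (1 / 2) ^ k * M" using R by (simp add: field_simps power_mult_distrib)
    finally show ?thesis by (simp add: norm_mult norm_divide norm_power)
  qed
  have "(\<lambda>k. (deriv ^^ k) g 0 / fact k * (t - 0) ^ k) sums g t"
    by (rule holomorphic_power_series[where r = "R + 1"]) (use h t in auto)
  then have "g t = (\<Sum>k. (deriv ^^ k) g 0 / fact k * t ^ k)" by (simp add: sums_iff)
  then show ?thesis using geometric_half_tail(2)[OF b, of n] by simp
qed

definition root_of_unity :: "nat \<Rightarrow> nat \<Rightarrow> complex"
  where "root_of_unity n q = exp (2 * of_real pi * \<i> * of_nat q / of_nat n)"

lemma root_of_unity_norm [simp]: "norm (root_of_unity n q) = 1"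
  by (simp add: root_of_unity_def)

lemma root_of_unity_orthogonal:
  assumes "j < n" "k < n"
  shows "(\<Sum>q<n. root_of_unity n q ^ j / root_of_unity n q ^ k) = (if j = k then of_nat n else 0)"
proof (cases "j = k")
  case True
  have "root_of_unity n q \<noteq> 0" for q by (simp add: root_of_unity_def)
  then show ?thesis using True by simp
next
  case False
  define x where "x = root_of_unity n j / root_of_unity n k"
  have n: "n \<noteq> 0" using assms by simp
  \<comment> \<open>Both sides are the exponential of \<open>2 * pi * i * q * j / n\<close>.
    Exchanging index and exponent turns the sum over \<open>q\<close> into a geometric sum.\<close>
  have pw: "root_of_unity n q ^ j = root_of_unity n j ^ q" for q j
    by (simp add: root_of_unity_def flip: exp_of_nat_mult) (simp add: mult_ac)
  have "x \<noteq> 1"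
    using assms False complex_root_unity_eq[of n j k] n
    by (auto simp: x_def root_of_unity_def cong_def)
  moreover have "x ^ n = 1"
    using complex_root_unity[OF n] by (simp add: x_def power_divide root_of_unity_def)
  ultimately have "(\<Sum>q<n. x ^ q) = 0"
    by (simp add: geometric_sum)
  then show ?thesis using False by (simp add: pw x_def power_divide)
qed

text \<open>Interpolation at the \<open>n\<close>-th roots of unity scaled by \<open>R\<close>: its coefficients are finite
  combinations of values of \<open>g\<close>, so they depend holomorphically on parameters.\<close>

definition interpolant :: "real \<Rightarrow> nat \<Rightarrow> (complex \<Rightarrow> complex) \<Rightarrow> complex \<Rightarrow> complex"
  where "interpolant R n g t = (\<Sum>k<n. t ^ k * (\<Sum>q<n. g (of_real R * root_of_unity n q)
            * (1 / (of_nat n * of_real R ^ k * root_of_unity n q ^ k))))"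

text \<open>Orthogonality of the roots of unity isolates each coefficient, so interpolation at
  \<open>n\<close> nodes reproduces polynomials of degree below \<open>n\<close>.\<close>

lemma interpolant_polynomial:
  assumes "0 < R"
  shows "interpolant R n (\<lambda>t. \<Sum>j<n. c j * t ^ j) t = (\<Sum>k<n. c k * t ^ k)"
  unfolding interpolant_def
proof (rule sum.cong[OF refl])
  fix k assume k: "k \<in> {..<n}"
  let ?w = "root_of_unity n" and ?R = "of_real R :: complex"
  have "(\<Sum>q<n. (\<Sum>j<n. c j * (?R * ?w q) ^ j) * (1 / (of_nat n * ?R ^ k * ?w q ^ k)))
      = (\<Sum>q<n. \<Sum>j<n. c j * ?R ^ j / (of_nat n * ?R ^ k) * (?w q ^ j / ?w q ^ k))"
    by (simp add: sum_distrib_right sum_divide_distrib power_mult_distrib mult_ac)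
  also have "\<dots> = (\<Sum>j<n. c j * ?R ^ j / (of_nat n * ?R ^ k) * (\<Sum>q<n. ?w q ^ j / ?w q ^ k))"
    by (subst sum.swap) (simp add: sum_distrib_left)
  also have "\<dots> = (\<Sum>j<n. if j = k then c k else 0)"
    by (rule sum.cong) (use assms k in \<open>auto simp: root_of_unity_orthogonal\<close>)
  also have "\<dots> = c k" using k by simp
  finally show "t ^ k * (\<Sum>q<n. (\<Sum>j<n. c j * (?R * ?w q) ^ j) *
      (1 / (of_nat n * ?R ^ k * ?w q ^ k))) = c k * t ^ k"
    by (simp add: mult.commute)
qed

text \<open>The \<open>k\<close>-th coefficient is at most \<open>B / R ^ k\<close>, so each of the
  \<open>n\<close> terms is at most \<open>B\<close>. The crude factor \<open>n\<close> does no harm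
  next to the geometric decay of the Taylor error.\<close>

lemma interpolant_bound:
  assumes "0 < R" "norm t \<le> R" and B: "\<And>w. norm w = R \<Longrightarrow> norm (h w) \<le> B"
  shows "norm (interpolant R n h t) \<le> real n * B"
proof -
  have "norm (h (of_real R * root_of_unity n q) * (1 / (of_nat n * of_real R ^ k * root_of_unity n q ^ k)))
      \<le> B * (1 / (real n * R ^ k))" for q k
    using assms(1) B[of "of_real R * root_of_unity n q"]
    by (auto simp: norm_mult norm_divide norm_power intro!: divide_right_mono)
  then have "norm (\<Sum>q<n. h (of_real R * root_of_unity n q) * (1 / (of_nat n * of_real R ^ k * root_of_unity n q ^ k)))
      \<le> (\<Sum>q<n. B * (1 / (real n * R ^ k)))" for k
    by (intro sum_norm_le) auto
  then have b: "norm (\<Sum>q<n. h (of_real R * root_of_unity n q) * (1 / (of_nat n * of_real R ^ k * root_of_unity n q ^ k)))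
      \<le> B / R ^ k" if "k < n" for k
    using that by simp
  have B0: "0 \<le> B" using order_trans[OF norm_ge_zero B[of "of_real R"]] assms(1) by simp
  have "norm (interpolant R n h t) \<le> (\<Sum>k<n. B)"
    unfolding interpolant_def
  proof (rule sum_norm_le)
    fix k assume "k \<in> {..<n}"
    then have "norm (t ^ k * (\<Sum>q<n. h (of_real R * root_of_unity n q) * (1 / (of_nat n * of_real R ^ k * root_of_unity n q ^ k))))
       \<le> R ^ k * (B / R ^ k)"
      unfolding norm_mult norm_power
      by (intro mult_mono power_mono b assms) (use assms in auto)
    then show "norm (t ^ k * (\<Sum>q<n. h (of_real R * root_of_unity n q) * (1 / (of_nat n * of_real R ^ k * root_of_unity n q ^ k)))) \<le> B"
      using assms(1) by simp
  qed
  then show ?thesis by simp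
qed

text \<open>Interpolation is linear and fixes the Taylor polynomial \<open>T\<close>. Hence the
  error is the interpolant of \<open>T - g\<close> minus \<open>T - g\<close> itself, and
  \<open>T - g\<close> is geometrically small.\<close>

lemma interpolant_error:
  assumes hol: "g holomorphic_on UNIV" and R: "0 < R"
    and M: "\<And>t. norm t \<le> 2 * R \<Longrightarrow> norm (g t) \<le> M" and t: "norm t \<le> R"
  shows "norm (g t - interpolant R n g t) \<le> real (n + 1) * (2 * (1 / 2) ^ n * M)"
proof -
  define c where "c k = (deriv ^^ k) g 0 / fact k" for k
  define T where "T t = (\<Sum>k<n. c k * t ^ k)" for t
  have e: "norm (T t - g t) \<le> 2 * (1 / 2) ^ n * M" if "norm t \<le> R" for t
    unfolding T_def c_def by (rule Taylor_polynomial_error[OF hol R M that])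
  have "interpolant R n (\<lambda>t. T t - g t) t = interpolant R n T t - interpolant R n g t"
    by (simp add: interpolant_def sum_subtractf algebra_simps sum_distrib_left diff_divide_distrib)
  moreover have "interpolant R n T t = T t"
    unfolding T_def by (rule interpolant_polynomial[OF R])
  ultimately have "g t - interpolant R n g t = interpolant R n (\<lambda>t. T t - g t) t - (T t - g t)"
    by simp
  also have "norm \<dots> \<le> real n * (2 * (1 / 2) ^ n * M) + 2 * (1 / 2) ^ n * M"
    by (intro order_trans[OF norm_triangle_ineq4] add_mono interpolant_bound[OF R t] e t) simp
  finally show ?thesis by (simp add: algebra_simps)
qed

text \<open>Expressions for polynomials with Gaussian rational coefficients. As syntax they are
  countable at once, which the enumeration behind the universal tuple needs.\<close>

datatype 'n cpoly = Const rat rat | Coord 'n | Add "'n cpoly" "'n cpoly" | Mul "'n cpoly" "'n cpoly"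

instance cpoly :: (countable) countable
  by countable_datatype

primrec peval :: "'n::finite cpoly \<Rightarrow> 'n cspace \<Rightarrow> complex"
  where
    "peval (Const a b) z = Complex (of_rat a) (of_rat b)"
  | "peval (Coord i) z = z $ i"
  | "peval (Add p q) z = peval p z + peval q z"
  | "peval (Mul p q) z = peval p z * peval q z"

lemma holomorphic_fun_peval [simp, intro]: "holomorphic_fun (peval p)"
proof -
  have "holomorphic_fun (\<lambda>z. peval p z)" by (induction p) auto
  then show ?thesis by (simp add: eta_contract_eq)
qed

lemma holomorphic_fun_bounded_on_ball:
  assumes "holomorphic_fun f"
  obtains B where "0 < B" "\<And>z. norm z \<le> R \<Longrightarrow> norm (f z) \<le> B"
proof -
  have "compact (f ` cball 0 R)"
    by (intro compact_continuous_image continuous_at_imp_continuous_on ballI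
        holomorphic_fun_continuous[OF assms]) simp
  then obtain B where "0 < B" "\<forall>y\<in>f ` cball 0 R. norm y \<le> B"
    using compact_imp_bounded bounded_pos by metis
  then show ?thesis using that by auto
qed

section \<open>Density of the polynomials with Gaussian rational coefficients\<close>

definition approximable :: "('n::finite cspace \<Rightarrow> complex) \<Rightarrow> bool"
  where "approximable f \<longleftrightarrow>
    (\<forall>R e. 0 < e \<longrightarrow> (\<exists>p. \<forall>z. norm z \<le> R \<longrightarrow> norm (f z - peval p z) < e))"

lemma approximable_limit:
  assumes "\<And>R e. 0 < e \<Longrightarrow> \<exists>g. approximable g \<and> (\<forall>z. norm z \<le> R \<longrightarrow> norm (f z - g z) < e)"
  shows "approximable f"
  unfolding approximable_def
proof (intro allI impI)
  fix R e :: real assume "0 < e"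
  then obtain g where g: "approximable g" "\<And>z. norm z \<le> R \<Longrightarrow> norm (f z - g z) < e / 2"
    using assms[of "e / 2" R] by auto
  then obtain p where "\<And>z. norm z \<le> R \<Longrightarrow> norm (g z - peval p z) < e / 2"
    unfolding approximable_def using \<open>0 < e\<close> by (meson half_gt_zero)
  then have "norm ((f z - g z) + (g z - peval p z)) < e" if "norm z \<le> R" for z
    using g(2)[OF that] that norm_triangle_lt[of "f z - g z" "g z - peval p z" e]
    by (metis add_strict_mono field_sum_of_halves)
  then show "\<exists>p. \<forall>z. norm z \<le> R \<longrightarrow> norm (f z - peval p z) < e" by auto
qed

lemma approximable_peval: "approximable (peval p)"
  unfolding approximable_def by (metis diff_self norm_zero)

lemma approximable_const: "approximable (\<lambda>_. c)"
proof (rule approximable_limit)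
  fix R e :: real assume "0 < e"
  obtain a where a: "Re c < of_rat a" "of_rat a < Re c + e / 2"
    using of_rat_dense[of "Re c" "Re c + e / 2"] \<open>0 < e\<close> by auto
  obtain b where b: "Im c < of_rat b" "of_rat b < Im c + e / 2"
    using of_rat_dense[of "Im c" "Im c + e / 2"] \<open>0 < e\<close> by auto
  have "norm (c - Complex (of_rat a) (of_rat b)) < e"
    using a b cmod_le[of "c - Complex (of_rat a) (of_rat b)"] by simp
  then show "\<exists>g. approximable g \<and> (\<forall>z. norm z \<le> R \<longrightarrow> norm (c - g z) < e)"
    by (intro exI[of _ "peval (Const a b)"]) (auto intro: approximable_peval)
qed

lemma approximable_add:
  assumes "approximable f" "approximable g"
  shows "approximable (\<lambda>z. f z + g z)"
  unfolding approximable_def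
proof (intro allI impI)
  fix R e :: real assume "0 < e"
  then obtain p q where p: "\<And>z. norm z \<le> R \<Longrightarrow> norm (f z - peval p z) < e / 2"
    and q: "\<And>z. norm z \<le> R \<Longrightarrow> norm (g z - peval q z) < e / 2"
    using assms unfolding approximable_def by (meson half_gt_zero)
  have "norm (f z + g z - peval (Add p q) z) < e" if "norm z \<le> R" for z
    using norm_triangle_lt[of "f z - peval p z" "g z - peval q z" e] p[OF that] q[OF that]
    by (simp add: algebra_simps)
  then show "\<exists>p. \<forall>z. norm z \<le> R \<longrightarrow> norm (f z + g z - peval p z) < e" by blast
qed

lemma approximable_bounded_on_ball:
  assumes "approximable f"
  obtains B where "0 < B" "\<And>z. norm z \<le> R \<Longrightarrow> norm (f z) \<le> B"
proof -
  obtain p where p: "\<And>z. norm z \<le> R \<Longrightarrow> norm (f z - peval p z) < 1"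
    using assms unfolding approximable_def by (meson zero_less_one)
  obtain B where B: "0 < B" "\<And>z. norm z \<le> R \<Longrightarrow> norm (peval p z) \<le> B"
    using holomorphic_fun_bounded_on_ball[OF holomorphic_fun_peval] by blast
  have "norm (f z) \<le> B + 1" if "norm z \<le> R" for z
    using p[OF that] B(2)[OF that] norm_triangle_ineq[of "f z - peval p z" "peval p z"] by simp
  then show ?thesis using that[of "B + 1"] B(1) by simp
qed

lemma approximable_mult:
  assumes f: "approximable f" and g: "approximable g"
  shows "approximable (\<lambda>z. f z * g z)"
  unfolding approximable_def
proof (intro allI impI)
  fix R e :: real assume e: "0 < e"
  obtain B where B: "0 < B" "\<And>z. norm z \<le> R \<Longrightarrow> norm (f z) \<le> B"
    using approximable_bounded_on_ball[OF f] by blast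
  obtain q where q: "\<And>z. norm z \<le> R \<Longrightarrow> norm (g z - peval q z) < e / (2 * B)"
    using g e B(1) unfolding approximable_def by (meson divide_pos_pos mult_pos_pos zero_less_numeral)
  obtain C where C: "0 < C" "\<And>z. norm z \<le> R \<Longrightarrow> norm (peval q z) \<le> C"
    using holomorphic_fun_bounded_on_ball[OF holomorphic_fun_peval] by blast
  obtain p where p: "\<And>z. norm z \<le> R \<Longrightarrow> norm (f z - peval p z) < e / (2 * C)"
    using f e C(1) unfolding approximable_def by (meson divide_pos_pos mult_pos_pos zero_less_numeral)
  have "norm (f z * g z - peval (Mul p q) z) < e" if z: "norm z \<le> R" for z
  proof -
    have "f z * g z - peval (Mul p q) z = f z * (g z - peval q z) + (f z - peval p z) * peval q z"
      by (simp add: algebra_simps)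
    also have "norm \<dots> \<le> norm (f z) * norm (g z - peval q z) + norm (f z - peval p z) * norm (peval q z)"
      by (metis norm_mult norm_triangle_ineq)
    also have "\<dots> \<le> B * norm (g z - peval q z) + norm (f z - peval p z) * C"
      by (intro add_mono mult_left_mono mult_right_mono B C z) auto
    also have "\<dots> < B * (e / (2 * B)) + e / (2 * C) * C"
      by (intro add_strict_mono mult_strict_left_mono mult_strict_right_mono p q z B C)
    also have "\<dots> = e" using B C by (simp add: field_simps)
    finally show ?thesis .
  qed
  then show "\<exists>p. \<forall>z. norm z \<le> R \<longrightarrow> norm (f z * g z - peval p z) < e" by blast
qed

lemma approximable_sum:
  "(\<And>k. k \<in> I \<Longrightarrow> approximable (f k)) \<Longrightarrow> approximable (\<lambda>z. \<Sum>k\<in>I. f k z)"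
  by (induction I rule: infinite_finite_induct) (auto intro: approximable_add approximable_const)

lemma approximable_coord_power: "approximable (\<lambda>z. (z $ i) ^ k)"
proof (induction k)
  case (Suc k)
  have "peval (Coord i) = (\<lambda>z. z $ i)" by auto
  then have "approximable (\<lambda>z. z $ i)" using approximable_peval[of "Coord i"] by metis
  then show ?case using approximable_mult[OF _ Suc] by simp
qed (auto intro: approximable_const)

definition indep_of :: "'n::finite set \<Rightarrow> ('n cspace \<Rightarrow> 'b) \<Rightarrow> bool"
  where "indep_of D f \<longleftrightarrow> (\<forall>z w. (\<forall>i. i \<notin> D \<longrightarrow> z $ i = w $ i) \<longrightarrow> f z = f w)"

lemma indep_ofD: "indep_of D f \<Longrightarrow> (\<And>i. i \<notin> D \<Longrightarrow> z $ i = w $ i) \<Longrightarrow> f z = f w"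
  unfolding indep_of_def by blast

lemma indep_ofI: "(\<And>z w. (\<And>i. i \<notin> D \<Longrightarrow> z $ i = w $ i) \<Longrightarrow> f z = f w) \<Longrightarrow> indep_of D f"
  unfolding indep_of_def by blast

definition upd :: "'n::finite cspace \<Rightarrow> 'n \<Rightarrow> complex \<Rightarrow> 'n cspace"
  where "upd z i t = (\<chi> j. if j = i then t else z $ j)"

lemma upd_nth [simp]: "upd z i t $ j = (if j = i then t else z $ j)"
  by (simp add: upd_def)

lemma norm_axis: "norm (axis i c) = norm (c::complex)"
  by (simp add: norm_eq_sqrt_inner inner_axis_axis)

lemma norm_upd_le: "norm (upd z i t) \<le> 2 * norm z + norm t"
proof -
  have "upd z i t = z + axis i (t - z $ i)" by (simp add: vec_eq_iff axis_def)
  also have "norm \<dots> \<le> norm z + (norm t + norm z)"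
    using norm_triangle_ineq[of z "axis i (t - z $ i)"] norm_triangle_ineq4[of t "z $ i"]
      Finite_Cartesian_Product.norm_nth_le[of z i] by (simp add: norm_axis)
  finally show ?thesis by simp
qed

text \<open>Induction on the set of coordinates that matter: interpolate in the coordinate
  \<open>i\<close>. The coefficients are entire and no longer depend on \<open>z $ i\<close>, so the
  induction hypothesis approximates them.\<close>

lemma approximable_holomorphic_indep:
  assumes "finite S"
  shows "holomorphic_fun f \<Longrightarrow> indep_of (- S) f \<Longrightarrow> approximable f"
  using assms
proof (induction S arbitrary: f)
  case empty
  then have "f = (\<lambda>_. f 0)" by (auto intro: indep_ofD)
  then show ?case using approximable_const by metis
next
  case (insert i S)
  note hol = insert.prems(1)
  have gz: "(\<lambda>t. f (upd z i t)) holomorphic_on UNIV" for z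
  proof -
    obtain b where b: "\<And>t. upd z i t = b + t *s axis i 1"
    proof
      show "upd z i t = upd z i 0 + t *s axis i 1" for t
        by (simp add: vec_eq_iff axis_def)
    qed
    show ?thesis
      unfolding b using holomorphic_fun_line[OF hol, of b "axis i 1"]
      by (auto simp: holomorphic_on_open)
  qed
  define c where "c R n k z = (\<Sum>q<n. f (upd z i (of_real R * root_of_unity n q))
            * (1 / (of_nat n * of_real R ^ k * root_of_unity n q ^ k)))" for R n k z
  have "approximable (c R n k)" for R n k
  proof (rule insert.IH)
    have "holomorphic_map (\<lambda>z. upd z i t)" for t
      by (rule holomorphic_mapI, rename_tac j, case_tac "j = i") auto
    then show "holomorphic_fun (c R n k)"
      unfolding c_def by (intro holomorphic_fun_sum holomorphic_fun_mult holomorphic_fun_const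
          holomorphic_fun_compose[OF hol])
    have "f (upd z i t) = f (upd w i t)" if "\<And>j. j \<notin> - S \<Longrightarrow> z $ j = w $ j" for z w t
      by (rule indep_ofD[OF insert.prems(2)]) (use that in auto)
    then show "indep_of (- S) (c R n k)"
      unfolding c_def by (intro indep_ofI sum.cong refl) metis
  qed
  then have app: "approximable (\<lambda>z. interpolant R n (\<lambda>t. f (upd z i t)) (z $ i))" for R n
    unfolding interpolant_def c_def[symmetric]
    by (intro approximable_sum approximable_mult approximable_coord_power)
  show ?case
  proof (rule approximable_limit)
    fix R e :: real assume "0 < e"
    \<comment> \<open>The interpolation circle needs a positive radius.\<close>
    define R' where "R' = max R 1"
    \<comment> \<open>\<open>norm_upd_le\<close> bounds the points that occur by
      \<open>2 * norm z + norm t\<close>, with \<open>norm z\<close> at most \<open>R'\<close> and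
      \<open>norm t\<close> at most \<open>2 * R'\<close>.\<close>
    obtain M where M: "0 < M" "\<And>z. norm z \<le> 4 * R' \<Longrightarrow> norm (f z) \<le> M"
      using holomorphic_fun_bounded_on_ball[OF hol] by blast
    have "(\<lambda>n. real (n + 1) * (2 * (1 / 2) ^ n * M)) \<longlonglongrightarrow> 0" by real_asymp
    then have "\<forall>\<^sub>F n in sequentially. real (n + 1) * (2 * (1 / 2) ^ n * M) < e"
      using \<open>0 < e\<close> by (rule order_tendstoD(2))
    then obtain n where n: "real (n + 1) * (2 * (1 / 2) ^ n * M) < e"
      using eventually_happens'[OF sequentially_bot] by blast
    have "norm (f z - interpolant R' n (\<lambda>t. f (upd z i t)) (z $ i)) < e" if z: "norm z \<le> R" for z
    proof -
      have "norm (f (upd z i (z $ i)) - interpolant R' n (\<lambda>t. f (upd z i t)) (z $ i))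
          \<le> real (n + 1) * (2 * (1 / 2) ^ n * M)"
      proof (rule interpolant_error[OF gz])
        fix t :: complex assume "norm t \<le> 2 * R'"
        then show "norm (f (upd z i t)) \<le> M"
          using norm_upd_le[of z i t] z by (intro M(2)) (auto simp: R'_def)
      qed (use z Finite_Cartesian_Product.norm_nth_le[of z i] in \<open>auto simp: R'_def\<close>)
      moreover have "upd z i (z $ i) = z" by (simp add: vec_eq_iff)
      ultimately show ?thesis using n by simp
    qed
    then show "\<exists>g. approximable g \<and> (\<forall>z. norm z \<le> R \<longrightarrow> norm (f z - g z) < e)"
      using app by blast
  qed
qed

lemma approximable_holomorphic: "holomorphic_fun f \<Longrightarrow> approximable f"
  by (rule approximable_holomorphic_indep[of UNIV]) (auto intro!: indep_ofI arg_cong[of _ _ f] simp: vec_eq_iff)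

section \<open>A universal tuple of entire functions\<close>

text \<open>Decay along the diagonal in both directions: seen from one centre of the later series,
  the other centres lie on either side.\<close>

definition decaying :: "('n::finite cspace \<Rightarrow> complex) \<Rightarrow> bool"
  where "decaying v \<longleftrightarrow> (\<forall>R e. 0 < e \<longrightarrow> (\<exists>N::nat. \<forall>s::int. int N \<le> \<bar>s\<bar> \<longrightarrow>
    (\<forall>z. norm z \<le> R \<longrightarrow> norm (v (z + vec (of_int s))) \<le> e)))"

text \<open>An exponential bound is crude, but it is stable under sums and products and is still
  beaten by a Gaussian.\<close>

lemma peval_growth:
  obtains C b where "0 \<le> C" "0 \<le> b" "\<And>z. norm (peval p z) \<le> C * exp (b * norm z)"
proof -
  have "\<exists>C b. 0 \<le> C \<and> 0 \<le> b \<and> (\<forall>z. norm (peval p z) \<le> C * exp (b * norm z))"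
  proof (induction p)
    case (Const a b)
    show ?case by (intro exI[of _ "norm (Complex (of_rat a) (of_rat b))"] exI[of _ 0]) simp
  next
    case (Coord i)
    have "norm (z $ i) \<le> exp (norm z)" for z :: "complex ^ 'a"
      using Finite_Cartesian_Product.norm_nth_le[of z i] exp_ge_add_one_self[of "norm z"] by linarith
    then show ?case by (intro exI[of _ 1]) simp
  next
    case (Add p q)
    then obtain C b C' b' where *: "0 \<le> C" "0 \<le> b" "\<And>z. norm (peval p z) \<le> C * exp (b * norm z)"
      "0 \<le> C'" "0 \<le> b'" "\<And>z. norm (peval q z) \<le> C' * exp (b' * norm z)" by blast
    have "norm (peval p z + peval q z) \<le> (C + C') * exp ((b + b') * norm z)" for z
    proof -
      have "norm (peval p z + peval q z) \<le> C * exp (b * norm z) + C' * exp (b' * norm z)"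
        by (intro order_trans[OF norm_triangle_ineq] add_mono *)
      also have "\<dots> \<le> C * exp ((b + b') * norm z) + C' * exp ((b + b') * norm z)"
        using * by (intro add_mono mult_left_mono) (auto simp: mult_right_mono)
      finally show ?thesis by (simp add: distrib_right)
    qed
    then show ?case using * by (intro exI[of _ "C + C'"] exI[of _ "b + b'"]) auto
  next
    case (Mul p q)
    then obtain C b C' b' where *: "0 \<le> C" "0 \<le> b" "\<And>z. norm (peval p z) \<le> C * exp (b * norm z)"
      "0 \<le> C'" "0 \<le> b'" "\<And>z. norm (peval q z) \<le> C' * exp (b' * norm z)" by blast
    have "norm (peval p z * peval q z) \<le> (C * C') * exp ((b + b') * norm z)" for z
    proof -
      have "norm (peval p z * peval q z) \<le> (C * exp (b * norm z)) * (C' * exp (b' * norm z))"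
        unfolding norm_mult by (intro mult_mono *) (use * in auto)
      then show ?thesis by (simp add: exp_add algebra_simps)
    qed
    then show ?case using * by (intro exI[of _ "C * C'"] exI[of _ "b + b'"]) auto
  qed
  then show ?thesis using that by blast
qed

section \<open>Polynomials damped by a Gaussian\<close>

definition erase :: "'n::finite set \<Rightarrow> 'n cspace \<Rightarrow> 'n cspace"
  where "erase D z = (\<chi> j. if j \<in> D then 0 else z $ j)"

lemma norm_erase_le: "norm (erase D z) \<le> norm z"
  unfolding norm_vec_def erase_def by (rule L2_set_mono) auto

lemma erase_eq: "(\<And>i. i \<notin> D \<Longrightarrow> z $ i = w $ i) \<Longrightarrow> erase D z = erase D w"
  by (simp add: erase_def vec_eq_iff)

text \<open>\<open>erase\<close> forces independence of the coordinates in \<open>D\<close> whatever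
  the polynomial \<open>p\<close> is. The Gaussian in one coordinate \<open>i\<close> outside
  \<open>D\<close> suffices for decay, because a diagonal translation moves every
  coordinate.\<close>

definition gaussian_poly :: "'n::finite set \<Rightarrow> 'n \<Rightarrow> real \<Rightarrow> 'n cpoly \<Rightarrow> 'n cspace \<Rightarrow> complex"
  where "gaussian_poly D i d p z = peval p (erase D z) * exp (- of_real d * (z $ i)\<^sup>2)"

lemma holomorphic_fun_gaussian_poly: "holomorphic_fun (gaussian_poly D i d p)"
proof -
  have "holomorphic_map (erase D)"
    by (rule holomorphic_mapI, rename_tac j, case_tac "j \<in> D") (auto simp: erase_def)
  then have "holomorphic_fun (\<lambda>z. gaussian_poly D i d p z)"
    unfolding gaussian_poly_def
    by (intro holomorphic_fun_mult holomorphic_fun_exp holomorphic_fun_const holomorphic_fun_power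
        holomorphic_fun_nth holomorphic_fun_compose[OF holomorphic_fun_peval])
  then show ?thesis by (simp add: eta_contract_eq)
qed

lemma indep_of_gaussian_poly: "i \<notin> D \<Longrightarrow> indep_of D (gaussian_poly D i d p)"
  unfolding gaussian_poly_def by (rule indep_ofI, subst erase_eq) auto

lemma decaying_gaussian_poly:
  assumes d: "0 < d"
  shows "decaying (gaussian_poly D i d p)"
  unfolding decaying_def
proof (intro allI impI)
  fix R e :: real assume e: "0 < e"
  obtain C b where C: "0 \<le> C" "0 \<le> b" "\<And>z. norm (peval p z) \<le> C * exp (b * norm z)"
    using peval_growth by blast
  define K where "K = norm (vec 1 :: complex ^ 'a)"
  \<comment> \<open>The bound at distance \<open>x = \<bar>s\<bar>\<close>: growth of the polynomial
    times the modulus of the Gaussian, which is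
    \<open>exp (- d * ((Re w)\<^sup>2 - (Im w)\<^sup>2))\<close> at \<open>w\<close>. The shift
    enlarges \<open>Re w\<close> only.\<close>
  define h where "h x = C * exp (b * (R + x * K)) * exp (- d * ((x - R)\<^sup>2 - R\<^sup>2))" for x :: real
  have "(\<lambda>n::nat. h (real n)) \<longlonglongrightarrow> 0"
  proof -
    have "(\<lambda>n::nat. exp (b * R + (b * K + 2 * d * R) * real n - d * (real n)\<^sup>2)) \<longlonglongrightarrow> 0"
      using d by real_asymp
    then have "(\<lambda>n::nat. C * exp (b * R + (b * K + 2 * d * R) * real n - d * (real n)\<^sup>2)) \<longlonglongrightarrow> C * 0"
      by (rule tendsto_mult_left)
    moreover have "h x = C * exp (b * R + (b * K + 2 * d * R) * x - d * x\<^sup>2)" for x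
      unfolding h_def by (simp add: power2_eq_square algebra_simps flip: exp_add)
    ultimately show ?thesis by simp
  qed
  then have "\<forall>\<^sub>F n in sequentially. h (real n) < e"
    using e by (rule order_tendstoD(2))
  then obtain N where N: "\<And>n. N \<le> n \<Longrightarrow> h (real n) < e"
    unfolding eventually_sequentially by blast
  have "norm (gaussian_poly D i d p (z + vec (of_int s))) \<le> e"
    if s: "int (N + nat \<lceil>R\<rceil>) \<le> \<bar>s\<bar>" and z: "norm z \<le> R" for s z
  proof -
    define x where "x = real (nat \<bar>s\<bar>)"
    have xs: "x = \<bar>real_of_int s\<bar>" by (simp add: x_def)
    \<comment> \<open>This is why the threshold contains \<open>nat \<lceil>R\<rceil>\<close>:
      squaring below preserves the inequality only if \<open>x - R\<close> is nonnegative.\<close>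
    have xR: "R \<le> x" using s unfolding xs by linarith
    define y where "y = z $ i"
    have y: "\<bar>Re y\<bar> \<le> R" "\<bar>Im y\<bar> \<le> R"
      using Finite_Cartesian_Product.norm_nth_le[of z i] z abs_Re_le_cmod[of y] abs_Im_le_cmod[of y] by (auto simp: y_def)
    have "(x - R)\<^sup>2 \<le> (Re y + s)\<^sup>2"
      unfolding abs_le_square_iff[symmetric] using xR xs y by linarith
    moreover have "(Im y)\<^sup>2 \<le> R\<^sup>2"
      unfolding abs_le_square_iff[symmetric] using y by linarith
    ultimately have "(x - R)\<^sup>2 - R\<^sup>2 \<le> (Re y + s)\<^sup>2 - (Im y)\<^sup>2" by linarith
    then have g: "norm (exp (- of_real d * ((z + vec (of_int s)) $ i)\<^sup>2)) \<le> exp (- d * ((x - R)\<^sup>2 - R\<^sup>2))"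
      using d by (simp add: power2_eq_square y_def)
    have "vec (of_int s) = (of_int s :: complex) *s (vec 1 :: complex ^ 'a)"
      by (simp add: vec_eq_iff)
    then have "norm (z + vec (of_int s)) \<le> R + x * K"
      using norm_triangle_ineq[of z "vec (of_int s)"] z
      by (simp add: norm_vector_scalar_mult K_def xs)
    then have "norm (erase D (z + vec (of_int s))) \<le> R + x * K"
      using norm_erase_le order_trans by blast
    then have "norm (peval p (erase D (z + vec (of_int s)))) \<le> C * exp (b * (R + x * K))"
      by (intro order_trans[OF C(3)] mult_left_mono) (use C in \<open>auto intro: mult_left_mono\<close>)
    then have "norm (gaussian_poly D i d p (z + vec (of_int s))) \<le> h x"
      unfolding gaussian_poly_def norm_mult h_def
      by (intro mult_mono g) (use C in auto)
    moreover have "h x < e" unfolding x_def by (rule N) (use s in linarith)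
    ultimately show ?thesis by simp
  qed
  then show "\<exists>N::nat. \<forall>s::int. int N \<le> \<bar>s\<bar> \<longrightarrow>
    (\<forall>z. norm z \<le> R \<longrightarrow> norm (gaussian_poly D i d p (z + vec (of_int s))) \<le> e)" by blast
qed

text \<open>First choose \<open>p\<close>, which is then bounded by some \<open>B\<close> on the
  ball; afterwards flatten the Gaussian until it differs from 1 there by less than
  \<open>e / (2 * B)\<close>. Restricting the parameter to \<open>1 / real (Suc q)\<close> keeps the
  family countable.\<close>

lemma gaussian_poly_approximation:
  assumes f: "holomorphic_fun f" "indep_of D f" and e: "0 < e"
  obtains p q where "\<And>z. norm z \<le> R \<Longrightarrow> norm (f z - gaussian_poly D i (1 / real (Suc q)) p z) < e"
proof -
  obtain p where p: "\<And>z. norm z \<le> R \<Longrightarrow> norm (f z - peval p z) < e / 2"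
    using approximable_holomorphic[OF f(1)] e unfolding approximable_def by (meson half_gt_zero)
  obtain B where B: "0 < B" "\<And>z. norm z \<le> R \<Longrightarrow> norm (peval p z) \<le> B"
    using holomorphic_fun_bounded_on_ball[OF holomorphic_fun_peval] by blast
  have "isCont exp (0::complex)" by simp
  then obtain d where d: "0 < d" "\<And>w::complex. norm w < d \<Longrightarrow> norm (exp w - 1) < e / (2 * B)"
    unfolding continuous_at_eps_delta dist_norm using e B(1)
    by (metis diff_zero divide_pos_pos exp_zero mult_pos_pos zero_less_numeral)
  obtain q where q: "R\<^sup>2 / d < real q" using reals_Archimedean2 by blast
  have "norm (f z - gaussian_poly D i (1 / real (Suc q)) p z) < e" if z: "norm z \<le> R" for z
  proof -
    have ez: "norm (erase D z) \<le> R" using norm_erase_le z order_trans by blast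
    have "norm (z $ i) \<le> R" using Finite_Cartesian_Product.norm_nth_le[of z i] z by linarith
    then have "norm ((z $ i)\<^sup>2) \<le> R\<^sup>2" by (simp add: norm_power power_mono)
    then have "norm (- of_real (1 / real (Suc q)) * (z $ i)\<^sup>2) \<le> R\<^sup>2 / real (Suc q)"
      by (simp add: norm_mult norm_divide divide_right_mono del: of_nat_Suc)
    also have "\<dots> < d" using q d(1) by (simp add: field_simps)
    finally have E: "norm (exp (- of_real (1 / real (Suc q)) * (z $ i)\<^sup>2) - 1) < e / (2 * B)"
      by (rule d(2))
    have "f z = f (erase D z)" by (rule indep_ofD[OF f(2)]) (simp add: erase_def)
    then have "f z - gaussian_poly D i (1 / real (Suc q)) p z = (f (erase D z) - peval p (erase D z))
        - peval p (erase D z) * (exp (- of_real (1 / real (Suc q)) * (z $ i)\<^sup>2) - 1)"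
      by (simp add: gaussian_poly_def algebra_simps)
    also have "norm \<dots> \<le> norm (f (erase D z) - peval p (erase D z))
        + norm (peval p (erase D z)) * norm (exp (- of_real (1 / real (Suc q)) * (z $ i)\<^sup>2) - 1)"
      by (metis norm_mult norm_triangle_ineq4)
    also have "\<dots> < e / 2 + B * (e / (2 * B))"
      by (intro add_less_le_mono p ez mult_mono B(2) less_imp_le[OF E]) (use B in auto)
    also have "\<dots> = e" using B by simp
    finally show ?thesis .
  qed
  then show ?thesis using that by blast
qed

text \<open>The translates of the \<open>v j\<close> are placed so far apart that near the \<open>j\<close>-th centre the sum
  differs from \<open>v j\<close> by at most the tail of a geometric series.\<close>

lemma translate_series:
  fixes v :: "nat \<Rightarrow> 'k::finite \<Rightarrow> 'n::finite cspace \<Rightarrow> complex"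
  assumes hol: "\<And>j k. holomorphic_fun (v j k)" and dec: "\<And>j k. decaying (v j k)"
  obtains \<phi> and m :: "nat \<Rightarrow> nat" where "\<And>k. holomorphic_fun (\<phi> k)"
    "\<And>k D. (\<And>j. indep_of D (v j k)) \<Longrightarrow> indep_of D (\<phi> k)"
    "\<And>j k z. norm z \<le> real j \<Longrightarrow>
      norm (\<phi> k (z + vec (of_nat (m j))) - v j k z) \<le> (real j + 1) * (1 / 2) ^ j"
proof -
  define P where "P i k j N \<longleftrightarrow> (\<forall>s::int. int N \<le> \<bar>s\<bar> \<longrightarrow>
    (\<forall>z. norm z \<le> real j \<longrightarrow> norm (v i k (z + vec (of_int s))) \<le> (1 / 2) ^ j))" for i k j N
  have "\<exists>N. P i k j N" for i k j
    unfolding P_def using dec[of i k] unfolding decaying_def by (meson zero_less_divide_1_iff zero_less_numeral zero_less_power)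
  then obtain N where "\<And>i k j. P i k j (N i k j)" by metis
  then have N: "norm (v i k (z + vec (of_int s))) \<le> (1 / 2) ^ j"
    if "int (N i k j) \<le> \<bar>s\<bar>" "norm z \<le> real j" for i k j s z
    using that unfolding P_def by blast
  \<comment> \<open>A single threshold dominating those of all terms up to \<open>j\<close> and all
    members of the tuple.\<close>
  define th where "th j = (\<Sum>i\<le>j. \<Sum>k\<in>UNIV. N i k j)" for j
  have th: "N i k j \<le> th j" if "i \<le> j" for i k j
  proof -
    have "N i k j \<le> (\<Sum>k\<in>UNIV. N i k j)" by (rule member_le_sum) auto
    also have "\<dots> \<le> th j" unfolding th_def by (rule member_le_sum) (use that in auto)
    finally show ?thesis .
  qed
  \<comment> \<open>With partial sums as centres, the distance of the \<open>i\<close>-th from the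
    \<open>j\<close>-th is at least the threshold of the larger index.\<close>
  define m where "m j = (\<Sum>i\<le>j. th i)" for j
  have m_gap: "m i + th j \<le> m j" if "i < j" for i j
  proof -
    have "m i + th j = (\<Sum>l\<in>insert j {..i}. th l)" using that by (simp add: m_def)
    also have "\<dots> \<le> m j" unfolding m_def by (rule sum_mono2) (use that in auto)
    finally show ?thesis .
  qed
  have small: "norm (v i k (z + vec (of_int (int (m j) - int (m i))))) \<le> (1 / 2) ^ max i j"
    if "i \<noteq> j" "norm z \<le> real (max i j)" for i j k z
  proof (rule N)
    have "int (th (max i j)) \<le> \<bar>int (m j) - int (m i)\<bar>"
      using m_gap[of i j] m_gap[of j i] that(1) by (cases "i < j") auto
    then show "int (N i k (max i j)) \<le> \<bar>int (m j) - int (m i)\<bar>"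
      using th[of i "max i j" k] by linarith
  qed (rule that)
  define \<phi> where "\<phi> k z = (\<Sum>i. v i k (z + vec (of_int (- int (m i)))))" for k z
  \<comment> \<open>The same estimate seen from the origin; it gives convergence on every
    ball.\<close>
  have small0: "norm (v i k (z + vec (of_int (- int (m i))))) \<le> (1 / 2) ^ i" if "norm z \<le> real i" for i k z
  proof (rule N)
    have "th i \<le> m i" unfolding m_def by (rule member_le_sum) auto
    then show "int (N i k i) \<le> \<bar>- int (m i)\<bar>" using th[of i i k] by linarith
  qed (rule that)
  show ?thesis
  proof (rule that)
    show "holomorphic_fun (\<phi> k)" for k
    proof -
      have "holomorphic_fun (\<lambda>z. \<phi> k z)"
        unfolding \<phi>_def
      proof (rule holomorphic_fun_suminf)
        show "holomorphic_fun (\<lambda>z. v i k (z + vec (of_int (- int (m i)))))" for i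
          by (rule holomorphic_fun_translate[OF hol])
        show "\<exists>N. \<forall>j\<ge>N. \<forall>z. norm z \<le> R \<longrightarrow> norm (v j k (z + vec (of_int (- int (m j))))) \<le> (1 / 2) ^ j" for R
          by (rule exI[of _ "nat \<lceil>R\<rceil>"]) (intro allI impI small0, linarith)
      qed
      then show ?thesis by (simp add: eta_contract_eq)
    qed
    show "indep_of D (\<phi> k)" if "\<And>j. indep_of D (v j k)" for k D
      unfolding \<phi>_def by (intro indep_ofI arg_cong[of _ _ suminf] ext indep_ofD[OF that]) simp
    fix j k and z :: "complex ^ 'n" assume z: "norm z \<le> real j"
    define a where "a i = v i k (z + vec (of_int (int (m j) - int (m i))))" for i
    have tail: "norm ((\<Sum>i<Suc j. a i) - (\<Sum>i. a i)) \<le> 2 * (1 / 2) ^ Suc j * 1"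
    proof (rule geometric_half_tail(2))
      fix i assume "Suc j \<le> i"
      then show "norm (a i) \<le> (1 / 2) ^ i * 1"
        unfolding a_def using small[of i j z k] z by (auto simp: max_absorb1)
    qed
    have head: "norm (\<Sum>i<j. a i) \<le> (\<Sum>i<j. (1 / 2) ^ j)"
    proof (rule sum_norm_le)
      fix i assume "i \<in> {..<j}"
      then show "norm (a i) \<le> (1 / 2) ^ j"
        unfolding a_def using small[of i j z k] z by (auto simp: max_absorb2)
    qed
    have "\<phi> k (z + vec (of_nat (m j))) = (\<Sum>i. a i)"
      unfolding \<phi>_def a_def
      by (intro arg_cong[of _ _ suminf] ext arg_cong[of _ _ "v _ k"]) (simp add: vec_eq_iff)
    moreover have "a j = v j k z" by (simp add: a_def)
    \<comment> \<open>Without the \<open>j\<close>-th term there remain \<open>j\<close> earlier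
      terms of size at most \<open>(1 / 2) ^ j\<close> and a tail of the same size, whence the
      factor \<open>real j + 1\<close>.\<close>
    ultimately have "\<phi> k (z + vec (of_nat (m j))) - v j k z = (\<Sum>i<j. a i) - ((\<Sum>i<Suc j. a i) - (\<Sum>i. a i))"
      by simp
    also have "norm \<dots> \<le> (\<Sum>i<j. (1 / 2) ^ j) + 2 * (1 / 2) ^ Suc j * 1"
      by (intro order_trans[OF norm_triangle_ineq4] add_mono head tail)
    also have "\<dots> = (real j + 1) * (1 / 2) ^ j" by (simp add: algebra_simps)
    finally show "norm (\<phi> k (z + vec (of_nat (m j))) - v j k z) \<le> (real j + 1) * (1 / 2) ^ j" .
  qed
qed

text \<open>Continuous convergence; for maps between Euclidean spaces it amounts to locally uniform
  convergence to a continuous limit, and it composes without further estimates.\<close>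

definition cconv :: "(nat \<Rightarrow> 'a::topological_space \<Rightarrow> 'b::topological_space) \<Rightarrow> ('a \<Rightarrow> 'b) \<Rightarrow> bool"
  where "cconv X f \<longleftrightarrow> (\<forall>z w. z \<longlonglongrightarrow> w \<longrightarrow> (\<lambda>j. X j (z j)) \<longlonglongrightarrow> f w)"

lemma cconvI: "(\<And>z w. z \<longlonglongrightarrow> w \<Longrightarrow> (\<lambda>j. X j (z j)) \<longlonglongrightarrow> f w) \<Longrightarrow> cconv X f"
  by (simp add: cconv_def)

lemma cconvD: "cconv X f \<Longrightarrow> z \<longlonglongrightarrow> w \<Longrightarrow> (\<lambda>j. X j (z j)) \<longlonglongrightarrow> f w"
  by (simp add: cconv_def)

text \<open>The terms of the series run through all tuples of damped polynomials. Decoding a whole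
  tuple from one index yields one sequence of translates serving all \<open>k\<close> at
  once.\<close>

lemma universal_translates:
  fixes D :: "'k::finite \<Rightarrow> 'n::finite set"
  assumes c: "\<And>k. c k \<notin> D k"
  obtains \<phi> where "\<And>k. holomorphic_fun (\<phi> k)" "\<And>k. indep_of (D k) (\<phi> k)"
    "\<And>\<psi>. (\<And>k. holomorphic_fun (\<psi> k)) \<Longrightarrow> (\<And>k. indep_of (D k) (\<psi> k)) \<Longrightarrow>
      \<exists>m::nat \<Rightarrow> nat. \<forall>k. cconv (\<lambda>j z. \<phi> k (z + vec (of_nat (m j)))) (\<psi> k)"
proof -
  \<comment> \<open>The last component is a dummy: it makes each tuple occur at arbitrarily large
    indices, where the error \<open>(real j + 1) * (1 / 2) ^ j\<close> is small.\<close>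
  define dec :: "nat \<Rightarrow> ('k \<Rightarrow> 'n cpoly \<times> nat) \<times> nat" where "dec = from_nat"
  define v where "v j k = gaussian_poly (D k) (c k) (1 / real (Suc (snd (fst (dec j) k)))) (fst (fst (dec j) k))" for j k
  have "\<And>j k. holomorphic_fun (v j k)" "\<And>j k. decaying (v j k)"
    unfolding v_def by (rule holomorphic_fun_gaussian_poly) (rule decaying_gaussian_poly, simp)
  then obtain \<phi> and m :: "nat \<Rightarrow> nat" where \<phi>: "\<And>k. holomorphic_fun (\<phi> k)"
    "\<And>k D. (\<And>j. indep_of D (v j k)) \<Longrightarrow> indep_of D (\<phi> k)"
    and m: "\<And>j k z. norm z \<le> real j \<Longrightarrow>
      norm (\<phi> k (z + vec (of_nat (m j))) - v j k z) \<le> (real j + 1) * (1 / 2) ^ j"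
    using translate_series[of v] by blast
  show ?thesis
  proof (rule that[of \<phi>])
    show "holomorphic_fun (\<phi> k)" for k by (rule \<phi>)
    show "indep_of (D k) (\<phi> k)" for k
      by (rule \<phi>) (unfold v_def, rule indep_of_gaussian_poly[OF c])
    fix \<psi> :: "'k \<Rightarrow> 'n cspace \<Rightarrow> complex"
    assume \<psi>: "\<And>k. holomorphic_fun (\<psi> k)" "\<And>k. indep_of (D k) (\<psi> k)"
    have "\<exists>j\<ge>r. \<forall>k z. norm z \<le> real r \<longrightarrow> norm (\<psi> k z - v j k z) < 1 / real (Suc r)" for r
    proof -
      have "\<exists>pq. \<forall>z. norm z \<le> real r \<longrightarrow>
          norm (\<psi> k z - gaussian_poly (D k) (c k) (1 / real (Suc (snd pq))) (fst pq) z) < 1 / real (Suc r)" for k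
        using gaussian_poly_approximation[OF \<psi>, where e = "1 / real (Suc r)" and R = "real r" and i = "c k"]
        by (metis fst_conv snd_conv zero_less_divide_1_iff of_nat_0_less_iff zero_less_Suc)
      then obtain t where t: "\<And>k z. norm z \<le> real r \<Longrightarrow>
          norm (\<psi> k z - gaussian_poly (D k) (c k) (1 / real (Suc (snd (t k)))) (fst (t k)) z) < 1 / real (Suc r)"
        by metis
      have "inj (\<lambda>x::nat. to_nat (t, x))" by (auto simp: inj_def)
      then have "infinite (range (\<lambda>x::nat. to_nat (t, x)))" by (rule range_inj_infinite)
      then obtain x :: nat where "r \<le> to_nat (t, x)"
        unfolding infinite_nat_iff_unbounded_le by blast
      moreover have "v (to_nat (t, x)) k z = gaussian_poly (D k) (c k) (1 / real (Suc (snd (t k)))) (fst (t k)) z" for k z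
        by (simp add: v_def dec_def)
      ultimately show ?thesis using t by metis
    qed
    then obtain J where J: "\<And>r. r \<le> J r"
      "\<And>r k z. norm z \<le> real r \<Longrightarrow> norm (\<psi> k z - v (J r) k z) < 1 / real (Suc r)" by metis
    show "\<exists>m::nat \<Rightarrow> nat. \<forall>k. cconv (\<lambda>j z. \<phi> k (z + vec (of_nat (m j)))) (\<psi> k)"
    proof (intro exI[of _ "\<lambda>r. m (J r)"] allI cconvI)
      fix k and z :: "nat \<Rightarrow> 'n cspace" and w assume z: "z \<longlonglongrightarrow> w"
      obtain B where B: "\<And>r. norm (z r) \<le> B"
        using convergent_imp_Bseq[OF convergentI[OF z]] by (auto simp: Bseq_def)
      define err where "err r = (real (J r) + 1) * (1 / 2) ^ J r + 1 / real (Suc r)" for r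
      have "(\<lambda>j::nat. (real j + 1) * (1 / 2) ^ j) \<longlonglongrightarrow> 0" by real_asymp
      moreover have "filterlim J at_top sequentially"
        by (rule filterlim_at_top_mono[OF filterlim_ident]) (use J(1) in auto)
      ultimately have "(\<lambda>r. (real (J r) + 1) * (1 / 2) ^ J r) \<longlonglongrightarrow> 0"
        by (rule filterlim_compose)
      moreover have "(\<lambda>r. 1 / real (Suc r)) \<longlonglongrightarrow> 0" by real_asymp
      ultimately have "err \<longlonglongrightarrow> 0 + 0" unfolding err_def by (rule tendsto_add)
      then have err: "err \<longlonglongrightarrow> 0" by simp
      have "(\<lambda>r. \<phi> k (z r + vec (of_nat (m (J r)))) - \<psi> k (z r)) \<longlonglongrightarrow> 0"
      proof (rule Lim_null_comparison[OF _ err])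
        show "\<forall>\<^sub>F r in sequentially.
            norm (\<phi> k (z r + vec (of_nat (m (J r)))) - \<psi> k (z r)) \<le> err r"
          using eventually_ge_at_top[of "nat \<lceil>B\<rceil>"]
        proof eventually_elim
          case (elim r)
          have r: "norm (z r) \<le> real r" using B[of r] elim by linarith
          then have rJ: "norm (z r) \<le> real (J r)" using J(1)[of r] by linarith
          have "norm (\<phi> k (z r + vec (of_nat (m (J r)))) - \<psi> k (z r)) \<le>
             norm (\<phi> k (z r + vec (of_nat (m (J r)))) - v (J r) k (z r)) + norm (\<psi> k (z r) - v (J r) k (z r))"
            by (metis norm_triangle_sub norm_minus_commute diff_add_cancel add_diff_eq norm_triangle_ineq)
          also have "\<dots> \<le> err r"
            unfolding err_def by (intro add_mono m rJ less_imp_le[OF J(2)] r)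
          finally show ?case .
        qed
      qed
      moreover have "(\<lambda>r. \<psi> k (z r)) \<longlonglongrightarrow> \<psi> k w"
        by (rule isCont_tendsto_compose[OF holomorphic_fun_continuous[OF \<psi>(1)] z])
      ultimately have "(\<lambda>r. (\<phi> k (z r + vec (of_nat (m (J r)))) - \<psi> k (z r)) + \<psi> k (z r)) \<longlonglongrightarrow> 0 + \<psi> k w"
        by (rule tendsto_add)
      then show "(\<lambda>r. \<phi> k (z r + vec (of_nat (m (J r))))) \<longlonglongrightarrow> \<psi> k w" by simp
    qed
  qed
qed

section \<open>Subgroups of the automorphism group\<close>

lemma hol_aut_mult [simp]: "F \<otimes>\<^bsub>hol_aut\<^esub> G = F \<circ> G"
  and hol_aut_one [simp]: "\<one>\<^bsub>hol_aut\<^esub> = id"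
  by (simp_all add: hol_aut_def)

lemma hol_autD:
  assumes "F \<in> carrier hol_aut"
  shows "bij F" "holomorphic_map F" "holomorphic_map (inv_into UNIV F)"
    "inv_into UNIV F (F z) = z" "F (inv_into UNIV F z) = z"
  using assms by (auto simp: hol_aut_def bij_is_inj bij_is_surj surj_f_inv_f)

lemma hol_autI:
  assumes "holomorphic_map F" "holomorphic_map G" "\<And>z. G (F z) = z" "\<And>z. F (G z) = z"
  shows "F \<in> carrier hol_aut" and "inv_into UNIV F = G"
proof -
  show "inv_into UNIV F = G"
    by (rule inv_unique_comp) (use assms in auto)
  moreover have "bij F" by (rule bijI') (use assms in metis)+
  ultimately show "F \<in> carrier hol_aut" using assms by (simp add: hol_aut_def)
qed

lemma hol_aut_compose:
  assumes "F \<in> carrier hol_aut" "G \<in> carrier hol_aut"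
  shows "F \<circ> G \<in> carrier hol_aut"
    and "inv_into UNIV (F \<circ> G) = inv_into UNIV G \<circ> inv_into UNIV F"
proof -
  have "holomorphic_map (F \<circ> G)" "holomorphic_map (inv_into UNIV G \<circ> inv_into UNIV F)"
    using hol_autD(2,3)[OF assms(1)] hol_autD(2,3)[OF assms(2)] by auto
  from hol_autI[OF this] show "F \<circ> G \<in> carrier hol_aut"
    "inv_into UNIV (F \<circ> G) = inv_into UNIV G \<circ> inv_into UNIV F"
    using hol_autD(4,5)[OF assms(1)] hol_autD(4,5)[OF assms(2)] by auto
qed

lemma hol_aut_inv_closed:
  assumes "F \<in> carrier hol_aut"
  shows "inv_into UNIV F \<in> carrier hol_aut"
  by (rule hol_autI(1)[where G = F]) (use hol_autD[OF assms] in auto)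

lemma id_in_hol_aut: "id \<in> carrier hol_aut"
  by (rule hol_autI(1)[where G = id]) (auto intro!: holomorphic_mapI)

lemma group_hol_aut: "group (hol_aut :: ('n::finite cspace \<Rightarrow> 'n cspace) monoid)"
proof (rule groupI)
  fix F :: "'n cspace \<Rightarrow> 'n cspace" assume F: "F \<in> carrier hol_aut"
  have "inv_into UNIV F \<circ> F = id" using hol_autD(4)[OF F] by auto
  then show "\<exists>G\<in>carrier hol_aut. G \<otimes>\<^bsub>hol_aut\<^esub> F = \<one>\<^bsub>hol_aut\<^esub>"
    using hol_aut_inv_closed[OF F] by auto
qed (auto simp: hol_aut_compose id_in_hol_aut simp del: id_apply)

interpretation hol_aut: group hol_aut
  by (rule group_hol_aut)

lemma inv_hol_aut: "F \<in> carrier hol_aut \<Longrightarrow> inv\<^bsub>hol_aut\<^esub> F = inv_into UNIV F"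
  by (rule hol_aut.inv_equality) (auto simp: hol_autD hol_aut_inv_closed)

lemma subgroup_hol_autI:
  assumes "\<Gamma> \<subseteq> carrier hol_aut" "id \<in> \<Gamma>" "\<And>F G. F \<in> \<Gamma> \<Longrightarrow> G \<in> \<Gamma> \<Longrightarrow> F \<circ> G \<in> \<Gamma>"
    "\<And>F. F \<in> \<Gamma> \<Longrightarrow> inv_into UNIV F \<in> \<Gamma>"
  shows "subgroup \<Gamma> hol_aut"
proof (rule hol_aut.subgroupI)
  fix F assume "F \<in> \<Gamma>"
  then show "inv\<^bsub>hol_aut\<^esub> F \<in> \<Gamma>"
    using assms(1,4) inv_hol_aut by (metis subsetD)
qed (use assms in auto)

lemma subgroup_hol_autD:
  assumes "subgroup \<Gamma> hol_aut"
  shows "F \<in> \<Gamma> \<Longrightarrow> F \<in> carrier hol_aut" "id \<in> \<Gamma>" "F \<in> \<Gamma> \<Longrightarrow> G \<in> \<Gamma> \<Longrightarrow> F \<circ> G \<in> \<Gamma>"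
    "F \<in> \<Gamma> \<Longrightarrow> inv_into UNIV F \<in> \<Gamma>"
proof -
  show c: "F \<in> carrier hol_aut" if "F \<in> \<Gamma>" for F
    using subgroup.subset[OF assms] that by auto
  show "id \<in> \<Gamma>" using subgroup.one_closed[OF assms] by simp
  show "F \<in> \<Gamma> \<Longrightarrow> G \<in> \<Gamma> \<Longrightarrow> F \<circ> G \<in> \<Gamma>"
    using subgroup.m_closed[OF assms, of F G] by simp
  show "inv_into UNIV F \<in> \<Gamma>" if "F \<in> \<Gamma>"
    using subgroup.m_inv_closed[OF assms that] inv_hol_aut[OF c[OF that]] by simp
qed

text \<open>Allows generation arguments to run in coordinates in which the translation is diagonal.
  The map \<open>A\<close> itself need not belong to \<open>\<Gamma>\<close>.\<close>

lemma subgroup_conjugates: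
  assumes \<Gamma>: "subgroup \<Gamma> hol_aut" and A: "A \<in> carrier hol_aut"
  shows "subgroup {X \<in> carrier hol_aut. inv_into UNIV A \<circ> X \<circ> A \<in> \<Gamma>} hol_aut"
proof (rule subgroup_hol_autI)
  note A' = hol_autD(4,5)[OF A]
  show "id \<in> {X \<in> carrier hol_aut. inv_into UNIV A \<circ> X \<circ> A \<in> \<Gamma>}"
  proof -
    have "inv_into UNIV A \<circ> id \<circ> A = id" using A' by auto
    then show ?thesis using subgroup_hol_autD(2)[OF \<Gamma>] by (simp add: id_in_hol_aut)
  qed
next
  note A' = hol_autD(4,5)[OF A]
  fix F G assume F: "F \<in> {X \<in> carrier hol_aut. inv_into UNIV A \<circ> X \<circ> A \<in> \<Gamma>}"
    and G: "G \<in> {X \<in> carrier hol_aut. inv_into UNIV A \<circ> X \<circ> A \<in> \<Gamma>}"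
  have "inv_into UNIV A \<circ> (F \<circ> G) \<circ> A = (inv_into UNIV A \<circ> F \<circ> A) \<circ> (inv_into UNIV A \<circ> G \<circ> A)"
    using A' by auto
  also have "\<dots> \<in> \<Gamma>" by (rule subgroup_hol_autD(3)[OF \<Gamma>]) (use F G in auto)
  finally show "F \<circ> G \<in> {X \<in> carrier hol_aut. inv_into UNIV A \<circ> X \<circ> A \<in> \<Gamma>}"
    using F G hol_aut_compose(1) by auto
next
  fix F assume F: "F \<in> {X \<in> carrier hol_aut. inv_into UNIV A \<circ> X \<circ> A \<in> \<Gamma>}"
  then have Fc: "F \<in> carrier hol_aut" and F\<Gamma>: "inv_into UNIV A \<circ> F \<circ> A \<in> \<Gamma>" by auto
  have "inv_into UNIV (inv_into UNIV A \<circ> F \<circ> A) = inv_into UNIV A \<circ> inv_into UNIV F \<circ> A"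
    by (rule inv_unique_comp) (use hol_autD(4,5)[OF A] hol_autD(4,5)[OF Fc] in auto)
  then show "inv_into UNIV F \<in> {X \<in> carrier hol_aut. inv_into UNIV A \<circ> X \<circ> A \<in> \<Gamma>}"
    using subgroup_hol_autD(4)[OF \<Gamma> F\<Gamma>] hol_aut_inv_closed[OF Fc] by simp
qed auto

section \<open>Overshears and shears in arbitrary coordinates\<close>

definition coord_overshear ::
    "'n::finite \<Rightarrow> ('n cspace \<Rightarrow> complex) \<Rightarrow> ('n cspace \<Rightarrow> complex) \<Rightarrow> 'n cspace \<Rightarrow> 'n cspace"
  where "coord_overshear i f g z = (\<chi> j. if j = i then exp (f z) * z $ i + g z else z $ j)"

lemma coord_overshear_nth:
  "coord_overshear i f g z $ j = (if j = i then exp (f z) * z $ i + g z else z $ j)"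
  by (simp add: coord_overshear_def)

definition hol_indep :: "'n::finite set \<Rightarrow> ('n cspace \<Rightarrow> complex) set"
  where "hol_indep D = {f. holomorphic_fun f \<and> indep_of D f}"

lemma hol_indepI: "holomorphic_fun f \<Longrightarrow> indep_of D f \<Longrightarrow> f \<in> hol_indep D"
  and hol_indepD: "f \<in> hol_indep D \<Longrightarrow> holomorphic_fun f" "f \<in> hol_indep D \<Longrightarrow> indep_of D f"
  by (auto simp: hol_indep_def)

lemma hol_indep_const [simp, intro]: "(\<lambda>_. c) \<in> hol_indep D"
  by (intro hol_indepI indep_ofI) auto

lemma hol_indep_nth: "i \<notin> D \<Longrightarrow> (\<lambda>z. z $ i) \<in> hol_indep D"
  by (intro hol_indepI indep_ofI) auto

lemma hol_indep_add: "f \<in> hol_indep D \<Longrightarrow> g \<in> hol_indep D \<Longrightarrow> (\<lambda>z. f z + g z) \<in> hol_indep D"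
  and hol_indep_diff: "f \<in> hol_indep D \<Longrightarrow> g \<in> hol_indep D \<Longrightarrow> (\<lambda>z. f z - g z) \<in> hol_indep D"
  and hol_indep_mult: "f \<in> hol_indep D \<Longrightarrow> g \<in> hol_indep D \<Longrightarrow> (\<lambda>z. f z * g z) \<in> hol_indep D"
  and hol_indep_uminus: "f \<in> hol_indep D \<Longrightarrow> (\<lambda>z. - f z) \<in> hol_indep D"
  and hol_indep_exp: "f \<in> hol_indep D \<Longrightarrow> (\<lambda>z. exp (f z)) \<in> hol_indep D"
  unfolding hol_indep_def indep_of_def by auto metis+

lemmas hol_indep_intros = hol_indep_const hol_indep_nth hol_indep_add hol_indep_diff
  hol_indep_mult hol_indep_uminus hol_indep_exp

lemma hol_indep_compose:
  assumes f: "f \<in> hol_indep D" and L: "holomorphic_map L"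
    and "\<And>z w j. (\<And>i. i \<notin> E \<Longrightarrow> z $ i = w $ i) \<Longrightarrow> j \<notin> D \<Longrightarrow> L z $ j = L w $ j"
  shows "(\<lambda>z. f (L z)) \<in> hol_indep E"
proof (rule hol_indepI)
  show "holomorphic_fun (\<lambda>z. f (L z))"
    by (rule holomorphic_fun_compose[OF hol_indepD(1)[OF f] L])
  show "indep_of E (\<lambda>z. f (L z))"
    by (rule indep_ofI, rule indep_ofD[OF hol_indepD(2)[OF f]]) (rule assms(3))
qed

lemma coord_overshear_invariant:
  assumes "h \<in> hol_indep {i}"
  shows "h (coord_overshear i f g z) = h z"
  by (rule indep_ofD[OF hol_indepD(2)[OF assms]]) (simp add: coord_overshear_nth)

lemma holomorphic_map_coord_overshear:
  assumes "holomorphic_fun f" "holomorphic_fun g"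
  shows "holomorphic_map (coord_overshear i f g)"
  by (rule holomorphic_mapI, rename_tac j, case_tac "j = i")
    (use assms in \<open>auto simp: coord_overshear_nth\<close>)

lemma coord_overshear_hol_aut:
  assumes f: "f \<in> hol_indep {i}" and g: "g \<in> hol_indep {i}"
  shows "coord_overshear i f g \<in> carrier hol_aut"
    and "inv_into UNIV (coord_overshear i f g) =
      coord_overshear i (\<lambda>z. - f z) (\<lambda>z. - (exp (- f z) * g z))"
proof -
  let ?h = "\<lambda>z. - (exp (- f z) * g z)"
  have h: "?h \<in> hol_indep {i}" by (intro hol_indep_intros f g)
  have "coord_overshear i (\<lambda>z. - f z) ?h (coord_overshear i f g z) = z"
    "coord_overshear i f g (coord_overshear i (\<lambda>z. - f z) ?h z) = z" for z
    by (auto simp: vec_eq_iff coord_overshear_nth coord_overshear_invariant[OF f]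
        coord_overshear_invariant[OF g] algebra_simps simp flip: exp_add mult.assoc)
  from hol_autI[OF _ _ this] show "coord_overshear i f g \<in> carrier hol_aut"
    "inv_into UNIV (coord_overshear i f g) = coord_overshear i (\<lambda>z. - f z) ?h"
    using holomorphic_map_coord_overshear[OF hol_indepD(1)[OF f] hol_indepD(1)[OF g]]
      holomorphic_map_coord_overshear[OF holomorphic_fun_uminus[OF hol_indepD(1)[OF f]] hol_indepD(1)[OF h]]
    by blast+
qed

definition coords_shear :: "'n::finite set \<Rightarrow> ('n \<Rightarrow> 'n cspace \<Rightarrow> complex) \<Rightarrow> 'n cspace \<Rightarrow> 'n cspace"
  where "coords_shear D h z = (\<chi> j. if j \<in> D then z $ j + h j z else z $ j)"

lemma coords_shear_nth: "coords_shear D h z $ j = (if j \<in> D then z $ j + h j z else z $ j)"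
  by (simp add: coords_shear_def)

lemma hol_indep_mono: "f \<in> hol_indep D \<Longrightarrow> E \<subseteq> D \<Longrightarrow> f \<in> hol_indep E"
  unfolding hol_indep_def indep_of_def by blast

text \<open>Every \<open>h j\<close> ignores all coordinates in \<open>D\<close>, so displacing one
  of them leaves the other displacements unchanged, and the map is a product of shears in single
  coordinates.\<close>

lemma coords_shear_in_subgroup:
  assumes \<Gamma>: "subgroup \<Gamma> hol_aut"
    and sh: "\<And>j g. g \<in> hol_indep {j} \<Longrightarrow> coord_overshear j (\<lambda>_. 0) g \<in> \<Gamma>"
    and h: "\<And>j. j \<in> D \<Longrightarrow> h j \<in> hol_indep D"
  shows "coords_shear D h \<in> \<Gamma>"
proof -
  have "finite D" by simp
  have "D' \<subseteq> D \<Longrightarrow> coords_shear D' h \<in> \<Gamma>" if "finite D'" for D'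
    using that
  proof (induction D' rule: finite_induct)
    case empty
    have "coords_shear {} h = id" by (auto simp: fun_eq_iff coords_shear_nth vec_eq_iff)
    then show ?case using subgroup_hol_autD(2)[OF \<Gamma>] by metis
  next
    case (insert j D')
    have "h j (coords_shear D' h z) = h j z" for z
      by (rule indep_ofD[OF hol_indepD(2)[OF h[of j]]]) (use insert in \<open>auto simp: coords_shear_nth\<close>)
    then have "coords_shear (insert j D') h = coord_overshear j (\<lambda>_. 0) (h j) \<circ> coords_shear D' h"
      using insert(2) by (auto simp: fun_eq_iff vec_eq_iff coords_shear_nth coord_overshear_nth)
    moreover have "h j \<in> hol_indep {j}"
      using insert by (auto intro: hol_indep_mono[OF h])
    moreover have "coords_shear D' h \<in> \<Gamma>" using insert by auto
    ultimately show ?case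
      using subgroup_hol_autD(3)[OF \<Gamma> sh] by metis
  qed
  then show ?thesis using \<open>finite D\<close> by simp
qed

section \<open>Complex linear maps and conjugation by them\<close>

definition clinear :: "('n::finite cspace \<Rightarrow> 'n cspace) \<Rightarrow> bool"
  where "clinear L \<longleftrightarrow> (\<forall>z w. L (z + w) = L z + L w) \<and> (\<forall>c z. L (c *s z) = c *s L z)"

lemma clinearD:
  assumes "clinear L"
  shows "L (z + w) = L z + L w" "L (c *s z) = c *s L z" "L 0 = 0"
proof -
  show "L (z + w) = L z + L w" and h: "L (c *s z) = c *s L z" for c z
    using assms by (auto simp: clinear_def)
  show "L 0 = 0" using h[of 0 0] by simp
qed

lemma clinear_compose: "clinear L \<Longrightarrow> clinear M \<Longrightarrow> clinear (L \<circ> M)"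
  by (simp add: clinear_def)

lemma clinear_matrix: "clinear ((*v) A)"
  by (simp add: clinear_def matrix_vector_right_distrib vector_scalar_commute)

lemma clinear_holomorphic_map:
  assumes "clinear L"
  shows "holomorphic_map L"
proof (rule holomorphic_mapI)
  fix i
  have s: "L (\<Sum>j\<in>J. z $ j *s axis j 1) = (\<Sum>j\<in>J. z $ j *s L (axis j 1))" for J z
    by (induction J rule: infinite_finite_induct) (auto simp: clinearD[OF assms])
  have "(\<lambda>z. L z $ i) = (\<lambda>z. \<Sum>j\<in>UNIV. z $ j * L (axis j 1) $ i)"
  proof
    show "L z $ i = (\<Sum>j\<in>UNIV. z $ j * L (axis j 1) $ i)" for z
      using arg_cong[OF s[of z UNIV], of "\<lambda>w. w $ i"] by (simp add: basis_expansion)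
  qed
  moreover have "holomorphic_fun (\<lambda>z. \<Sum>j\<in>UNIV. z $ j * L (axis j 1) $ i)"
    by (intro holomorphic_fun_sum holomorphic_fun_mult holomorphic_fun_nth holomorphic_fun_const)
  ultimately show "holomorphic_fun (\<lambda>z. L z $ i)" by (simp only:)
qed

lemma clinear_hol_aut:
  assumes "clinear L" "clinear L'" "\<And>z. L' (L z) = z" "\<And>z. L (L' z) = z"
  shows "L \<in> carrier hol_aut" "inv_into UNIV L = L'"
  using hol_autI[of L L'] assms clinear_holomorphic_map by auto

text \<open>A linear conjugate of a coordinate overshear moves points in the direction \<open>v\<close> of the
  transformed axis. If \<open>v $ i \<noteq> 0\<close>, a product of transvections turns \<open>v\<close> into a multiple of the
  \<open>i\<close>-th axis, and hence the map into an overshear in the \<open>i\<close>-th coordinate.\<close>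

lemma linear_conjugate_in_subgroup:
  assumes \<Gamma>: "subgroup \<Gamma> hol_aut"
    and sh: "\<And>i f g. f \<in> hol_indep {i} \<Longrightarrow> g \<in> hol_indep {i} \<Longrightarrow>
      coord_overshear i (\<lambda>z. o' * f z) g \<in> \<Gamma>"
    and L: "clinear L" "clinear L'" "\<And>z. L' (L z) = z" "\<And>z. L (L' z) = z"
    and f: "f \<in> hol_indep {k}" and g: "g \<in> hol_indep {k}"
  shows "L' \<circ> coord_overshear k (\<lambda>z. o' * f z) g \<circ> L \<in> \<Gamma>"
proof -
  define v where "v = L' (axis k 1)"
  have "L v = axis k 1" by (simp add: v_def L)
  then have "v \<noteq> 0" using clinearD(3)[OF L(1)] by (metis axis_eq_0_iff zero_neq_one)
  then obtain i where i: "v $ i \<noteq> 0" by (auto simp: vec_eq_iff)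
  \<comment> \<open>\<open>B 1\<close> sends the \<open>i\<close>-th axis vector to \<open>v\<close>
    divided by \<open>v $ i\<close>, and \<open>B (- 1)\<close> is its inverse.\<close>
  define B where "B c = coords_shear (- {i}) (\<lambda>j z. c * (v $ j / v $ i) * z $ i)" for c
  have sh0: "coord_overshear i (\<lambda>_. 0) g \<in> \<Gamma>" if "g \<in> hol_indep {i}" for i g
    using sh[OF hol_indep_const[of 0] that] by simp
  have B\<Gamma>: "B c \<in> \<Gamma>" for c
    unfolding B_def by (rule coords_shear_in_subgroup[OF \<Gamma> sh0], assumption) (intro hol_indep_intros, simp)
  have BB: "B (- 1) (B 1 z) = z" "B 1 (B (- 1) z) = z" for z
    by (auto simp: B_def coords_shear_nth vec_eq_iff)
  have Blin: "clinear (B c)" for c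
    by (auto simp: clinear_def B_def coords_shear_nth vec_eq_iff algebra_simps add_divide_distrib)
  define C where "C = L \<circ> B 1"
  have Clin: "clinear C" unfolding C_def by (rule clinear_compose[OF L(1) Blin])
  have "B 1 (axis i 1) = (1 / v $ i) *s v"
    using i by (auto simp: B_def coords_shear_nth vec_eq_iff axis_def)
  then have "C (axis i 1) = (1 / v $ i) *s axis k 1"
    by (simp add: C_def clinearD[OF L(1)] \<open>L v = axis k 1\<close>)
  then have Ci: "C (z + c *s axis i 1) = C z + (c / v $ i) *s axis k 1" for z c
    by (simp add: clinearD[OF Clin])
  have agree: "C w = C z + ((w $ i - z $ i) / v $ i) *s axis k 1"
    if "\<And>j. j \<notin> {i} \<Longrightarrow> z $ j = w $ j" for z w
  proof -
    have "w = z + (w $ i - z $ i) *s axis i 1" using that by (auto simp: vec_eq_iff axis_def)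
    then show ?thesis using Ci[of z "w $ i - z $ i"] by simp
  qed
  have comp: "(\<lambda>z. h (C z)) \<in> hol_indep {i}" if "h \<in> hol_indep {k}" for h
  proof (rule hol_indep_compose[OF that clinear_holomorphic_map[OF Clin]])
    fix z w :: "'a cspace" and j assume zw: "\<And>i'. i' \<notin> {i} \<Longrightarrow> z $ i' = w $ i'" and "j \<notin> {k}"
    then show "C z $ j = C w $ j"
      using arg_cong[OF agree[OF zw], of "\<lambda>u. u $ j"] by (simp add: axis_def)
  qed
  define F where "F z = f (C z)" for z
  \<comment> \<open>\<open>r\<close> is the part of \<open>C z $ k\<close> that does not involve
    \<open>z $ i\<close>. Solving for the new value of the \<open>i\<close>-th coordinate gives the
    additive term \<open>H\<close>; the exponent is merely pulled back, so for \<open>o' = 0\<close>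
    a shear stays a shear.\<close>
  define r where "r z = C z $ k - z $ i / v $ i" for z
  define H where "H z = v $ i * ((exp (o' * F z) - 1) * r z + g (C z))" for z
  have F: "F \<in> hol_indep {i}" unfolding F_def by (rule comp[OF f])
  have r: "r \<in> hol_indep {i}"
  proof (rule hol_indepI)
    show "holomorphic_fun r"
      using clinear_holomorphic_map[OF Clin] i unfolding r_def divide_inverse
      by (intro holomorphic_fun_diff holomorphic_fun_mult holomorphic_fun_nth holomorphic_fun_const)
        (auto simp: holomorphic_map_def)
    show "indep_of {i} r"
    proof (rule indep_ofI)
      fix z w :: "'a cspace" assume "\<And>j. j \<notin> {i} \<Longrightarrow> z $ j = w $ j"
      from agree[OF this] show "r z = r w"
        by (simp add: r_def axis_def diff_divide_distrib)
    qed
  qed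
  have H: "H \<in> hol_indep {i}" unfolding H_def by (intro hol_indep_intros F r comp[OF g])
  have key: "C (coord_overshear i (\<lambda>z. o' * F z) H z) = coord_overshear k (\<lambda>z. o' * f z) g (C z)" for z
  proof -
    define y where "y = coord_overshear i (\<lambda>z. o' * F z) H z"
    have "C y = C z + ((y $ i - z $ i) / v $ i) *s axis k 1"
      by (rule agree) (simp add: y_def coord_overshear_nth)
    moreover have "(y $ i - z $ i) / v $ i = (exp (o' * F z) - 1) * C z $ k + g (C z)"
      using i by (simp add: y_def coord_overshear_nth H_def r_def field_simps)
    ultimately have Cy: "C y = C z + ((exp (o' * F z) - 1) * C z $ k + g (C z)) *s axis k 1" by simp
    have "C y = coord_overshear k (\<lambda>z. o' * f z) g (C z)"
      by (simp add: Cy vec_eq_iff coord_overshear_nth axis_def F_def algebra_simps)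
    then show ?thesis by (simp only: y_def)
  qed
  have LB: "L (B 1 z) = C z" for z by (simp add: C_def)
  have "L' \<circ> coord_overshear k (\<lambda>z. o' * f z) g \<circ> L = B 1 \<circ> coord_overshear i (\<lambda>z. o' * F z) H \<circ> B (- 1)"
  proof
    fix z
    have "coord_overshear k (\<lambda>z. o' * f z) g (L z) = L (B 1 (coord_overshear i (\<lambda>z. o' * F z) H (B (- 1) z)))"
      by (simp add: LB key) (simp add: C_def BB)
    then show "(L' \<circ> coord_overshear k (\<lambda>z. o' * f z) g \<circ> L) z =
        (B 1 \<circ> coord_overshear i (\<lambda>z. o' * F z) H \<circ> B (- 1)) z"
      by (simp add: L)
  qed
  then show ?thesis
    using sh[OF F H] B\<Gamma> subgroup_hol_autD(3)[OF \<Gamma>] by metis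
qed

section \<open>The twist and the shear groups\<close>

lemma next_coord_less:
  fixes i :: "'n::{finite, linorder}"
  assumes "i \<noteq> last_coord"
  shows "i < next_coord i" and "j < next_coord i \<longleftrightarrow> j \<le> i"
proof -
  have "{j. i < j} \<noteq> {}"
  proof -
    have "i \<le> last_coord" by (simp add: last_coord_def)
    then have "i < last_coord" using assms by simp
    then show ?thesis by blast
  qed
  then show lt: "i < next_coord i" unfolding next_coord_def using Min_in[of "{j. i < j}"] by auto
  have "next_coord i \<le> j" if "i < j"
    unfolding next_coord_def using that by (intro Min_le) auto
  then show "j < next_coord i \<longleftrightarrow> j \<le> i"
    using lt by (meson leD leI le_less_trans)
qed

lemma first_coord_le: "first_coord \<le> (i :: 'n::{finite, linorder})"
  and le_last_coord: "i \<le> last_coord"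
  by (simp_all add: first_coord_def last_coord_def)

lemma prev_coord:
  fixes i :: "'n::{finite, linorder}"
  assumes "i \<noteq> first_coord"
  obtains j where "j \<noteq> last_coord" "next_coord j = i"
proof
  define j where "j = Max {j. j < i}"
  have "first_coord < i" using assms first_coord_le[of i] by simp
  then have "j \<in> {j. j < i}" unfolding j_def by (intro Max_in) auto
  then have ji: "j < i" by simp
  then show l: "j \<noteq> last_coord" using le_last_coord[of i] by auto
  have "k \<le> j" if "k < i" for k unfolding j_def using that by simp
  then show "next_coord j = i"
    using next_coord_less[OF l] ji by (metis leD linorder_less_linear)
qed

lemma coord_induct [case_names first_coord next_coord]:
  fixes i :: "'n::{finite, linorder}"
  assumes "P first_coord" "\<And>i. i \<noteq> last_coord \<Longrightarrow> P i \<Longrightarrow> P (next_coord i)"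
  shows "P i"
proof (induction "card {j. j < i}" arbitrary: i rule: less_induct)
  case less
  show ?case
  proof (cases "i = first_coord")
    case False
    then obtain j where j: "j \<noteq> last_coord" "next_coord j = i" by (rule prev_coord)
    have "{k. k < j} \<subset> {k. k < i}" using next_coord_less(1)[OF j(1)] j(2) by auto
    then have "card {k. k < j} < card {k. k < i}" by (intro psubset_card_mono) auto
    then show ?thesis using less[of j] assms(2)[OF j(1)] j(2) by simp
  qed (use assms in simp)
qed

lemma next_coord_eq_iff:
  "i \<noteq> last_coord \<Longrightarrow> j \<noteq> last_coord \<Longrightarrow> next_coord i = next_coord j \<longleftrightarrow> i = j"
  using next_coord_less(2)[of i j] next_coord_less(2)[of j i] next_coord_less(1)[of i] next_coord_less(1)[of j]
  by (metis order_antisym)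

lemma next_coord_neq_first: "i \<noteq> last_coord \<Longrightarrow> next_coord i \<noteq> first_coord"
  using next_coord_less(1)[of i] first_coord_le[of i] by auto

text \<open>This is \<open>(- 1) ^ (n - 1)\<close>, the sign of an \<open>n\<close>-cycle; it gives
  the twist determinant 1.\<close>

abbreviation twist_sign :: "'n::{finite, linorder} itself \<Rightarrow> complex"
  where "twist_sign _ \<equiv> - ((- 1) ^ CARD('n))"

lemma twist_sign_square: "twist_sign TYPE('n::{finite, linorder}) * twist_sign TYPE('n) = 1"
  by (simp flip: power_mult_distrib)

lemma twist_nth:
  "twist z $ i = (if i = last_coord then twist_sign TYPE('n) * z $ first_coord else z $ next_coord i)"
  for z :: "'n::{finite, linorder} cspace"
  by (simp add: twist_def)

definition untwist :: "'n cspace \<Rightarrow> 'n::{finite, linorder} cspace"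
  where "untwist z = (\<chi> i. if i = first_coord then twist_sign TYPE('n) * z $ last_coord
    else z $ (THE j. j \<noteq> last_coord \<and> next_coord j = i))"

lemma untwist_first: "untwist z $ first_coord = twist_sign TYPE('n) * z $ last_coord"
  for z :: "'n::{finite, linorder} cspace"
  by (simp add: untwist_def)

lemma untwist_next:
  assumes "i \<noteq> last_coord"
  shows "untwist z $ next_coord i = z $ i"
proof -
  have "(THE j. j \<noteq> last_coord \<and> next_coord j = next_coord i) = i"
    by (rule the_equality) (use assms next_coord_eq_iff in auto)
  then show ?thesis using next_coord_neq_first[OF assms] by (simp add: untwist_def)
qed

lemma
  fixes z :: "'n::{finite, linorder} cspace"
  shows untwist_twist: "untwist (twist z) = z" and twist_untwist: "twist (untwist z) = z"
proof -
  show "untwist (twist z) = z"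
  proof (rule vec_eq_iff[THEN iffD2, rule_format])
    fix i
    show "untwist (twist z) $ i = z $ i"
    proof (cases "i = first_coord")
      case True
      then show ?thesis
        using twist_sign_square[where 'n = 'n]
        by (simp only: untwist_first twist_nth refl if_True mult.assoc[symmetric] mult_1_left)
    next
      case False
      then obtain j where "j \<noteq> last_coord" "next_coord j = i" by (rule prev_coord)
      then show ?thesis using untwist_next[of j] by (auto simp: twist_nth)
    qed
  qed
  show "twist (untwist z) = z"
    using twist_sign_square[where 'n = 'n]
    by (simp only: vec_eq_iff twist_nth untwist_first mult.assoc[symmetric] mult_1_left)
      (auto simp: untwist_next)
qed

lemma clinear_twist: "clinear twist"
  by (simp add: clinear_def vec_eq_iff twist_nth algebra_simps)

lemma clinear_untwist: "clinear untwist"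
  by (simp add: clinear_def vec_eq_iff untwist_def algebra_simps)

lemma twist_hol_aut: "twist \<in> carrier hol_aut" and inv_twist: "inv_into UNIV twist = untwist"
  using clinear_hol_aut[OF clinear_twist clinear_untwist untwist_twist twist_untwist] by auto

text \<open>Conjugation by the twist carries overshears in one coordinate to overshears in the next.\<close>

lemma coord_overshears_in_subgroup:
  fixes \<Gamma> :: "('n cspace \<Rightarrow> 'n::{finite, linorder} cspace) set"
  assumes \<Gamma>: "subgroup \<Gamma> hol_aut" and tw: "twist \<in> \<Gamma>"
    and sh: "\<And>f g. f \<in> hol_indep {last_coord} \<Longrightarrow> g \<in> hol_indep {last_coord} \<Longrightarrow>
      coord_overshear last_coord (\<lambda>z. o' * f z) g \<in> \<Gamma>"
    and fg: "f \<in> hol_indep {i}" "g \<in> hol_indep {i}"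
  shows "coord_overshear i (\<lambda>z. o' * f z) g \<in> \<Gamma>"
proof -
  have conj: "untwist \<circ> X \<circ> twist \<in> \<Gamma>" if "X \<in> \<Gamma>" for X
    using subgroup_hol_autD(3)[OF \<Gamma> subgroup_hol_autD(3)[OF \<Gamma> subgroup_hol_autD(4)[OF \<Gamma> tw] that] tw]
    unfolding inv_twist .
  have hu: "holomorphic_map (untwist :: 'n cspace \<Rightarrow> 'n cspace)"
    by (rule clinear_holomorphic_map[OF clinear_untwist])
  show ?thesis
    using fg
  proof (induction i arbitrary: f g rule: coord_induct)
    case first_coord
    let ?e = "twist_sign TYPE('n)"
    have h: "(\<lambda>z. h (untwist z)) \<in> hol_indep {last_coord}" if "h \<in> hol_indep {first_coord}" for h :: "'n cspace \<Rightarrow> complex"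
    proof (rule hol_indep_compose[OF that hu])
      fix z w :: "'n cspace" and j :: 'n
      assume zw: "\<And>i. i \<notin> {last_coord} \<Longrightarrow> z $ i = w $ i" and "j \<notin> {first_coord}"
      then obtain k where "k \<noteq> last_coord" "next_coord k = j" using prev_coord[of j] by auto
      then show "untwist z $ j = untwist w $ j" using zw untwist_next[of k] by auto
    qed
    \<comment> \<open>Only the additive term picks up the sign: multiplication by the exponential
      commutes with multiplication by \<open>?e\<close>.\<close>
    have t: "twist (coord_overshear first_coord (\<lambda>z. o' * f z) g z) =
        coord_overshear last_coord (\<lambda>z. o' * f (untwist z)) (\<lambda>z. ?e * g (untwist z)) (twist z)" for z
    proof (rule vec_eq_iff[THEN iffD2, rule_format])
      fix j
      show "twist (coord_overshear first_coord (\<lambda>z. o' * f z) g z) $ j =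
        coord_overshear last_coord (\<lambda>z. o' * f (untwist z)) (\<lambda>z. ?e * g (untwist z)) (twist z) $ j"
        using next_coord_neq_first[of j]
        by (auto simp: twist_nth coord_overshear_nth untwist_twist algebra_simps)
    qed
    have "coord_overshear first_coord (\<lambda>z. o' * f z) g =
      untwist \<circ> coord_overshear last_coord (\<lambda>z. o' * f (untwist z)) (\<lambda>z. ?e * g (untwist z)) \<circ> twist"
      by (rule ext) (simp only: o_apply t[symmetric] untwist_twist)
    moreover have "coord_overshear last_coord (\<lambda>z. o' * f (untwist z)) (\<lambda>z. ?e * g (untwist z)) \<in> \<Gamma>"
      using first_coord by (intro sh h hol_indep_mult hol_indep_const)
    ultimately show ?case using conj by metis
  next
    case (next_coord i)
    have h: "(\<lambda>z. h (untwist z)) \<in> hol_indep {i}" if "h \<in> hol_indep {next_coord i}" for h :: "'n cspace \<Rightarrow> complex"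
    proof (rule hol_indep_compose[OF that hu])
      fix z w :: "'n cspace" and j :: 'n
      assume zw: "\<And>k. k \<notin> {i} \<Longrightarrow> z $ k = w $ k" and j: "j \<notin> {next_coord i}"
      show "untwist z $ j = untwist w $ j"
      proof (cases "j = first_coord")
        case True
        then show ?thesis using zw[of last_coord] next_coord(1) by (simp add: untwist_first)
      next
        case False
        then obtain k where "k \<noteq> last_coord" "next_coord k = j" using prev_coord[of j] by auto
        then show ?thesis using zw[of k] untwist_next[of k] j by auto
      qed
    qed
    have t: "twist (coord_overshear (next_coord i) (\<lambda>z. o' * f z) g z) =
        coord_overshear i (\<lambda>z. o' * f (untwist z)) (\<lambda>z. g (untwist z)) (twist z)" for z
    proof (rule vec_eq_iff[THEN iffD2, rule_format])
      fix j
      show "twist (coord_overshear (next_coord i) (\<lambda>z. o' * f z) g z) $ j =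
        coord_overshear i (\<lambda>z. o' * f (untwist z)) (\<lambda>z. g (untwist z)) (twist z) $ j"
        using next_coord_neq_first[OF next_coord(1)] next_coord_eq_iff[of j i] next_coord(1)
        by (auto simp: twist_nth coord_overshear_nth untwist_twist)
    qed
    have "coord_overshear (next_coord i) (\<lambda>z. o' * f z) g =
      untwist \<circ> coord_overshear i (\<lambda>z. o' * f (untwist z)) (\<lambda>z. g (untwist z)) \<circ> twist"
      by (rule ext) (simp only: o_apply t[symmetric] untwist_twist)
    moreover have "coord_overshear i (\<lambda>z. o' * f (untwist z)) (\<lambda>z. g (untwist z)) \<in> \<Gamma>"
      using next_coord by (intro next_coord.IH h)
    ultimately show ?case using conj by metis
  qed
qed

definition signed_swap :: "'n::finite \<Rightarrow> 'n \<Rightarrow> 'n cspace \<Rightarrow> 'n cspace"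
  where "signed_swap i j z = (\<chi> k. if k = i then z $ j else if k = j then - z $ i else z $ k)"

lemma signed_swap_nth:
  "signed_swap i j z $ k = (if k = i then z $ j else if k = j then - z $ i else z $ k)"
  by (simp add: signed_swap_def)

text \<open>A quarter turn in the plane of coordinates \<open>i\<close> and \<open>j\<close> is a
  product of three transvections with coefficients 1, -1, 1, as in \<open>SL(2)\<close>.\<close>

lemma signed_swap_in_subgroup:
  assumes \<Gamma>: "subgroup \<Gamma> hol_aut"
    and sh: "\<And>j g. g \<in> hol_indep {j} \<Longrightarrow> coord_overshear j (\<lambda>_. 0) g \<in> \<Gamma>"
    and ij: "i \<noteq> j"
  shows "signed_swap i j \<in> \<Gamma>"
proof -
  define S where "S i j c = coord_overshear i (\<lambda>_. 0) (\<lambda>z. c * z $ j)" for i j :: 'a and c :: complex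
  have S: "S i j c \<in> \<Gamma>" if "i \<noteq> j" for i j c
    unfolding S_def by (intro sh hol_indep_intros) (use that in auto)
  have "signed_swap i j = S i j 1 \<circ> (S j i (- 1) \<circ> S i j 1)"
    using ij by (auto simp: fun_eq_iff vec_eq_iff signed_swap_nth S_def coord_overshear_nth)
  then show ?thesis using S ij subgroup_hol_autD(3)[OF \<Gamma>] by metis
qed

text \<open>The twist is a product of signed swaps of adjacent coordinates. \<open>T s\<close> is
  the partial twist of the coordinates up to \<open>s\<close>; each further swap carries the
  original first coordinate one place up and changes its sign.\<close>

lemma twist_in_subgroup:
  fixes \<Gamma> :: "('n cspace \<Rightarrow> 'n::{finite, linorder} cspace) set"
  assumes \<Gamma>: "subgroup \<Gamma> hol_aut"
    and sh: "\<And>j g. g \<in> hol_indep {j} \<Longrightarrow> coord_overshear j (\<lambda>_. 0) g \<in> \<Gamma>"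
  shows "twist \<in> \<Gamma>"
proof -
  define T :: "'n \<Rightarrow> 'n cspace \<Rightarrow> 'n cspace" where
    "T s z = (\<chi> k. if k < s then z $ next_coord k
      else if k = s then (- 1) ^ card {j. j < s} * z $ first_coord else z $ k)" for s z
  have "T s \<in> \<Gamma>" for s
  proof (induction s rule: coord_induct)
    case first_coord
    have "{j. j < (first_coord::'n)} = {}" using first_coord_le by (auto simp: not_less)
    then have "T first_coord = id"
      using first_coord_le by (auto simp: T_def fun_eq_iff vec_eq_iff not_less[symmetric] leD)
    then show ?case using subgroup_hol_autD(2)[OF \<Gamma>] by metis
  next
    case (next_coord s)
    note s = next_coord(1)
    have lt: "s < next_coord s" and le: "j < next_coord s \<longleftrightarrow> j \<le> s" for j
      using next_coord_less[OF s] by blast+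
    have "{j. j < next_coord s} = insert s {j. j < s}"
      unfolding le by (auto simp: le_less)
    then have c: "card {j. j < next_coord s} = Suc (card {j. j < s})" by simp
    have "T (next_coord s) z $ k = signed_swap s (next_coord s) (T s z) $ k" for z k
    proof -
      consider "k < s" | "k = s" | "k = next_coord s" | "s < k" "k \<noteq> next_coord s"
        using linorder_less_linear by blast
      then show ?thesis
      proof cases
        case 1
        then have "k \<noteq> next_coord s" "k \<noteq> s" "k < next_coord s" using lt by auto
        then show ?thesis using 1 unfolding T_def signed_swap_nth by simp
      next
        case 2
        then have "\<not> next_coord s < s" "next_coord s \<noteq> s" using lt by auto
        then show ?thesis using 2 lt unfolding T_def signed_swap_nth by simp
      next
        case 3
        then have "k \<noteq> s" using lt by auto
        then show ?thesis using 3 unfolding T_def signed_swap_nth by (simp add: c)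
      next
        case 4
        then have "\<not> k < s" "k \<noteq> s" "\<not> k < next_coord s" by (auto simp: le)
        then show ?thesis using 4 unfolding T_def signed_swap_nth by simp
      qed
    qed
    then have "T (next_coord s) = signed_swap s (next_coord s) \<circ> T s"
      by (simp add: fun_eq_iff vec_eq_iff)
    moreover have "signed_swap s (next_coord s) \<in> \<Gamma>"
      using lt by (intro signed_swap_in_subgroup[OF \<Gamma> sh]) auto
    ultimately show ?case using next_coord.IH subgroup_hol_autD(3)[OF \<Gamma>] by metis
  qed
  moreover have "T last_coord = twist"
  proof -
    have "{j. j < (last_coord::'n)} = UNIV - {last_coord}" using le_last_coord by (auto simp: less_le)
    then have "card {j. j < (last_coord::'n)} = CARD('n) - 1" by simp
    moreover have "(- 1 :: complex) ^ (CARD('n) - 1) = twist_sign TYPE('n)"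
      using zero_less_card_finite[where 'a = 'n] by (cases "CARD('n)") auto
    ultimately show ?thesis
      using le_last_coord by (auto simp: T_def fun_eq_iff vec_eq_iff twist_nth less_le)
  qed
  ultimately show ?thesis by metis
qed

text \<open>The case \<open>o' = 0\<close> gives the shears and \<open>o' = 1\<close> the overshears.\<close>

definition axis_family :: "complex \<Rightarrow> ('n cspace \<Rightarrow> 'n::{finite, linorder} cspace) set"
  where "axis_family o' = {coord_overshear last_coord (\<lambda>z. o' * f z) g | f g.
    f \<in> hol_indep {last_coord} \<and> g \<in> hol_indep {last_coord}}"

lemma axis_familyI:
  "f \<in> hol_indep {last_coord} \<Longrightarrow> g \<in> hol_indep {last_coord} \<Longrightarrow>
    coord_overshear last_coord (\<lambda>z. o' * f z) g \<in> axis_family o'"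
  unfolding axis_family_def by blast

lemma hol_fun_without_last_eq: "hol_fun_without_last = hol_indep {last_coord}"
  by (simp add: hol_fun_without_last_def hol_indep_def indep_of_def)

lemma axis_overshear_eq: "axis_overshear = coord_overshear last_coord"
  by (simp add: fun_eq_iff axis_overshear_def coord_overshear_def)

lemma axis_shears_eq: "axis_shears = axis_family 0"
  unfolding axis_shears_def axis_family_def hol_fun_without_last_eq axis_overshear_eq
  using hol_indep_const by auto

lemma axis_overshears_eq: "axis_overshears = axis_family 1"
  unfolding axis_overshears_def axis_family_def hol_fun_without_last_eq axis_overshear_eq by simp

lemma matrix_inv_mult:
  fixes A :: "complex ^ 'n ^ 'n"
  assumes "det A \<noteq> 0"
  shows "matrix_inv A *v (A *v z) = z" and "A *v (matrix_inv A *v z) = z"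
proof -
  have "A ** matrix_inv A = mat 1 \<and> matrix_inv A ** A = mat 1"
    using assms unfolding invertible_det_nz[symmetric] invertible_def matrix_inv_def by (rule someI_ex)
  then show "matrix_inv A *v (A *v z) = z" "A *v (matrix_inv A *v z) = z"
    by (simp_all add: matrix_vector_mul_assoc)
qed

text \<open>The matrix is a diagonal reflection with two rows interchanged; the two factors -1 in
  the determinant cancel.\<close>

lemma signed_swap_matrix:
  fixes i j :: "'n::finite"
  assumes ij: "i \<noteq> j"
  obtains A :: "('n cspace, 'n) vec" where "det A = 1" "\<And>z. A *v z = signed_swap i j z"
proof -
  define E :: "('n cspace, 'n) vec" where "E = (\<chi> r c. if r = c then (if r = i then - 1 else 1) else 0)"
  define A :: "('n cspace, 'n) vec" where "A = (\<chi> r. E $ Transposition.transpose i j r)"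
  have "det E = (\<Prod>r\<in>UNIV. E $ r $ r)" by (rule det_diagonal) (simp add: E_def)
  also have "\<dots> = (\<Prod>r\<in>UNIV. if r = i then - 1 else 1)" by (simp add: E_def)
  finally have "det E = - 1" by simp
  moreover have "det A = of_int (sign (Transposition.transpose i j)) * det E"
    unfolding A_def by (rule det_permute_rows) (rule permutes_swap_id, auto)
  ultimately have "det A = 1" using ij by (simp add: sign_swap_id)
  moreover have "A *v z = signed_swap i j z" for z
  proof (rule vec_eq_iff[THEN iffD2, rule_format])
    fix r
    have E: "(\<Sum>c\<in>UNIV. E $ s $ c * z $ c) = (if s = i then - z $ i else z $ s)" for s
      by (simp add: E_def if_distrib[of "\<lambda>x. x * _"] cong: if_cong)
    show "(A *v z) $ r = signed_swap i j z $ r"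
      using ij by (simp add: matrix_vector_mult_def A_def E signed_swap_nth Transposition.transpose_def)
  qed
  ultimately show ?thesis by (rule that)
qed

text \<open>A signed swap has determinant 1 and carries the \<open>i\<close>-th coordinate to the
  last one without a sign, so it conjugates one kind of overshear into the other.\<close>

lemma coord_overshear_SL_conjugate:
  fixes f g :: "'n::{finite, linorder} cspace \<Rightarrow> complex"
  assumes f: "f \<in> hol_indep {i}" and g: "g \<in> hol_indep {i}"
  shows "coord_overshear i (\<lambda>z. o' * f z) g \<in> SL_conjugates (axis_family o')"
proof -
  have *: "X \<in> SL_conjugates (axis_family o')"
    if "det A = 1" "G \<in> axis_family o'" "\<And>z. A *v X z = G (A *v z)" for A :: "('n cspace, 'n) vec" and G X
  proof -
    have "X = (\<lambda>z. matrix_inv A *v G (A *v z))"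
      using that(3)[symmetric] matrix_inv_mult(1)[of A] that(1) by auto
    then show ?thesis using that(1,2) unfolding SL_conjugates_def by blast
  qed
  show ?thesis
  proof (cases "i = last_coord")
    case True
    show ?thesis
      by (rule *[of "mat 1" "coord_overshear i (\<lambda>z. o' * f z) g"])
        (use f g True in \<open>auto simp: axis_family_def\<close>)
  next
    case False
    define l where "l = (last_coord :: 'n)"
    have il: "l \<noteq> i" using False by (simp add: l_def)
    obtain A :: "('n cspace, 'n) vec" where A: "det A = 1" "\<And>z. A *v z = signed_swap l i z"
      using signed_swap_matrix[OF il] by blast
    have inv: "signed_swap i l (signed_swap l i z) = z" for z :: "'n cspace"
      using il by (auto simp: vec_eq_iff signed_swap_nth)
    have lin: "clinear (signed_swap i l)"
      using il by (auto simp: clinear_def vec_eq_iff signed_swap_nth)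
    have h: "(\<lambda>z. h (signed_swap i l z)) \<in> hol_indep {l}" if "h \<in> hol_indep {i}" for h :: "'n cspace \<Rightarrow> complex"
      by (rule hol_indep_compose[OF that clinear_holomorphic_map[OF lin]])
        (use il in \<open>auto simp: signed_swap_nth\<close>)
    show ?thesis
    proof (rule *[OF A(1)])
      show "coord_overshear l (\<lambda>z. o' * f (signed_swap i l z)) (\<lambda>z. g (signed_swap i l z)) \<in> axis_family o'"
        using axis_familyI[OF h[OF f, unfolded l_def] h[OF g, unfolded l_def]] unfolding l_def .
      fix z
      show "A *v coord_overshear i (\<lambda>z. o' * f z) g z =
        coord_overshear l (\<lambda>z. o' * f (signed_swap i l z)) (\<lambda>z. g (signed_swap i l z)) (A *v z)"
        using il by (auto simp: A(2) vec_eq_iff coord_overshear_nth signed_swap_nth inv)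
    qed
  qed
qed

section \<open>The groups generated by shears and by overshears\<close>

definition family_group :: "complex \<Rightarrow> ('n cspace \<Rightarrow> 'n::{finite, linorder} cspace) set"
  where "family_group o' = generate hol_aut (SL_conjugates (axis_family o'))"

lemma shear_group_eq: "shear_group = family_group 0"
  by (simp add: shear_group_def shears_def axis_shears_eq family_group_def)

lemma overshear_group_eq: "overshear_group = family_group 1"
  by (simp add: overshear_group_def overshears_def axis_overshears_eq family_group_def)

lemma SL_conjugatesE:
  assumes "X \<in> SL_conjugates (axis_family o')"
  obtains A :: "('n cspace, 'n::{finite, linorder}) vec" and f g where "det A = 1"
    "f \<in> hol_indep {last_coord}" "g \<in> hol_indep {last_coord}"
    "X = (*v) (matrix_inv A) \<circ> coord_overshear last_coord (\<lambda>z. o' * f z) g \<circ> (*v) A"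
  using assms unfolding SL_conjugates_def axis_family_def by (force simp: o_def)

lemma subgroup_family_group: "subgroup (family_group o') hol_aut"
  unfolding family_group_def
proof (rule hol_aut.generate_is_subgroup, rule subsetI)
  fix X :: "'n::{finite, linorder} cspace \<Rightarrow> 'n cspace" assume "X \<in> SL_conjugates (axis_family o')"
  then obtain A :: "('n cspace, 'n) vec" and f g where A: "det A = 1"
    "f \<in> hol_indep {last_coord}" "g \<in> hol_indep {last_coord}"
    "X = (*v) (matrix_inv A) \<circ> coord_overshear last_coord (\<lambda>z. o' * f z) g \<circ> (*v) A"
    by (rule SL_conjugatesE)
  have "(*v) A \<in> carrier hol_aut" "(*v) (matrix_inv A) \<in> carrier hol_aut"
    using A(1) by (auto intro!: clinear_hol_aut(1) clinear_matrix matrix_inv_mult)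
  moreover have "coord_overshear last_coord (\<lambda>z. o' * f z) g \<in> carrier hol_aut"
    by (intro coord_overshear_hol_aut hol_indep_intros A)
  ultimately show "X \<in> carrier hol_aut" unfolding A(4) by (intro hol_aut_compose)
qed

lemma coord_overshear_in_family_group:
  assumes "f \<in> hol_indep {i}" "g \<in> hol_indep {i}"
  shows "coord_overshear i (\<lambda>z. o' * f z) g \<in> family_group o'"
  unfolding family_group_def by (rule generate.incl[OF coord_overshear_SL_conjugate[OF assms]])

text \<open>Conjugation by the twist produces overshears in all coordinates, and these produce all
  their linear conjugates. This covers an \<open>A\<close> of any determinant, for which the two
  hypotheses do not literally concern generators of the group.\<close>

lemma family_group_subset:
  fixes \<Gamma> :: "('n cspace \<Rightarrow> 'n::{finite, linorder} cspace) set"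
  assumes \<Gamma>: "subgroup \<Gamma> hol_aut"
    and A: "clinear A" "clinear A'" "\<And>z. A' (A z) = z" "\<And>z. A (A' z) = z"
    and tw: "A' \<circ> twist \<circ> A \<in> \<Gamma>"
    and sh: "\<And>f g. f \<in> hol_indep {last_coord} \<Longrightarrow> g \<in> hol_indep {last_coord} \<Longrightarrow>
      A' \<circ> coord_overshear last_coord (\<lambda>z. o' * f z) g \<circ> A \<in> \<Gamma>"
  shows "family_group o' \<subseteq> \<Gamma>"
proof -
  note Aa = clinear_hol_aut[OF A]
  define \<Delta> where "\<Delta> = {X \<in> carrier hol_aut. inv_into UNIV A \<circ> X \<circ> A \<in> \<Gamma>}"
  have \<Delta>: "subgroup \<Delta> hol_aut" unfolding \<Delta>_def by (rule subgroup_conjugates[OF \<Gamma> Aa(1)])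
  have co: "coord_overshear i (\<lambda>z. o' * f z) g \<in> \<Delta>" if "f \<in> hol_indep {i}" "g \<in> hol_indep {i}" for i f g
  proof (rule coord_overshears_in_subgroup[OF \<Delta> _ _ that])
    show "twist \<in> \<Delta>" using tw by (simp add: \<Delta>_def Aa(2) twist_hol_aut)
    fix f g :: "'n cspace \<Rightarrow> complex" assume fg: "f \<in> hol_indep {last_coord}" "g \<in> hol_indep {last_coord}"
    have "coord_overshear last_coord (\<lambda>z. o' * f z) g \<in> carrier hol_aut"
      by (intro coord_overshear_hol_aut hol_indep_intros fg)
    then show "coord_overshear last_coord (\<lambda>z. o' * f z) g \<in> \<Delta>"
      using sh[OF fg] by (simp add: \<Delta>_def Aa(2))
  qed
  have "SL_conjugates (axis_family o') \<subseteq> \<Gamma>"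
  proof
    fix X :: "'n cspace \<Rightarrow> 'n cspace" assume "X \<in> SL_conjugates (axis_family o')"
    then obtain M :: "('n cspace, 'n) vec" and f g where M: "det M = 1"
      "f \<in> hol_indep {last_coord}" "g \<in> hol_indep {last_coord}"
      "X = (*v) (matrix_inv M) \<circ> coord_overshear last_coord (\<lambda>z. o' * f z) g \<circ> (*v) M"
      by (rule SL_conjugatesE)
    \<comment> \<open>This is \<open>A \<circ> X \<circ> A'\<close>, again a linear conjugate of a
      coordinate overshear; conjugating back returns \<open>X\<close>.\<close>
    have "(A \<circ> (*v) (matrix_inv M)) \<circ> coord_overshear last_coord (\<lambda>z. o' * f z) g \<circ> ((*v) M \<circ> A') \<in> \<Delta>"
    proof (rule linear_conjugate_in_subgroup[OF \<Delta> co _ _ _ _ M(2,3)])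
      show "clinear ((*v) M \<circ> A')" "clinear (A \<circ> (*v) (matrix_inv M))"
        by (intro clinear_compose clinear_matrix A)+
    qed (use M(1) A matrix_inv_mult[of M] in auto)
    then have "A' \<circ> ((A \<circ> (*v) (matrix_inv M)) \<circ> coord_overshear last_coord (\<lambda>z. o' * f z) g \<circ> ((*v) M \<circ> A')) \<circ> A \<in> \<Gamma>"
      by (simp only: \<Delta>_def Aa(2) mem_Collect_eq)
    moreover have "A' \<circ> ((A \<circ> (*v) (matrix_inv M)) \<circ> coord_overshear last_coord (\<lambda>z. o' * f z) g \<circ> ((*v) M \<circ> A')) \<circ> A = X"
      by (rule ext) (simp add: A M(4))
    ultimately show "X \<in> \<Gamma>" by (simp only:)
  qed
  then show ?thesis
    unfolding family_group_def using hol_aut.generate_subgroup_incl[OF _ \<Gamma>] by blast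
qed

lemma linear_conjugate_in_family_group:
  assumes A: "clinear A" "clinear A'" "\<And>z. A' (A z) = z" "\<And>z. A (A' z) = z"
    and fg: "f \<in> hol_indep {i}" "g \<in> hol_indep {i}"
  shows "A' \<circ> coord_overshear i (\<lambda>z. o' * f z) g \<circ> A \<in> family_group o'"
  by (rule linear_conjugate_in_subgroup[OF subgroup_family_group _ A fg])
    (rule coord_overshear_in_family_group)

section \<open>Sequential closures in the compact-open topology\<close>

lemma cconv_compose: "cconv X f \<Longrightarrow> cconv Y g \<Longrightarrow> cconv (\<lambda>j. X j \<circ> Y j) (f \<circ> g)"
  by (auto simp: cconv_def)

lemma cconv_constant: "(\<And>z. isCont f z) \<Longrightarrow> cconv (\<lambda>_. f) f"
  by (auto intro!: cconvI isCont_tendsto_compose)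

lemma cconv_holomorphic: "holomorphic_fun f \<Longrightarrow> cconv (\<lambda>_. f) f"
  by (intro cconv_constant holomorphic_fun_continuous)

lemma holomorphic_map_continuous:
  assumes "holomorphic_map F"
  shows "isCont F z"
proof -
  have "isCont (\<lambda>z. F z $ i) z" for i
    using assms holomorphic_fun_continuous[of "\<lambda>z. F z $ i"] by (simp add: holomorphic_map_def)
  then show ?thesis unfolding isCont_def by (auto intro: vec_tendstoI)
qed

lemma cconv_holomorphic_map: "holomorphic_map F \<Longrightarrow> cconv (\<lambda>_. F) F"
  by (intro cconv_constant holomorphic_map_continuous)

lemma cconv_vecI: "(\<And>i. cconv (\<lambda>j z. X j z $ i) (\<lambda>z. F z $ i)) \<Longrightarrow> cconv X F"
  unfolding cconv_def by (auto intro: vec_tendstoI)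

lemma cconv_nth: "cconv (\<lambda>_ z. z $ i) (\<lambda>z. (z :: 'n::finite cspace) $ i)"
  by (intro cconv_holomorphic holomorphic_fun_nth)

lemma cconv_complex_const: "cconv (\<lambda>_ _. c) (\<lambda>_. c)"
  by (simp add: cconv_def)

lemma cconv_add: "cconv f f' \<Longrightarrow> cconv g g' \<Longrightarrow> cconv (\<lambda>j z. f j z + g j z) (\<lambda>z. f' z + g' z)"
  for f' g' :: "'a::topological_space \<Rightarrow> complex"
  by (auto intro!: cconvI tendsto_add dest: cconvD)

lemma cconv_diff: "cconv f f' \<Longrightarrow> cconv g g' \<Longrightarrow> cconv (\<lambda>j z. f j z - g j z) (\<lambda>z. f' z - g' z)"
  for f' g' :: "'a::topological_space \<Rightarrow> complex"
  by (auto intro!: cconvI tendsto_diff dest: cconvD)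

lemma cconv_mult: "cconv f f' \<Longrightarrow> cconv g g' \<Longrightarrow> cconv (\<lambda>j z. f j z * g j z) (\<lambda>z. f' z * g' z)"
  for f' g' :: "'a::topological_space \<Rightarrow> complex"
  by (auto intro!: cconvI tendsto_mult dest: cconvD)

lemma cconv_uminus: "cconv f f' \<Longrightarrow> cconv (\<lambda>j z. - f j z) (\<lambda>z. - f' z)"
  for f' :: "'a::topological_space \<Rightarrow> complex"
  by (auto intro!: cconvI tendsto_minus dest: cconvD)

lemma cconv_exp: "cconv f f' \<Longrightarrow> cconv (\<lambda>j z. exp (f j z)) (\<lambda>z. exp (f' z))"
  for f' :: "'a::topological_space \<Rightarrow> complex"
  by (auto intro!: cconvI tendsto_exp dest: cconvD)

lemmas cconv_intros = cconv_nth cconv_complex_const cconv_add cconv_diff cconv_mult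
  cconv_uminus cconv_exp

lemma cconv_coord_overshear:
  assumes "cconv f f'" "cconv g g'"
  shows "cconv (\<lambda>j. coord_overshear i (f j) (g j)) (coord_overshear i f' g')"
proof (rule cconv_vecI)
  show "cconv (\<lambda>j z. coord_overshear i (f j) (g j) z $ k) (\<lambda>z. coord_overshear i f' g' z $ k)" for k
    by (cases "k = i") (simp_all add: coord_overshear_nth cconv_intros assms)
qed

lemma cconv_coords_shear:
  assumes "\<And>k. k \<in> D \<Longrightarrow> cconv (\<lambda>j. h j k) (h' k)"
  shows "cconv (\<lambda>j. coords_shear D (h j)) (coords_shear D h')"
proof (rule cconv_vecI)
  show "cconv (\<lambda>j z. coords_shear D (h j) z $ k) (\<lambda>z. coords_shear D h' z $ k)" for k
    by (cases "k \<in> D") (simp_all add: coords_shear_nth cconv_intros assms)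
qed

text \<open>Demanding convergence of the inverses as well makes the closure visibly stable under
  inversion, hence a subgroup.\<close>

definition seq_closure :: "('n cspace \<Rightarrow> 'n::finite cspace) set \<Rightarrow> ('n cspace \<Rightarrow> 'n cspace) set"
  where "seq_closure \<Gamma> = {X \<in> carrier hol_aut. \<exists>x. (\<forall>j. x j \<in> \<Gamma>) \<and> cconv x X \<and>
    cconv (\<lambda>j. inv_into UNIV (x j)) (inv_into UNIV X)}"

lemma subgroup_seq_closure:
  assumes \<Gamma>: "subgroup \<Gamma> hol_aut"
  shows "subgroup (seq_closure \<Gamma>) hol_aut"
proof (rule subgroup_hol_autI)
  show "seq_closure \<Gamma> \<subseteq> carrier hol_aut" by (auto simp: seq_closure_def)
  have "cconv (\<lambda>_. id) (id :: 'a cspace \<Rightarrow> 'a cspace)" by (auto simp: cconv_def)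
  then show "id \<in> seq_closure \<Gamma>"
    unfolding seq_closure_def using subgroup_hol_autD(2)[OF \<Gamma>] id_in_hol_aut
    by (auto intro!: exI[of _ "\<lambda>_. id"])
next
  fix F G assume "F \<in> seq_closure \<Gamma>" "G \<in> seq_closure \<Gamma>"
  then obtain x y where x: "\<And>j. x j \<in> \<Gamma>" "cconv x F" "cconv (\<lambda>j. inv_into UNIV (x j)) (inv_into UNIV F)"
    and y: "\<And>j. y j \<in> \<Gamma>" "cconv y G" "cconv (\<lambda>j. inv_into UNIV (y j)) (inv_into UNIV G)"
    and FG: "F \<in> carrier hol_aut" "G \<in> carrier hol_aut"
    unfolding seq_closure_def by blast
  have "x j \<circ> y j \<in> \<Gamma>" for j by (rule subgroup_hol_autD(3)[OF \<Gamma> x(1) y(1)])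
  moreover have "cconv (\<lambda>j. x j \<circ> y j) (F \<circ> G)" by (rule cconv_compose[OF x(2) y(2)])
  moreover have "inv_into UNIV (x j \<circ> y j) = inv_into UNIV (y j) \<circ> inv_into UNIV (x j)" for j
    by (rule hol_aut_compose(2)[OF subgroup_hol_autD(1)[OF \<Gamma> x(1)] subgroup_hol_autD(1)[OF \<Gamma> y(1)]])
  moreover have "cconv (\<lambda>j. inv_into UNIV (y j) \<circ> inv_into UNIV (x j)) (inv_into UNIV (F \<circ> G))"
    unfolding hol_aut_compose(2)[OF FG] by (rule cconv_compose[OF y(3) x(3)])
  ultimately show "F \<circ> G \<in> seq_closure \<Gamma>"
    unfolding seq_closure_def using hol_aut_compose(1)[OF FG]
    by (intro CollectI conjI exI[of _ "\<lambda>j. x j \<circ> y j"]) auto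
next
  fix F assume "F \<in> seq_closure \<Gamma>"
  then obtain x where x: "\<And>j. x j \<in> \<Gamma>" "cconv x F" "cconv (\<lambda>j. inv_into UNIV (x j)) (inv_into UNIV F)"
    and F: "F \<in> carrier hol_aut"
    unfolding seq_closure_def by blast
  have ii: "inv_into UNIV (inv_into UNIV Y) = Y" if "Y \<in> carrier hol_aut" for Y :: "'a cspace \<Rightarrow> 'a cspace"
    by (rule inv_inv_eq[OF hol_autD(1)[OF that]])
  show "inv_into UNIV F \<in> seq_closure \<Gamma>"
    unfolding seq_closure_def
    by (intro CollectI conjI exI[of _ "\<lambda>j. inv_into UNIV (x j)"])
      (simp_all add: hol_aut_inv_closed F subgroup_hol_autD(4)[OF \<Gamma> x(1)] x ii[OF F]
        ii[OF subgroup_hol_autD(1)[OF \<Gamma> x(1)]])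
qed

text \<open>Otherwise points of \<open>K\<close> are sent outside \<open>U\<close> for infinitely
  many indices. By compactness a subsequence of them tends to some \<open>w\<close>, and continuous
  convergence contradicts \<open>F w \<in> U\<close>.\<close>

lemma cconv_eventually_in:
  fixes X :: "nat \<Rightarrow> 'a::metric_space \<Rightarrow> 'b::topological_space"
  assumes X: "cconv X F" and K: "compact K" and U: "open U" and FK: "F ` K \<subseteq> U"
  shows "\<forall>\<^sub>F j in sequentially. X j ` K \<subseteq> U"
proof (rule ccontr)
  assume "\<not> ?thesis"
  then have "\<exists>\<^sub>F j in sequentially. \<not> X j ` K \<subseteq> U" by (simp add: frequently_def)
  then have "\<forall>N. \<exists>j>N. \<not> X j ` K \<subseteq> U"
    unfolding frequently_def eventually_sequentially by (meson Suc_le_eq)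
  then have inf: "infinite {j. \<not> X j ` K \<subseteq> U}"
    unfolding infinite_nat_iff_unbounded by auto
  define r where "r = enumerate {j. \<not> X j ` K \<subseteq> U}"
  have r: "strict_mono r" "\<And>n. \<not> X (r n) ` K \<subseteq> U"
    using strict_mono_enumerate[OF inf] enumerate_in_set[OF inf] by (auto simp: r_def)
  then have "\<exists>z. \<forall>n. z n \<in> K \<and> X (r n) (z n) \<notin> U" by (intro choice) blast
  then obtain z where z: "\<And>n. z n \<in> K" "\<And>n. X (r n) (z n) \<notin> U" by blast
  obtain w s where w: "w \<in> K" "strict_mono s" "(z \<circ> s) \<longlonglongrightarrow> w"
    using K[unfolded compact_def] z(1) by blast
  have rs: "strict_mono (r \<circ> s)" by (rule strict_mono_o[OF r(1) w(2)])
  \<comment> \<open>Continuous convergence speaks of full sequences, so the gaps between the chosen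
    indices are filled with the limit \<open>w\<close>.\<close>
  define y where "y j = (if j \<in> range (r \<circ> s) then (z \<circ> s) (inv_into UNIV (r \<circ> s) j) else w)" for j
  have inj: "inj (r \<circ> s)" using rs by (rule strict_mono_imp_inj_on)
  have y_rs: "y ((r \<circ> s) n) = (z \<circ> s) n" for n
    unfolding y_def using inv_f_f[OF inj, of n] by auto
  have "y \<longlonglongrightarrow> w"
  proof (rule topological_tendstoI)
    fix V assume V: "open V" "w \<in> V"
    then have "\<forall>\<^sub>F n in sequentially. (z \<circ> s) n \<in> V" by (rule topological_tendstoD[OF w(3)])
    then obtain N where N: "\<And>n. N \<le> n \<Longrightarrow> (z \<circ> s) n \<in> V" unfolding eventually_sequentially by blast
    have "y j \<in> V" if "(r \<circ> s) N \<le> j" for j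
    proof (cases "j \<in> range (r \<circ> s)")
      case True
      then obtain n where n: "j = (r \<circ> s) n" by blast
      then have "N \<le> n" using that rs strict_mono_less_eq by blast
      then show ?thesis using N n y_rs by simp
    qed (use V in \<open>simp add: y_def\<close>)
    then show "\<forall>\<^sub>F j in sequentially. y j \<in> V" unfolding eventually_sequentially by blast
  qed
  then have "(\<lambda>j. X j (y j)) \<longlonglongrightarrow> F w" by (rule cconvD[OF X])
  then have "\<forall>\<^sub>F j in sequentially. X j (y j) \<in> U"
    using U FK w(1) by (intro topological_tendstoD) auto
  then have "\<forall>\<^sub>F n in sequentially. X ((r \<circ> s) n) (y ((r \<circ> s) n)) \<in> U"
    by (rule eventually_subseq[OF rs])
  then show False using z(2) unfolding y_rs by (auto simp: eventually_sequentially)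
qed

lemma cconv_eventually_in_open:
  fixes X :: "nat \<Rightarrow> 'a::metric_space \<Rightarrow> 'b::topological_space"
  assumes X: "cconv X F" and W: "openin compact_open_topology W" and F: "F \<in> W"
  shows "\<forall>\<^sub>F j in sequentially. X j \<in> W"
proof -
  have "generate_topology_on {{f. f ` K \<subseteq> U} | K U. compact K \<and> open U} W"
    using W unfolding compact_open_topology_def openin_topology_generated_by_iff .
  then show ?thesis
    using F
  proof (induction rule: generate_topology_on.induct)
    case (Basis W)
    then show ?case using cconv_eventually_in[OF X] by auto
  next
    case (Int a b)
    then show ?case by (auto intro: eventually_conj)
  next
    case (UN \<W>)
    then obtain W where "W \<in> \<W>" "F \<in> W" by blast
    then have "\<forall>\<^sub>F j in sequentially. X j \<in> W" using UN by blast
    then show ?case by (rule eventually_mono) (use \<open>W \<in> \<W>\<close> in blast)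
  qed simp
qed

lemma dense_in_compact_openI:
  assumes sub: "\<Gamma> \<subseteq> S" and cl: "S \<subseteq> seq_closure \<Gamma>"
  shows "dense_in_compact_open \<Gamma> S"
proof -
  \<comment> \<open>The whole function space is the subbasic set for the empty compact set.\<close>
  have "openin compact_open_topology (UNIV :: ('a cspace \<Rightarrow> 'a cspace) set)"
    unfolding compact_open_topology_def openin_topology_generated_by_iff
    by (rule generate_topology_on.Basis) (auto intro!: exI[of _ "{}"])
  then have top: "topspace (subtopology compact_open_topology S) = S"
    using openin_subset by (fastforce simp: topspace_subtopology)
  have "S \<subseteq> subtopology compact_open_topology S closure_of \<Gamma>"
  proof
    fix F assume F: "F \<in> S"
    show "F \<in> subtopology compact_open_topology S closure_of \<Gamma>"
      unfolding in_closure_of top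
    proof (intro conjI F allI impI, elim conjE)
      fix T assume "F \<in> T" "openin (subtopology compact_open_topology S) T"
      then obtain W where W: "openin compact_open_topology W" "T = W \<inter> S" "F \<in> W"
        unfolding openin_subtopology by blast
      obtain x where x: "\<And>j. x j \<in> \<Gamma>" "cconv x F"
        using F cl unfolding seq_closure_def by blast
      obtain j where "x j \<in> W"
        using eventually_happens'[OF sequentially_bot cconv_eventually_in_open[OF x(2) W(1,3)]] by blast
      then show "\<exists>y. y \<in> \<Gamma> \<and> y \<in> T" using x(1) sub W(2) by blast
    qed
  qed
  moreover have "subtopology compact_open_topology S closure_of \<Gamma> \<subseteq> S"
    using closure_of_subset_topspace[of "subtopology compact_open_topology S" \<Gamma>] unfolding top .
  ultimately show ?thesis using sub by (auto simp: dense_in_compact_open_def)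
qed

section \<open>The family of generators\<close>

text \<open>Scaling by \<open>1 / a $ i\<close> and adding multiples of \<open>z $ i\<close> to the
  other coordinates; the determinant of \<open>A\<close> is \<open>1 / a $ i\<close>.\<close>

lemma linear_to_ones:
  fixes a :: "'n::finite cspace"
  assumes "a \<noteq> 0"
  obtains A A' where "clinear A" "clinear A'" "\<And>z. A' (A z) = z" "\<And>z. A (A' z) = z" "A a = vec 1"
proof -
  obtain i where i: "a $ i \<noteq> 0" using assms by (auto simp: vec_eq_iff)
  define A :: "'n cspace \<Rightarrow> 'n cspace" where
    "A z = (\<chi> j. if j = i then z $ i / a $ i else z $ j + (1 - a $ j) / a $ i * z $ i)" for z
  define A' :: "'n cspace \<Rightarrow> 'n cspace" where
    "A' z = (\<chi> j. if j = i then a $ i * z $ i else z $ j - (1 - a $ j) * z $ i)" for z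
  have "clinear A"
    by (auto simp: clinear_def A_def vec_eq_iff add_divide_distrib distrib_left mult_ac)
  moreover have "clinear A'"
    by (auto simp: clinear_def A'_def vec_eq_iff algebra_simps)
  moreover have "A' (A z) = z" "A (A' z) = z" for z
    using i by (auto simp: A_def A'_def vec_eq_iff)
  moreover have "A a = vec 1" using i by (auto simp: A_def vec_eq_iff)
  ultimately show ?thesis by (rule that)
qed

text \<open>A tuple \<open>\<phi>\<close> consists of the two functions of an overshear (indices \<open>Inl\<close>) and of one
  displacement for each coordinate (indices \<open>Inr\<close>).\<close>

definition tuple_indep :: "bool + 'n \<Rightarrow> 'n::{finite, linorder} set"
  where "tuple_indep k = (case k of Inl _ \<Rightarrow> {last_coord}
    | Inr i \<Rightarrow> if i = first_coord then - {last_coord} else - {first_coord})"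

definition admissible :: "(bool + 'n \<Rightarrow> 'n::{finite, linorder} cspace \<Rightarrow> complex) \<Rightarrow> bool"
  where "admissible \<phi> \<longleftrightarrow> (\<forall>k. \<phi> k \<in> hol_indep (tuple_indep k))"

text \<open>The nonlinear conjugating map. For an admissible tuple the factor applied first moves
  the first coordinate by a function of the last one alone, the second moves all others by functions
  of the first; each layer is a one-variable interpolation problem.\<close>

definition displace :: "(bool + 'n \<Rightarrow> 'n cspace \<Rightarrow> complex) \<Rightarrow> 'n cspace \<Rightarrow> 'n::{finite, linorder} cspace"
  where "displace \<phi> = coords_shear (- {first_coord}) (\<lambda>i. \<phi> (Inr i)) \<circ>
    coords_shear {first_coord} (\<lambda>i. \<phi> (Inr i))"

text \<open>The overshear is written relative to \<open>z $ first_coord\<close> so that it depends equivariantly on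
  \<open>\<phi>\<close> under translations along the diagonal; \<open>rotate_diag\<close> is the twist corrected by a shear so as
  to commute with them.\<close>

definition diag_overshear :: "complex \<Rightarrow> (bool + 'n \<Rightarrow> 'n cspace \<Rightarrow> complex) \<Rightarrow>
    'n cspace \<Rightarrow> 'n::{finite, linorder} cspace"
  where "diag_overshear o' \<phi> = coord_overshear last_coord (\<lambda>z. o' * \<phi> (Inl False) z)
    (\<lambda>z. (1 - exp (o' * \<phi> (Inl False) z)) * z $ first_coord + \<phi> (Inl True) z)"

text \<open>With \<open>e\<close> the twist sign, the last coordinate of the twist becomes
  \<open>e * z\<^sub>1 + (1 - e) * z\<^sub>2\<close> for \<open>n \<ge> 2\<close>, with coefficients
  summing to 1. If \<open>e = 1\<close> nothing is corrected.\<close>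

definition twist_correction :: "'n cspace \<Rightarrow> 'n::{finite, linorder} cspace"
  where "twist_correction = coord_overshear last_coord (\<lambda>_. 0)
    (\<lambda>z. (1 - twist_sign TYPE('n)) * z $ first_coord)"

definition rotate_diag :: "'n cspace \<Rightarrow> 'n::{finite, linorder} cspace"
  where "rotate_diag = twist_correction \<circ> twist"

text \<open>The generator in diagonal coordinates; the final \<open>F\<close> is its conjugate by
  the linear map that sends \<open>a\<close> to the vector of ones.\<close>

definition core :: "complex \<Rightarrow> (bool + 'n \<Rightarrow> 'n cspace \<Rightarrow> complex) \<Rightarrow>
    'n cspace \<Rightarrow> 'n::{finite, linorder} cspace"
  where "core o' \<phi> = inv_into UNIV (displace \<phi>) \<circ> (diag_overshear o' \<phi> \<circ> rotate_diag) \<circ> displace \<phi>"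

section \<open>Invertibility, continuity and equivariance of \<open>core\<close>\<close>

lemma coords_shear_hol_aut:
  assumes h: "\<And>j. j \<in> D \<Longrightarrow> h j \<in> hol_indep D"
  shows "coords_shear D h \<in> carrier hol_aut"
    and "inv_into UNIV (coords_shear D h) = coords_shear D (\<lambda>j z. - h j z)"
proof -
  have hol: "holomorphic_map (coords_shear D g)" if "\<And>j. j \<in> D \<Longrightarrow> holomorphic_fun (g j)" for g
    by (rule holomorphic_mapI, rename_tac k, case_tac "k \<in> D") (auto simp: coords_shear_nth that)
  have i: "h j (coords_shear D g z) = h j z" if "j \<in> D" for j g z
    by (rule indep_ofD[OF hol_indepD(2)[OF h[OF that]]]) (simp add: coords_shear_nth)
  have "coords_shear D (\<lambda>j z. - h j z) (coords_shear D h z) = z"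
    "coords_shear D h (coords_shear D (\<lambda>j z. - h j z) z) = z" for z
    by (simp_all add: vec_eq_iff coords_shear_nth i)
  from hol_autI[OF hol hol this] show "coords_shear D h \<in> carrier hol_aut"
    "inv_into UNIV (coords_shear D h) = coords_shear D (\<lambda>j z. - h j z)"
    using hol_indepD(1)[OF h] by auto
qed

context
  assumes two_coords: "(first_coord :: 'n::{finite, linorder}) \<noteq> last_coord"
begin

lemma admissibleD:
  fixes \<phi> :: "bool + 'n \<Rightarrow> 'n cspace \<Rightarrow> complex"
  assumes "admissible \<phi>"
  shows "\<phi> (Inl b) \<in> hol_indep {last_coord}"
    and "i \<in> - {first_coord} \<Longrightarrow> \<phi> (Inr i) \<in> hol_indep (- {first_coord})"
    and "i \<in> {first_coord} \<Longrightarrow> \<phi> (Inr i) \<in> hol_indep {first_coord}"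
proof -
  have *: "\<phi> k \<in> hol_indep (tuple_indep k)" for k using assms by (simp add: admissible_def)
  show "\<phi> (Inl b) \<in> hol_indep {last_coord}" using *[of "Inl b"] by (simp add: tuple_indep_def)
  show "i \<in> - {first_coord} \<Longrightarrow> \<phi> (Inr i) \<in> hol_indep (- {first_coord})"
    using *[of "Inr i"] by (simp add: tuple_indep_def)
  show "i \<in> {first_coord} \<Longrightarrow> \<phi> (Inr i) \<in> hol_indep {first_coord}"
    using *[of "Inr i"] two_coords by (auto simp: tuple_indep_def elim!: hol_indep_mono)
qed

lemma displace_hol_aut:
  fixes \<phi> :: "bool + 'n \<Rightarrow> 'n cspace \<Rightarrow> complex"
  assumes "admissible \<phi>"
  shows "displace \<phi> \<in> carrier hol_aut"
    and "inv_into UNIV (displace \<phi>) = coords_shear {first_coord} (\<lambda>i z. - \<phi> (Inr i) z) \<circ>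
      coords_shear (- {first_coord}) (\<lambda>i z. - \<phi> (Inr i) z)"
proof -
  have c1: "coords_shear (- {first_coord}) (\<lambda>i. \<phi> (Inr i)) \<in> carrier hol_aut"
    "inv_into UNIV (coords_shear (- {first_coord}) (\<lambda>i. \<phi> (Inr i))) =
      coords_shear (- {first_coord}) (\<lambda>i z. - \<phi> (Inr i) z)"
    by (rule coords_shear_hol_aut, erule admissibleD[OF assms])+
  have c2: "coords_shear {first_coord} (\<lambda>i. \<phi> (Inr i)) \<in> carrier hol_aut"
    "inv_into UNIV (coords_shear {first_coord} (\<lambda>i. \<phi> (Inr i))) =
      coords_shear {first_coord} (\<lambda>i z. - \<phi> (Inr i) z)"
    by (rule coords_shear_hol_aut, erule admissibleD[OF assms])+
  show "displace \<phi> \<in> carrier hol_aut"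
    unfolding displace_def by (rule hol_aut_compose(1)[OF c1(1) c2(1)])
  show "inv_into UNIV (displace \<phi>) = coords_shear {first_coord} (\<lambda>i z. - \<phi> (Inr i) z) \<circ>
      coords_shear (- {first_coord}) (\<lambda>i z. - \<phi> (Inr i) z)"
    using hol_aut_compose(2)[OF c1(1) c2(1)] unfolding displace_def[of \<phi>] c1(2) c2(2) .
qed

lemma diag_overshear_parts:
  fixes \<phi> :: "bool + 'n \<Rightarrow> 'n cspace \<Rightarrow> complex"
  assumes "admissible \<phi>"
  shows "(\<lambda>z. o' * \<phi> (Inl False) z) \<in> hol_indep {last_coord}"
    and "(\<lambda>z. (1 - exp (o' * \<phi> (Inl False) z)) * z $ first_coord + \<phi> (Inl True) z) \<in> hol_indep {last_coord}"
proof -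
  show "(\<lambda>z. o' * \<phi> (Inl False) z) \<in> hol_indep {last_coord}"
    by (intro hol_indep_mult hol_indep_const admissibleD(1)[OF assms])
  show "(\<lambda>z. (1 - exp (o' * \<phi> (Inl False) z)) * z $ first_coord + \<phi> (Inl True) z) \<in> hol_indep {last_coord}"
    by (intro hol_indep_intros admissibleD(1)[OF assms]) (use two_coords in simp)
qed

lemma diag_overshear_hol_aut:
  fixes \<phi> :: "bool + 'n \<Rightarrow> 'n cspace \<Rightarrow> complex"
  assumes "admissible \<phi>"
  shows "diag_overshear o' \<phi> \<in> carrier hol_aut"
    and "inv_into UNIV (diag_overshear o' \<phi>) = coord_overshear last_coord (\<lambda>z. - (o' * \<phi> (Inl False) z))
    (\<lambda>z. - (exp (- (o' * \<phi> (Inl False) z)) *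
       ((1 - exp (o' * \<phi> (Inl False) z)) * z $ first_coord + \<phi> (Inl True) z)))"
  unfolding diag_overshear_def by (rule coord_overshear_hol_aut diag_overshear_parts assms)+

lemma twist_correction_indep:
  "(\<lambda>z :: 'n cspace. (1 - twist_sign TYPE('n)) * z $ first_coord) \<in> hol_indep {last_coord}"
  using two_coords by (intro hol_indep_intros) simp

lemma twist_correction_hol_aut: "(twist_correction :: 'n cspace \<Rightarrow> 'n cspace) \<in> carrier hol_aut"
  unfolding twist_correction_def
  by (rule coord_overshear_hol_aut hol_indep_const twist_correction_indep)+

lemma rotate_diag_hol_aut: "(rotate_diag :: 'n cspace \<Rightarrow> 'n cspace) \<in> carrier hol_aut"
  unfolding rotate_diag_def by (rule hol_aut_compose(1)[OF twist_correction_hol_aut twist_hol_aut])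

lemma core_hol_aut:
  fixes \<phi> :: "bool + 'n \<Rightarrow> 'n cspace \<Rightarrow> complex"
  assumes "admissible \<phi>"
  shows "core o' \<phi> \<in> carrier hol_aut"
    and "inv_into UNIV (core o' \<phi>) = inv_into UNIV (displace \<phi>) \<circ>
      (inv_into UNIV rotate_diag \<circ> inv_into UNIV (diag_overshear o' \<phi>)) \<circ> displace \<phi>"
proof -
  note D = displace_hol_aut(1)[OF assms] and O = diag_overshear_hol_aut(1)[OF assms]
  note DI = hol_aut_inv_closed[OF D]
  note OR = hol_aut_compose[OF O rotate_diag_hol_aut]
  note DOR = hol_aut_compose[OF DI OR(1)]
  show "core o' \<phi> \<in> carrier hol_aut"
    unfolding core_def by (rule hol_aut_compose(1)[OF DOR(1) D])
  show "inv_into UNIV (core o' \<phi>) = inv_into UNIV (displace \<phi>) \<circ>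
      (inv_into UNIV rotate_diag \<circ> inv_into UNIV (diag_overshear o' \<phi>)) \<circ> displace \<phi>"
    unfolding core_def hol_aut_compose(2)[OF DOR(1) D] DOR(2) OR(2) inv_inv_eq[OF hol_autD(1)[OF D]]
    by (simp only: o_assoc)
qed

text \<open>The inverses of the factors depending on the tuple are explicit shears and overshears,
  so continuity in the tuple is read off factor by factor, for the inverse too.\<close>

lemma cconv_core:
  fixes \<psi> :: "bool + 'n \<Rightarrow> 'n cspace \<Rightarrow> complex"
  assumes adm: "\<And>j. admissible (\<Phi> j)" "admissible \<psi>" and c: "\<And>k. cconv (\<lambda>j. \<Phi> j k) (\<psi> k)"
  shows "cconv (\<lambda>j. core o' (\<Phi> j)) (core o' \<psi>)"
    and "cconv (\<lambda>j. inv_into UNIV (core o' (\<Phi> j))) (inv_into UNIV (core o' \<psi>))"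
proof -
  have D: "cconv (\<lambda>j. displace (\<Phi> j)) (displace \<psi>)"
    unfolding displace_def by (intro cconv_compose cconv_coords_shear c)
  have DI: "cconv (\<lambda>j. inv_into UNIV (displace (\<Phi> j))) (inv_into UNIV (displace \<psi>))"
    unfolding displace_hol_aut(2)[OF adm(1)] displace_hol_aut(2)[OF adm(2)]
    by (intro cconv_compose cconv_coords_shear cconv_uminus c)
  have O: "cconv (\<lambda>j. diag_overshear o' (\<Phi> j)) (diag_overshear o' \<psi>)"
    unfolding diag_overshear_def by (intro cconv_coord_overshear cconv_intros c)
  have OI: "cconv (\<lambda>j. inv_into UNIV (diag_overshear o' (\<Phi> j))) (inv_into UNIV (diag_overshear o' \<psi>))"
    unfolding diag_overshear_hol_aut(2)[OF adm(1)] diag_overshear_hol_aut(2)[OF adm(2)]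
    by (intro cconv_coord_overshear cconv_intros c)
  have R: "cconv (\<lambda>_. rotate_diag) (rotate_diag :: 'n cspace \<Rightarrow> 'n cspace)"
    "cconv (\<lambda>_. inv_into UNIV rotate_diag) (inv_into UNIV rotate_diag :: 'n cspace \<Rightarrow> 'n cspace)"
    by (intro cconv_holomorphic_map hol_autD rotate_diag_hol_aut)+
  show "cconv (\<lambda>j. core o' (\<Phi> j)) (core o' \<psi>)"
    unfolding core_def by (intro cconv_compose D DI O R)
  show "cconv (\<lambda>j. inv_into UNIV (core o' (\<Phi> j))) (inv_into UNIV (core o' \<psi>))"
    unfolding core_hol_aut(2)[OF adm(1)] core_hol_aut(2)[OF adm(2)]
    by (intro cconv_compose D DI OI R)
qed

lemma admissible_translate:
  fixes \<phi> :: "bool + 'n \<Rightarrow> 'n cspace \<Rightarrow> complex"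
  assumes "admissible \<phi>"
  shows "admissible (\<lambda>k z. \<phi> k (z + b))"
  unfolding admissible_def
proof
  fix k
  show "(\<lambda>z. \<phi> k (z + b)) \<in> hol_indep (tuple_indep k)"
  proof (rule hol_indep_compose[of "\<phi> k" "tuple_indep k"])
    show "\<phi> k \<in> hol_indep (tuple_indep k)" using assms by (simp add: admissible_def)
    show "holomorphic_map (\<lambda>z. z + b)" by (auto intro!: holomorphic_mapI)
  qed simp
qed

text \<open>Each factor is equivariant by itself: a shear only adds values of the tuple, and in the
  overshear the coefficients of \<open>z $ last_coord\<close> and \<open>z $ first_coord\<close> sum
  to 1.\<close>

lemma core_translate:
  fixes \<phi> :: "bool + 'n \<Rightarrow> 'n cspace \<Rightarrow> complex"
  assumes adm: "admissible \<phi>"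
  shows "core o' (\<lambda>k z. \<phi> k (z + vec m)) z + vec m = core o' \<phi> (z + vec m)"
proof -
  let ?\<psi> = "\<lambda>k z. \<phi> k (z + vec m)"
  have coo: "coords_shear D (\<lambda>i z. h i (z + vec m)) z + vec m = coords_shear D h (z + vec m)" for D h and z :: "'n cspace"
    by (auto simp: vec_eq_iff coords_shear_nth)
  have D: "displace ?\<psi> z + vec m = displace \<phi> (z + vec m)" for z
    using coo[of _ "\<lambda>i. \<phi> (Inr i)"] by (simp only: displace_def o_apply)
  have DI: "inv_into UNIV (displace ?\<psi>) z + vec m = inv_into UNIV (displace \<phi>) (z + vec m)" for z
    unfolding displace_hol_aut(2)[OF adm] displace_hol_aut(2)[OF admissible_translate[OF adm]]
    using coo[of _ "\<lambda>i z. - \<phi> (Inr i) z"] by (simp only: o_apply)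
  have O: "diag_overshear o' ?\<psi> z + vec m = diag_overshear o' \<phi> (z + vec m)" for z
    by (auto simp: vec_eq_iff diag_overshear_def coord_overshear_nth algebra_simps)
  have R: "rotate_diag z + vec m = rotate_diag (z + vec m)" for z :: "'n cspace"
    using two_coords by (auto simp: vec_eq_iff rotate_diag_def twist_correction_def coord_overshear_nth twist_nth algebra_simps)
  show ?thesis
    by (simp only: core_def o_apply D DI O R)
qed

lemma conjugate_core_in_family_group:
  fixes \<phi> :: "bool + 'n \<Rightarrow> 'n cspace \<Rightarrow> complex"
  assumes adm: "admissible \<phi>"
    and A: "clinear A" "clinear A'" "\<And>z. A' (A z) = z" "\<And>z. A (A' z) = z"
  shows "A' \<circ> core o' \<phi> \<circ> A \<in> family_group o'"
proof -
  note Aa = clinear_hol_aut[OF A]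
  define \<Delta> where "\<Delta> = {X \<in> carrier hol_aut. inv_into UNIV A \<circ> X \<circ> A \<in> family_group o'}"
  have \<Delta>: "subgroup \<Delta> hol_aut" unfolding \<Delta>_def by (rule subgroup_conjugates[OF subgroup_family_group Aa(1)])
  have co: "coord_overshear i (\<lambda>z. o' * f z) g \<in> \<Delta>" if "f \<in> hol_indep {i}" "g \<in> hol_indep {i}" for i f g
    unfolding \<Delta>_def Aa(2)
    by (intro CollectI conjI coord_overshear_hol_aut hol_indep_intros that
        linear_conjugate_in_family_group[OF A that])
  have sh: "coord_overshear i (\<lambda>_. 0) g \<in> \<Delta>" if "g \<in> hol_indep {i}" for i g
    using co[OF hol_indep_const[of 0] that] by simp
  have D: "displace \<phi> \<in> \<Delta>"
    unfolding displace_def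
    by (intro subgroup_hol_autD(3)[OF \<Delta>] coords_shear_in_subgroup[OF \<Delta> sh])
      (use admissibleD[OF adm] in auto)
  have O: "diag_overshear o' \<phi> \<in> \<Delta>"
    unfolding diag_overshear_def by (rule co[OF admissibleD(1)[OF adm] diag_overshear_parts(2)[OF adm]])
  have R: "rotate_diag \<in> \<Delta>"
    unfolding rotate_diag_def twist_correction_def
    by (intro subgroup_hol_autD(3)[OF \<Delta>] sh twist_correction_indep twist_in_subgroup[OF \<Delta> sh])
  have "core o' \<phi> \<in> \<Delta>"
    unfolding core_def by (intro subgroup_hol_autD(3,4)[OF \<Delta>] D O R)
  then show ?thesis by (simp add: \<Delta>_def Aa(2))
qed

text \<open>Special tuples isolate the factors. Zero displacement leaves
  \<open>diag_overshear\<close> after \<open>rotate_diag\<close>; the zero tuple leaves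
  \<open>rotate_diag\<close> alone. Cancelling it yields all overshears in the last coordinate,
  among them \<open>twist_correction\<close>, and thereby the twist.\<close>

lemma family_group_subset_if_cores:
  fixes \<Gamma> :: "('n cspace \<Rightarrow> 'n cspace) set"
  assumes \<Gamma>: "subgroup \<Gamma> hol_aut"
    and A: "clinear A" "clinear A'" "\<And>z. A' (A z) = z" "\<And>z. A (A' z) = z"
    and core: "\<And>\<psi>. admissible \<psi> \<Longrightarrow> A' \<circ> core o' \<psi> \<circ> A \<in> \<Gamma>"
  shows "family_group o' \<subseteq> \<Gamma>"
proof -
  note Aa = clinear_hol_aut[OF A]
  define \<Delta> where "\<Delta> = {X \<in> carrier hol_aut. inv_into UNIV A \<circ> X \<circ> A \<in> \<Gamma>}"
  have \<Delta>: "subgroup \<Delta> hol_aut" unfolding \<Delta>_def by (rule subgroup_conjugates[OF \<Gamma> Aa(1)])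
  define tup :: "('n cspace \<Rightarrow> complex) \<Rightarrow> ('n cspace \<Rightarrow> complex) \<Rightarrow> bool + 'n \<Rightarrow> 'n cspace \<Rightarrow> complex"
    where "tup f g k = (case k of Inl b \<Rightarrow> if b then g else f | Inr _ \<Rightarrow> (\<lambda>_. 0))" for f g k
  have adm: "admissible (tup f g)" if "f \<in> hol_indep {last_coord}" "g \<in> hol_indep {last_coord}" for f g
    using that by (auto simp: admissible_def tup_def tuple_indep_def split: sum.split)
  have "displace (tup f g) = id" for f g
    by (simp add: fun_eq_iff displace_def vec_eq_iff coords_shear_nth tup_def)
  then have c: "core o' (tup f g) = diag_overshear o' (tup f g) \<circ> rotate_diag" for f g
    by (simp add: core_def inv_id id_def o_def)
  have OR: "diag_overshear o' (tup f g) \<circ> rotate_diag \<in> \<Delta>"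
    if "f \<in> hol_indep {last_coord}" "g \<in> hol_indep {last_coord}" for f g
    using core[OF adm[OF that]] core_hol_aut(1)[OF adm[OF that], of o'] unfolding c[symmetric]
    by (simp add: \<Delta>_def Aa(2))
  have "diag_overshear o' (tup (\<lambda>_. 0) (\<lambda>_. 0)) = id"
    by (simp add: fun_eq_iff diag_overshear_def vec_eq_iff coord_overshear_nth tup_def)
  then have R: "rotate_diag \<in> \<Delta>"
    using OR[OF hol_indep_const[of 0] hol_indep_const[of 0]] by (simp only: id_o)
  have co: "coord_overshear last_coord (\<lambda>z. o' * f z) g \<in> \<Delta>"
    if f: "f \<in> hol_indep {last_coord}" and g: "g \<in> hol_indep {last_coord}" for f g
  proof -
    \<comment> \<open>Compensates the multiple of \<open>z $ first_coord\<close> built into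
      \<open>diag_overshear\<close>.\<close>
    let ?g = "\<lambda>z. g z - (1 - exp (o' * f z)) * z $ first_coord"
    have "?g \<in> hol_indep {last_coord}"
      using two_coords by (intro hol_indep_intros f g) simp
    from subgroup_hol_autD(3)[OF \<Delta> OR[OF f this] subgroup_hol_autD(4)[OF \<Delta> R]]
    have "diag_overshear o' (tup f ?g) \<circ> rotate_diag \<circ> inv_into UNIV rotate_diag \<in> \<Delta>" .
    also have "diag_overshear o' (tup f ?g) \<circ> rotate_diag \<circ> inv_into UNIV rotate_diag = diag_overshear o' (tup f ?g)"
      using hol_autD(5)[OF rotate_diag_hol_aut] by auto
    also have "\<dots> = coord_overshear last_coord (\<lambda>z. o' * f z) g"
      by (simp add: diag_overshear_def tup_def)
    finally show ?thesis .
  qed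
  have E: "twist_correction \<in> \<Delta>"
    unfolding twist_correction_def using co[OF hol_indep_const[of 0] twist_correction_indep] by simp
  have "inv_into UNIV twist_correction \<circ> rotate_diag \<in> \<Delta>"
    by (intro subgroup_hol_autD(3,4)[OF \<Delta>] E R)
  also have "inv_into UNIV twist_correction \<circ> rotate_diag = (twist :: 'n cspace \<Rightarrow> 'n cspace)"
    unfolding rotate_diag_def using hol_autD(4)[OF twist_correction_hol_aut] by auto
  finally have "twist \<in> \<Delta>" .
  then show ?thesis
    using co by (intro family_group_subset[OF \<Gamma> A]) (simp_all add: \<Delta>_def Aa(2))
qed

text \<open>\<open>twist_correction\<close> and \<open>diag_overshear\<close> act on the same
  coordinate, so their composite \<open>G\<close> is again an overshear there. The conjugating
  automorphism is \<open>displace \<phi> \<circ> A\<close>.\<close>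

lemma conjugate_core_twisted:
  fixes \<phi> :: "bool + 'n \<Rightarrow> 'n cspace \<Rightarrow> complex"
  assumes adm: "admissible \<phi>"
    and A: "clinear A" "clinear A'" "\<And>z. A' (A z) = z" "\<And>z. A (A' z) = z"
  obtains G where "G \<in> SL_conjugates (axis_family o')"
    "conjugate_in hol_aut (A' \<circ> core o' \<phi> \<circ> A) (G \<circ> twist)"
proof
  note Aa = clinear_hol_aut[OF A]
  let ?f = "\<phi> (Inl False)" and ?e = "twist_sign TYPE('n)"
  define G where "G = coord_overshear last_coord (\<lambda>z. o' * ?f z)
    (\<lambda>z. exp (o' * ?f z) * ((1 - ?e) * z $ first_coord) +
      ((1 - exp (o' * ?f z)) * z $ first_coord + \<phi> (Inl True) z))"
  have g: "(\<lambda>z. exp (o' * ?f z) * ((1 - ?e) * z $ first_coord) +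
      ((1 - exp (o' * ?f z)) * z $ first_coord + \<phi> (Inl True) z)) \<in> hol_indep {last_coord}"
    by (intro hol_indep_add[OF hol_indep_mult] hol_indep_exp diag_overshear_parts[OF adm] twist_correction_indep)
  show "G \<in> SL_conjugates (axis_family o')"
    unfolding G_def by (rule coord_overshear_SL_conjugate[OF admissibleD(1)[OF adm] g])
  have "diag_overshear o' \<phi> (twist_correction z) = G z" for z
  proof -
    have inv: "h (twist_correction z) = h z" if "h \<in> hol_indep {last_coord}" for h
      unfolding twist_correction_def by (rule coord_overshear_invariant[OF that])
    have "diag_overshear o' \<phi> (twist_correction z) = coord_overshear last_coord (\<lambda>_. o' * ?f z)
        (\<lambda>_. (1 - exp (o' * ?f z)) * z $ first_coord + \<phi> (Inl True) z) (twist_correction z)"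
      using inv[OF admissibleD(1)[OF adm, of False]] inv[OF admissibleD(1)[OF adm, of True]]
        inv[OF hol_indep_nth[of first_coord "{last_coord}"]] two_coords
      by (simp add: vec_eq_iff diag_overshear_def coord_overshear_nth)
    also have "\<dots> = G z"
      by (simp add: vec_eq_iff G_def twist_correction_def coord_overshear_nth algebra_simps)
    finally show ?thesis .
  qed
  then have OR: "diag_overshear o' \<phi> \<circ> rotate_diag = G \<circ> twist"
    by (auto simp: rotate_diag_def)
  have h: "displace \<phi> \<circ> A \<in> carrier hol_aut"
    by (rule hol_aut_compose(1)[OF displace_hol_aut(1)[OF adm] Aa(1)])
  have "A' \<circ> core o' \<phi> \<circ> A = inv\<^bsub>hol_aut\<^esub> (displace \<phi> \<circ> A) \<otimes>\<^bsub>hol_aut\<^esub> (G \<circ> twist) \<otimes>\<^bsub>hol_aut\<^esub> (displace \<phi> \<circ> A)"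
    unfolding inv_hol_aut[OF h] hol_aut_compose(2)[OF displace_hol_aut(1)[OF adm] Aa(1)] Aa(2) core_def OR
    by (simp only: hol_aut_mult o_assoc)
  moreover have "G \<circ> twist \<in> carrier hol_aut"
    unfolding OR[symmetric] by (rule hol_aut_compose(1)[OF diag_overshear_hol_aut(1)[OF adm] rotate_diag_hol_aut])
  moreover have "A' \<circ> core o' \<phi> \<circ> A \<in> carrier hol_aut"
    using hol_aut_inv_closed[OF Aa(1)] unfolding Aa(2)
    by (intro hol_aut_compose(1) core_hol_aut(1)[OF adm] Aa(1))
  ultimately show "conjugate_in hol_aut (A' \<circ> core o' \<phi> \<circ> A) (G \<circ> twist)"
    unfolding conjugate_in_def using h by blast
qed

end

section \<open>Words\<close>

text \<open>Words over two abstract letters, \<open>(True, _)\<close> standing for \<open>t\<close> and \<open>(False, _)\<close> for \<open>F\<close>;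
  relations are thus excluded even before \<open>t\<close> and \<open>F\<close> are known to be distinct.\<close>

definition letter_map :: "('a \<Rightarrow> 'a) \<Rightarrow> ('a \<Rightarrow> 'a) \<Rightarrow> bool \<times> bool \<Rightarrow> 'a \<Rightarrow> 'a"
  where "letter_map t F p = (let y = if fst p then t else F in if snd p then y else inv_into UNIV y)"

definition word_map :: "('a \<Rightarrow> 'a) \<Rightarrow> ('a \<Rightarrow> 'a) \<Rightarrow> (bool \<times> bool) list \<Rightarrow> 'a \<Rightarrow> 'a"
  where "word_map t F w = foldr (\<lambda>p x. letter_map t F p \<circ> x) w id"

lemma word_map_simps [simp]:
  "word_map t F [] = id" "word_map t F (p # w) = letter_map t F p \<circ> word_map t F w"
  by (simp_all add: word_map_def)

lemma cconv_word_map: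
  fixes t :: "'n::finite cspace \<Rightarrow> 'n cspace"
  assumes t: "t \<in> carrier hol_aut" and X: "cconv X F"
    "cconv (\<lambda>j. inv_into UNIV (X j)) (inv_into UNIV F)"
  shows "cconv (\<lambda>j. word_map t (X j) w) (word_map t F w)"
proof (induction w)
  case Nil
  show ?case by (simp add: cconv_def)
next
  case (Cons p w)
  have "cconv (\<lambda>j. letter_map t (X j) p) (letter_map t F p)"
    using X cconv_holomorphic_map[OF hol_autD(2)[OF t]] cconv_holomorphic_map[OF hol_autD(3)[OF t]]
    by (simp add: letter_map_def)
  from cconv_compose[OF this Cons] show ?case by (simp only: word_map_simps)
qed

lemma translation_hol_aut:
  "translation a \<in> carrier hol_aut" "inv_into UNIV (translation a) = translation (- a)"
proof -
  have "holomorphic_map (translation b)" for b :: "'a cspace"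
    by (auto intro!: holomorphic_mapI simp: translation_def)
  from hol_autI[OF this this, of "- a" a]
  show "translation a \<in> carrier hol_aut" "inv_into UNIV (translation a) = translation (- a)"
    by (auto simp: translation_def)
qed

lemma translation_apply: "translation a z = z + a" "inv_into UNIV (translation a) z = z - a"
  by (simp_all add: translation_hol_aut(2)) (simp_all add: translation_def)

text \<open>Translations commute with the shift by \<open>b\<close>, so replacing \<open>F\<close>
  by its conjugate under that shift conjugates every word in the same way; relations are thereby
  inherited.\<close>

lemma word_map_translate:
  fixes F F' :: "'n::finite cspace \<Rightarrow> 'n cspace"
  assumes F: "F \<in> carrier hol_aut" "F' \<in> carrier hol_aut" and eq: "\<And>z. F' z + b = F (z + b)"
  shows "word_map (translation a) F' w z + b = word_map (translation a) F w (z + b)"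
proof (induction w)
  case (Cons p w)
  have inv: "inv_into UNIV F' z + b = inv_into UNIV F (z + b)" for z
    using eq[of "inv_into UNIV F' z"] hol_autD(4,5)[OF F(1)] hol_autD(5)[OF F(2)] by metis
  have "letter_map (translation a) F' p z + b = letter_map (translation a) F p (z + b)" for z
    by (cases "fst p"; cases "snd p") (simp_all add: letter_map_def translation_apply eq inv)
  then show ?case by (simp add: Cons)
qed simp

section \<open>Weights of reduced words\<close>

definition exponent_sum :: "bool \<Rightarrow> (bool \<times> bool) list \<Rightarrow> real"
  where "exponent_sum b w = (\<Sum>p\<leftarrow>w. if fst p = b then if snd p then 1 else - 1 else 0)"

definition letter_count :: "bool \<Rightarrow> (bool \<times> bool) list \<Rightarrow> real"
  where "letter_count b w = (\<Sum>p\<leftarrow>w. if fst p = b then 1 else 0)"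

text \<open>The real part counts the letter \<open>b\<close> with sign, so the weight follows a unit
  step or its inverse. The imaginary part counts the other letter without sign, so no return is
  possible once it has occurred.\<close>

definition word_weight :: "bool \<Rightarrow> (bool \<times> bool) list \<Rightarrow> complex"
  where "word_weight b w = Complex (exponent_sum b w) (letter_count (\<not> b) w)"

lemma word_weight_append: "word_weight b (u @ v) = word_weight b u + word_weight b v"
  by (simp add: word_weight_def exponent_sum_def letter_count_def complex_eq_iff)

lemma letter_count_eq_0: "letter_count b w = 0 \<Longrightarrow> p \<in> set w \<Longrightarrow> fst p \<noteq> b"
proof (induction w)
  case (Cons q w)
  have "0 \<le> letter_count b w" unfolding letter_count_def by (rule sum_list_nonneg) auto
  then show ?case using Cons by (auto simp: letter_count_def split: if_splits)
qed simp

text \<open>Weight zero leaves no occurrence of the other letter; a reduced word in one letter is a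
  power, whose exponent sum is plus or minus its length.\<close>

lemma word_weight_neq_0:
  assumes red: "reduced_word w" and "w \<noteq> []"
  shows "word_weight b w \<noteq> 0"
proof
  assume "word_weight b w = 0"
  then have e: "exponent_sum b w = 0" and c: "letter_count (\<not> b) w = 0"
    by (simp_all add: word_weight_def complex_eq_iff)
  have fst: "fst p = b" if "p \<in> set w" for p using letter_count_eq_0[OF c that] by auto
  have "exponent_sum b v = (if snd (hd v) then 1 else - 1) * real (length v)"
    if "reduced_word v" "\<And>p. p \<in> set v \<Longrightarrow> fst p = b" for v
    using that
  proof (induction v)
    case (Cons p v)
    show ?case
    proof (cases v)
      case (Cons q u)
      have "snd p = snd q" "reduced_word v"
        using Cons.prems Cons by (auto simp: reduced_word_def)
      then show ?thesis
        using Cons.IH Cons.prems Cons by (auto simp: exponent_sum_def algebra_simps)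
    qed (use Cons.prems in \<open>simp add: exponent_sum_def\<close>)
  qed (simp add: exponent_sum_def)
  from this[OF red fst] e assms(2) show False by (auto split: if_splits)
qed

text \<open>The weights of two suffixes differ by the weight of the nonempty reduced segment between
  them. This supplies the distinct nodes for interpolation.\<close>

lemma word_weight_suffix_inj:
  assumes red: "reduced_word w"
  shows "inj_on (\<lambda>k. word_weight b (drop k w)) {..length w}"
proof (rule linorder_inj_onI)
  fix j k assume jk: "j < k" and k: "j \<in> {..length w}" "k \<in> {..length w}"
  define u where "u = take (k - j) (drop j w)"
  have jw: "drop j w = u @ drop k w"
    unfolding u_def using jk by (metis append_take_drop_id drop_drop le_add_diff_inverse2 less_imp_le)
  have "reduced_word (take j w @ (u @ drop k w))" using red by (simp flip: jw)
  then have "reduced_word u"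
    unfolding reduced_word_def successively_append_iff by blast
  moreover have "u \<noteq> []" using jk k by (auto simp: u_def)
  ultimately have "word_weight b u \<noteq> 0" by (rule word_weight_neq_0)
  then show "word_weight b (drop j w) \<noteq> word_weight b (drop k w)"
    by (simp add: jw word_weight_append)
qed auto

lemma interpolating_polynomial:
  fixes x y :: "nat \<Rightarrow> complex"
  assumes "finite K" "inj_on x K"
  obtains q where "\<And>k. k \<in> K \<Longrightarrow> poly q (x k) = y k"
proof -
  have "\<exists>q. \<forall>k\<in>K. poly q (x k) = y k"
    using assms
  proof (induction K rule: finite_induct)
    case (insert j K)
    then obtain q where q: "\<And>k. k \<in> K \<Longrightarrow> poly q (x k) = y k" by auto
    define r where "r = (\<Prod>k\<in>K. [:- x k, 1:])"
    have r0: "poly r (x k) = 0" if "k \<in> K" for k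
      using insert(1) that by (auto simp: r_def poly_prod prod_zero_iff)
    have rj: "poly r (x j) \<noteq> 0"
      using insert by (auto simp: r_def poly_prod prod_zero_iff)
    have "poly (q + smult ((y j - poly q (x j)) / poly r (x j)) r) (x k) = y k" if "k \<in> insert j K" for k
      using that q r0 rj by auto
    then show ?case by blast
  qed simp
  then show ?thesis using that by blast
qed

definition coord_rank :: "'n::{finite, linorder} \<Rightarrow> complex"
  where "coord_rank i = of_nat (card {j. j < i})"

lemma coord_rank_first: "coord_rank (first_coord :: 'n::{finite, linorder}) = 0"
  using first_coord_le by (auto simp: coord_rank_def not_less)

lemma coord_rank_next:
  assumes "i \<noteq> last_coord"
  shows "coord_rank (next_coord i) = coord_rank i + 1"
proof -
  have "{j. j < next_coord i} = insert i {j. j < i}"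
    unfolding next_coord_less(2)[OF assms] by (auto simp: le_less)
  then show ?thesis by (simp add: coord_rank_def)
qed

lemma coord_rank_last: "coord_rank (last_coord :: 'n::{finite, linorder}) = of_nat CARD('n) - 1"
proof -
  have "{j. j < (last_coord::'n)} = UNIV - {last_coord}" using le_last_coord by (auto simp: less_le)
  then have "card {j. j < (last_coord::'n)} = CARD('n) - 1" by simp
  moreover have "0 < CARD('n)" by (rule zero_less_card_finite)
  ultimately show ?thesis by (simp add: coord_rank_def of_nat_diff)
qed

text \<open>The parameters are chosen such that the orbit of the origin under the suffixes of \<open>w\<close> is
  known: \<open>displace\<close> sends the point \<open>c\<cdot>(1, \<dots>, 1)\<close> with \<open>c = word_weight True u\<close> to
  \<open>s\<cdot>(1, \<dots>, 1) + (0, 1, \<dots>, n - 1)\<close> with \<open>s = word_weight False u\<close>, and on such points the rest of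
  \<open>core\<close> increments \<open>s\<close>.\<close>

lemma word_map_moves_origin:
  fixes a :: "'n::{finite, linorder} cspace"
  assumes two: "(first_coord :: 'n) \<noteq> last_coord"
    and A: "clinear A" "clinear A'" "\<And>z. A' (A z) = z" "\<And>z. A (A' z) = z" and Aa: "A a = vec 1"
    and w: "reduced_word w" "w \<noteq> []"
  obtains \<psi> where "admissible \<psi>"
    "word_map (translation a) (A' \<circ> core o' \<psi> \<circ> A) w 0 \<noteq> 0"
proof -
  define K where "K = {..length w}"
  define c where "c k = word_weight True (drop k w)" for k
  define s where "s k = word_weight False (drop k w)" for k
  have inj: "inj_on c K" "inj_on s K"
    unfolding c_def s_def K_def by (rule word_weight_suffix_inj[OF w(1)])+
  \<comment> \<open>\<open>Q\<close> moves the first coordinate from \<open>c k\<close> to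
    \<open>s k\<close>. The polynomials \<open>P i\<close> below read this new value and move the
    remaining coordinates from \<open>c k\<close> to \<open>s k + coord_rank i\<close>.\<close>
  obtain Q where Q: "\<And>k. k \<in> K \<Longrightarrow> poly Q (c k) = s k - c k"
    using interpolating_polynomial[OF _ inj(1), of "\<lambda>k. s k - c k"] by (auto simp: K_def)
  have "\<exists>P. \<forall>k\<in>K. poly P (s k) = s k + coord_rank i - c k" for i :: 'n
    using interpolating_polynomial[OF _ inj(2), of "\<lambda>k. s k + coord_rank i - c k"]
    unfolding K_def by (metis finite_atMost)
  then obtain P where P: "\<And>(i::'n) k. k \<in> K \<Longrightarrow> poly (P i) (s k) = s k + coord_rank i - c k" by metis
  \<comment> \<open>With \<open>e\<close> the twist sign, \<open>rotate_diag\<close> gives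
    \<open>y x\<close> the last coordinate \<open>e * x + (1 - e) * (x + 1) = x + 1 - e\<close>. The
    value needed for \<open>y (x + 1)\<close> is \<open>x + n\<close>, and the difference is the
    constant \<open>n - 1 + e\<close>.\<close>
  define \<psi> :: "bool + 'n \<Rightarrow> 'n cspace \<Rightarrow> complex" where
    "\<psi> k = (case k of Inl b \<Rightarrow> if b then (\<lambda>_. of_nat CARD('n) - 1 + twist_sign TYPE('n)) else (\<lambda>_. 0)
      | Inr i \<Rightarrow> if i = first_coord then (\<lambda>z. poly Q (z $ last_coord)) else (\<lambda>z. poly (P i) (z $ first_coord)))" for k
  have poly: "(\<lambda>z. poly q (z $ i)) \<in> hol_indep (- {i})" for q and i :: 'n
    by (intro hol_indepI indep_ofI holomorphic_fun_poly holomorphic_fun_nth) simp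
  have adm: "admissible \<psi>"
    unfolding admissible_def by (auto simp: \<psi>_def tuple_indep_def poly split: sum.split)
  define y :: "complex \<Rightarrow> 'n cspace" where "y x = (\<chi> i. x + coord_rank i)" for x
  have D: "displace \<psi> (vec (c k)) = y (s k)" if k: "k \<in> K" for k
    by (auto simp: vec_eq_iff displace_def coords_shear_nth \<psi>_def y_def coord_rank_first Q[OF k] P[OF k])
  have T: "diag_overshear o' \<psi> (rotate_diag (y x)) = y (x + 1)" for x
    using two coord_rank_next[of first_coord]
    by (auto simp: vec_eq_iff diag_overshear_def rotate_diag_def twist_correction_def
        coord_overshear_nth twist_nth y_def \<psi>_def coord_rank_first coord_rank_next coord_rank_last algebra_simps)
  define F where "F = A' \<circ> core o' \<psi> \<circ> A"
  have F: "F \<in> carrier hol_aut"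
    unfolding F_def using A
    by (intro hol_aut_compose(1) core_hol_aut(1)[OF two adm] clinear_hol_aut(1)[of A A'] clinear_hol_aut(1)[of A' A]) auto
  have AP: "A (x *s a) = vec x" for x by (simp add: clinearD[OF A(1)] Aa vec_eq_iff)
  have PA: "A' (vec x) = x *s a" for x using A(3)[of "x *s a"] by (simp add: AP)
  \<comment> \<open>Only the \<open>s\<close>-weights have to differ by 1; \<open>displace\<close>
    translates between the two systems of weights.\<close>
  have step: "F (c j *s a) = c k *s a" if "j \<in> K" "k \<in> K" "s k = s j + 1" for j k
  proof -
    have "inv_into UNIV (displace \<psi>) (y (s k)) = vec (c k)"
      using hol_autD(4)[OF displace_hol_aut(1)[OF two adm], of "vec (c k)"] D[OF that(2)] by simp
    then show ?thesis
      using that(3) D[OF that(1)] by (simp add: F_def core_def AP PA T)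
  qed
  have orbit: "k \<le> length w \<Longrightarrow> word_map (translation a) F (drop k w) 0 = c k *s a" for k
  proof (induction "length w - k" arbitrary: k)
    case 0
    then show ?case by (simp add: c_def word_weight_def exponent_sum_def letter_count_def complex_eq_iff)
  next
    case (Suc d)
    then have k: "k < length w" by simp
    define p where "p = w ! k"
    have dr: "drop k w = p # drop (Suc k) w" unfolding p_def by (rule Cons_nth_drop_Suc[symmetric, OF k])
    have IH: "word_map (translation a) F (drop (Suc k) w) 0 = c (Suc k) *s a"
      using Suc k by simp
    have "drop k w = [p] @ drop (Suc k) w" by (simp add: dr)
    then have ww: "word_weight b (drop k w) = word_weight b [p] + word_weight b (drop (Suc k) w)" for b
      by (simp only: word_weight_append)
    \<comment> \<open>A translation letter changes \<open>c\<close> by plus or minus 1, a letter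
      \<open>F\<close> changes \<open>s\<close> likewise; the other weight moves by
      \<open>\<i>\<close>, and interpolation has arranged that the orbit follows.\<close>
    have pw: "word_weight b [p] = (if fst p = b then if snd p then 1 else - 1 else \<i>)" for b
      by (auto simp: word_weight_def exponent_sum_def letter_count_def complex_eq_iff)
    have "letter_map (translation a) F p (c (Suc k) *s a) = c k *s a"
    proof (cases "fst p")
      case True
      then have "c k = c (Suc k) + (if snd p then 1 else - 1)"
        using ww[of True] pw[of True] by (simp add: c_def)
      then show ?thesis
        using True by (auto simp: letter_map_def translation_apply vec_eq_iff algebra_simps)
    next
      case False
      then have sk: "s k = s (Suc k) + (if snd p then 1 else - 1)"
        using ww[of False] pw[of False] by (simp add: s_def)
      have KK: "k \<in> K" "Suc k \<in> K" using k by (auto simp: K_def)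
      show ?thesis
      proof (cases "snd p")
        case True
        then show ?thesis using False sk step[OF KK(2,1)] by (simp add: letter_map_def)
      next
        case neg: False
        then have "F (c k *s a) = c (Suc k) *s a" using sk by (intro step KK) simp
        then have "inv_into UNIV F (c (Suc k) *s a) = c k *s a"
          using hol_autD(4)[OF F, of "c k *s a"] by simp
        then show ?thesis using False neg by (simp add: letter_map_def)
      qed
    qed
    then show ?case by (simp add: dr IH)
  qed
  have "c 0 \<noteq> 0" unfolding c_def using word_weight_neq_0[OF w] by simp
  moreover have "a \<noteq> 0"
  proof
    assume "a = 0"
    then have "(vec 1 :: 'n cspace) = 0" using Aa clinearD(3)[OF A(1)] by simp
    then show False by (simp add: vec_eq_iff)
  qed
  ultimately have "c 0 *s a \<noteq> 0" by (simp add: vec_eq_iff)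
  then have "word_map (translation a) F w 0 \<noteq> 0" using orbit[of 0] by simp
  then show ?thesis using that[OF adm] by (simp add: F_def)
qed

section \<open>The theorem\<close>

lemma translation_in_family_group: "translation a \<in> family_group o'"
proof -
  have "coord_overshear j (\<lambda>_. 0) g \<in> family_group o'" if "g \<in> hol_indep {j}" for j g
    using coord_overshear_in_family_group[OF hol_indep_const[of 0] that] by simp
  then have "coords_shear UNIV (\<lambda>i _. a $ i) \<in> family_group o'"
    by (rule coords_shear_in_subgroup[OF subgroup_family_group]) auto
  moreover have "coords_shear UNIV (\<lambda>i _. a $ i) = translation a"
    by (simp add: fun_eq_iff vec_eq_iff coords_shear_nth translation_def)
  ultimately show ?thesis by simp
qed

lemma conjugate_core_translate:
  fixes a :: "'n::{finite, linorder} cspace"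
  assumes two: "(first_coord :: 'n) \<noteq> last_coord"
    and A: "clinear A" "\<And>z. A' (A z) = z" "clinear A'" and Aa: "A a = vec 1"
    and adm: "admissible \<phi>"
  shows "(A' \<circ> core o' (\<lambda>k z. \<phi> k (z + vec m)) \<circ> A) z + m *s a = (A' \<circ> core o' \<phi> \<circ> A) (z + m *s a)"
proof -
  have m: "A (m *s a) = vec m" by (simp add: clinearD[OF A(1)] Aa vec_eq_iff)
  have m': "A' (vec m) = m *s a" by (metis m A(2))
  have "core o' \<phi> (A z + vec m) = core o' (\<lambda>k z. \<phi> k (z + vec m)) (A z) + vec m"
    using core_translate[OF two adm] by simp
  then show ?thesis by (simp add: clinearD(1)[OF A(1)] clinearD(1)[OF A(3)] m m')
qed

section \<open>Freeness of a subgroup with two generators\<close>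

lemma eval_word_restrict:
  fixes t F :: "'n::finite cspace \<Rightarrow> 'n cspace"
  assumes \<Gamma>: "subgroup \<Gamma> hol_aut" and tF: "t \<in> \<Gamma>" "F \<in> \<Gamma>" and w: "fst ` set w \<subseteq> {t, F}"
  shows "eval_word (hol_aut\<lparr>carrier := \<Gamma>\<rparr>) w = word_map t F (map (\<lambda>p. (fst p = t, snd p)) w)"
  using w
proof (induction w)
  case Nil
  show ?case by (simp add: eval_word_def)
next
  case (Cons p w)
  obtain b s where p: "p = (b, s)" by (cases p)
  have b: "b = t \<or> b = F" using Cons.prems p by auto
  then have "b \<in> \<Gamma>" using tF by auto
  then have "inv\<^bsub>hol_aut\<lparr>carrier := \<Gamma>\<rparr>\<^esub> b = inv_into UNIV b"
    using hol_aut.m_inv_consistent[OF \<Gamma>] inv_hol_aut subgroup_hol_autD(1)[OF \<Gamma>] by metis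
  then have "eval_word (hol_aut\<lparr>carrier := \<Gamma>\<rparr>) (p # w) =
      (if s then b else inv_into UNIV b) \<circ> eval_word (hol_aut\<lparr>carrier := \<Gamma>\<rparr>) w"
    by (simp add: eval_word_def p)
  also have "\<dots> = letter_map t F (b = t, s) \<circ> word_map t F (map (\<lambda>p. (fst p = t, snd p)) w)"
    using Cons b by (auto simp: letter_map_def)
  finally show ?case by (simp only: p list.map word_map_simps fst_conv snd_conv)
qed

lemma free_group_generated_by_two:
  fixes t F :: "'n::finite cspace \<Rightarrow> 'n cspace"
  assumes tF: "t \<in> carrier hol_aut" "F \<in> carrier hol_aut"
    and free: "\<And>w. reduced_word w \<Longrightarrow> w \<noteq> [] \<Longrightarrow> word_map t F w \<noteq> id"
  shows "free_group (hol_aut\<lparr>carrier := generate hol_aut {t, F}\<rparr>)"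
proof -
  define \<Gamma> where "\<Gamma> = generate hol_aut {t, F}"
  have sub: "{t, F} \<subseteq> \<Gamma>" unfolding \<Gamma>_def by (auto intro: generate.incl)
  have \<Gamma>: "subgroup \<Gamma> hol_aut"
    unfolding \<Gamma>_def by (rule hol_aut.generate_is_subgroup) (use tF in auto)
  have "free_basis (hol_aut\<lparr>carrier := \<Gamma>\<rparr>) {t, F}"
    unfolding free_basis_def
  proof (intro conjI allI impI)
    show "{t, F} \<subseteq> carrier (hol_aut\<lparr>carrier := \<Gamma>\<rparr>)" using sub by simp
    show "generate (hol_aut\<lparr>carrier := \<Gamma>\<rparr>) {t, F} = carrier (hol_aut\<lparr>carrier := \<Gamma>\<rparr>)"
      using hol_aut.generate_consistent[OF sub \<Gamma>] by (simp add: \<Gamma>_def)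
    fix w assume w: "w \<noteq> [] \<and> fst ` set w \<subseteq> {t, F} \<and> reduced_word w"
    \<comment> \<open>The relabelling is injective on \<open>{t, F}\<close>, also when the two
      coincide, and so keeps words reduced.\<close>
    define v where "v = map (\<lambda>p. (fst p = t, snd p)) w"
    have "reduced_word v"
      unfolding v_def reduced_word_def successively_map
    proof (rule successively_mono)
      show "successively (\<lambda>p q. fst p = fst q \<longrightarrow> snd p = snd q) w" using w by (simp add: reduced_word_def)
    qed (use w in auto)
    moreover have "v \<noteq> []" using w by (simp add: v_def)
    ultimately have "word_map t F v \<noteq> id" by (rule free)
    then show "eval_word (hol_aut\<lparr>carrier := \<Gamma>\<rparr>) w \<noteq> \<one>\<^bsub>hol_aut\<lparr>carrier := \<Gamma>\<rparr>\<^esub>"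
      using eval_word_restrict[OF \<Gamma>, of t F w] sub w by (simp add: v_def)
  qed
  then show ?thesis
    unfolding free_group_def \<Gamma>_def[symmetric]
    using hol_aut.subgroup_imp_group[OF \<Gamma>] by blast
qed

lemma free_dense_twisted_generator:
  fixes a :: "'n::{finite, linorder} cspace"
  assumes n: "CARD('n) \<ge> 2" and a: "a \<noteq> 0"
  shows "\<exists>F \<in> carrier hol_aut.
    (\<exists>T \<in> {G \<circ> twist | G. G \<in> SL_conjugates (axis_family o')}. conjugate_in hol_aut F T) \<and>
    subgroup (generate hol_aut {translation a, F}) (hol_aut\<lparr>carrier := family_group o'\<rparr>) \<and>
    free_group (hol_aut\<lparr>carrier := generate hol_aut {translation a, F}\<rparr>) \<and>
    dense_in_compact_open (generate hol_aut {translation a, F}) (family_group o')"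
proof -
  have two: "(first_coord :: 'n) \<noteq> last_coord"
  proof
    assume "(first_coord :: 'n) = last_coord"
    then have "i = j" for i j :: 'n
      using first_coord_le le_last_coord by (metis order_antisym)
    then have "(UNIV :: 'n set) = {last_coord}" by auto
    then have "CARD('n) = card {last_coord :: 'n}" by (rule arg_cong)
    then show False using n by simp
  qed
  obtain A A' where A: "clinear A" "clinear A'" "\<And>z. A' (A z) = z" "\<And>z. A (A' z) = z"
    and Aa: "A a = vec 1"
    using linear_to_ones[OF a] by blast
  \<comment> \<open>For each member of the tuple a coordinate on which it may depend, to carry the
    Gaussian factor.\<close>
  define c :: "bool + 'n \<Rightarrow> 'n" where "c k = (case k of Inl _ \<Rightarrow> first_coord
    | Inr i \<Rightarrow> if i = first_coord then last_coord else first_coord)" for k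
  have "c k \<notin> tuple_indep k" for k
    using two by (auto simp: c_def tuple_indep_def split: sum.split)
  then obtain \<phi> :: "bool + 'n \<Rightarrow> 'n cspace \<Rightarrow> complex"
    where \<phi>: "\<And>k. holomorphic_fun (\<phi> k)" "\<And>k. indep_of (tuple_indep k) (\<phi> k)"
    and univ: "\<And>\<psi>. (\<And>k. holomorphic_fun (\<psi> k)) \<Longrightarrow> (\<And>k. indep_of (tuple_indep k) (\<psi> k)) \<Longrightarrow>
      \<exists>m::nat \<Rightarrow> nat. \<forall>k. cconv (\<lambda>j z. \<phi> k (z + vec (of_nat (m j)))) (\<psi> k)"
    using universal_translates[of c tuple_indep] by blast
  have adm: "admissible \<phi>" using \<phi> by (simp add: admissible_def hol_indep_def)
  define E where "E \<psi> = A' \<circ> core o' \<psi> \<circ> A" for \<psi> :: "bool + 'n \<Rightarrow> 'n cspace \<Rightarrow> complex"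
  define tr where "tr m = (\<lambda>k z. \<phi> k (z + vec (of_nat m)))" for m
  have adm_tr: "admissible (tr m)" for m unfolding tr_def by (rule admissible_translate[OF two adm])
  note Aa' = clinear_hol_aut[OF A] clinear_hol_aut[OF A(2,1,4,3)]
  have E: "E \<psi> \<in> carrier hol_aut" "inv_into UNIV (E \<psi>) = A' \<circ> inv_into UNIV (core o' \<psi>) \<circ> A"
    if "admissible \<psi>" for \<psi>
  proof -
    note c1 = core_hol_aut(1)[OF two that, of o']
    note c2 = hol_aut_compose[OF Aa'(3) c1]
    show "E \<psi> \<in> carrier hol_aut" unfolding E_def by (rule hol_aut_compose(1)[OF c2(1) Aa'(1)])
    show "inv_into UNIV (E \<psi>) = A' \<circ> inv_into UNIV (core o' \<psi>) \<circ> A"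
      unfolding E_def hol_aut_compose(2)[OF c2(1) Aa'(1)] c2(2) Aa'(2,4) by (simp only: o_assoc)
  qed
  have E_tr: "E (tr m) z + of_nat m *s a = E \<phi> (z + of_nat m *s a)" for m z
    unfolding E_def tr_def by (rule conjugate_core_translate[OF two A(1,3,2) Aa adm])
  have conv: "\<exists>m::nat \<Rightarrow> nat. cconv (\<lambda>j. E (tr (m j))) (E \<psi>) \<and>
      cconv (\<lambda>j. inv_into UNIV (E (tr (m j)))) (inv_into UNIV (E \<psi>))" if "admissible \<psi>" for \<psi>
  proof -
    have "holomorphic_fun (\<psi> k)" "indep_of (tuple_indep k) (\<psi> k)" for k
      using that by (auto simp: admissible_def hol_indep_def)
    then obtain m :: "nat \<Rightarrow> nat" where "\<And>k. cconv (\<lambda>j z. \<phi> k (z + vec (of_nat (m j)))) (\<psi> k)"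
      using univ[of \<psi>] by blast
    then have "cconv (\<lambda>j. tr (m j) k) (\<psi> k)" for k by (simp add: tr_def)
    note cc = cconv_core[OF two adm_tr that this, of o']
    have "cconv (\<lambda>_. A) A" "cconv (\<lambda>_. A') A'"
      by (intro cconv_holomorphic_map clinear_holomorphic_map A)+
    then show ?thesis
      unfolding E(2)[OF adm_tr] E(2)[OF that] unfolding E_def
      using cc by (intro exI[of _ m] conjI cconv_compose)
  qed
  define \<Gamma> where "\<Gamma> = generate hol_aut {translation a, E \<phi>}"
  have gens: "{translation a, E \<phi>} \<subseteq> carrier hol_aut" using translation_hol_aut(1) E(1)[OF adm] by auto
  have \<Gamma>: "subgroup \<Gamma> hol_aut" unfolding \<Gamma>_def by (rule hol_aut.generate_is_subgroup[OF gens])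
  have tF: "translation a \<in> \<Gamma>" "E \<phi> \<in> \<Gamma>" unfolding \<Gamma>_def by (auto intro: generate.incl)
  have t_pow: "translation (of_nat m *s a) \<in> \<Gamma>" for m
  proof (induction m)
    case 0
    have "translation (of_nat 0 *s a) = id" by (auto simp: translation_def)
    then show ?case using subgroup_hol_autD(2)[OF \<Gamma>] by metis
  next
    case (Suc m)
    have "translation (of_nat (Suc m) *s a) = translation a \<circ> translation (of_nat m *s a)"
      by (auto simp: translation_def vec_eq_iff algebra_simps)
    then show ?case using subgroup_hol_autD(3)[OF \<Gamma> tF(1) Suc] by metis
  qed
  have "E (tr m) \<in> \<Gamma>" for m
  proof -
    have "E (tr m) z = inv_into UNIV (translation (of_nat m *s a)) (E \<phi> (translation (of_nat m *s a) z))" for z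
      using E_tr[of m z] by (simp add: translation_apply eq_diff_eq)
    then have "E (tr m) = inv_into UNIV (translation (of_nat m *s a)) \<circ> E \<phi> \<circ> translation (of_nat m *s a)"
      by auto
    also have "\<dots> \<in> \<Gamma>" by (intro subgroup_hol_autD(3,4)[OF \<Gamma>] t_pow tF(2))
    finally show ?thesis .
  qed
  then have cl: "E \<psi> \<in> seq_closure \<Gamma>" if adm_\<psi>: "admissible \<psi>" for \<psi>
  proof -
    obtain m where "cconv (\<lambda>j. E (tr (m j))) (E \<psi>)"
      "cconv (\<lambda>j. inv_into UNIV (E (tr (m j)))) (inv_into UNIV (E \<psi>))"
      using conv[OF adm_\<psi>] by blast
    then show ?thesis
      unfolding seq_closure_def using E(1)[OF adm_\<psi>] \<open>\<And>m. E (tr m) \<in> \<Gamma>\<close>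
      by (intro CollectI conjI exI[of _ "\<lambda>j. E (tr (m j))"]) auto
  qed
  have "family_group o' \<subseteq> seq_closure \<Gamma>"
    by (rule family_group_subset_if_cores[OF two subgroup_seq_closure[OF \<Gamma>] A])
      (use cl in \<open>simp only: E_def\<close>)
  moreover have sub: "\<Gamma> \<subseteq> family_group o'"
    unfolding \<Gamma>_def
    using translation_in_family_group conjugate_core_in_family_group[OF two adm A]
    by (intro hol_aut.generate_subgroup_incl[OF _ subgroup_family_group]) (auto simp: E_def)
  ultimately have dense: "dense_in_compact_open \<Gamma> (family_group o')"
    by (intro dense_in_compact_openI)
  have "word_map (translation a) (E \<phi>) w \<noteq> id" if w: "reduced_word w" "w \<noteq> []" for w
  proof
    assume id: "word_map (translation a) (E \<phi>) w = id"
    obtain \<psi> where \<psi>: "admissible \<psi>" "word_map (translation a) (E \<psi>) w 0 \<noteq> 0"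
      using word_map_moves_origin[OF two A Aa w] unfolding E_def by blast
    obtain m :: "nat \<Rightarrow> nat" where m: "cconv (\<lambda>j. E (tr (m j))) (E \<psi>)"
      "cconv (\<lambda>j. inv_into UNIV (E (tr (m j)))) (inv_into UNIV (E \<psi>))"
      using conv[OF \<psi>(1)] by blast
    \<comment> \<open>The relation holds for all translated tuples, so its limit fixes the origin,
      contrary to the choice of \<open>\<psi>\<close>.\<close>
    have "word_map (translation a) (E (tr k)) w z = z" for k z
      using word_map_translate[OF E(1)[OF adm] E(1)[OF adm_tr] E_tr, where a = a and w = w] by (simp add: id)
    then have "(\<lambda>j::nat. 0) \<longlonglongrightarrow> word_map (translation a) (E \<psi>) w 0"
      using cconvD[OF cconv_word_map[OF translation_hol_aut(1) m], of "\<lambda>_. 0" 0 a w] by simp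
    then show False using \<psi>(2) by (simp add: LIMSEQ_const_iff)
  qed
  then have free: "free_group (hol_aut\<lparr>carrier := \<Gamma>\<rparr>)"
    unfolding \<Gamma>_def by (intro free_group_generated_by_two translation_hol_aut(1) E(1)[OF adm])
  obtain G where G: "G \<in> SL_conjugates (axis_family o')" "conjugate_in hol_aut (E \<phi>) (G \<circ> twist)"
    using conjugate_core_twisted[OF two adm A] unfolding E_def by blast
  show ?thesis
  proof (rule bexI[of _ "E \<phi>"], intro conjI)
    show "\<exists>T\<in>{G \<circ> twist | G. G \<in> SL_conjugates (axis_family o')}. conjugate_in hol_aut (E \<phi>) T"
      using G by blast
    show "subgroup (generate hol_aut {translation a, E \<phi>}) (hol_aut\<lparr>carrier := family_group o'\<rparr>)"
      using hol_aut.subgroup_incl[OF \<Gamma> subgroup_family_group sub] unfolding \<Gamma>_def .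
  qed (use dense free E(1)[OF adm] in \<open>simp_all add: \<Gamma>_def\<close>)
qed

theorem theorem2p6:
  fixes a :: "'n::{finite, linorder} cspace"
  assumes "CARD('n) \<ge> 2" and "a \<noteq> 0"
  shows
    "(\<exists>F \<in> carrier hol_aut.
        (\<exists>T \<in> twisted_shears. conjugate_in hol_aut F T) \<and>
        subgroup (generate hol_aut {translation a, F}) (hol_aut\<lparr>carrier := shear_group\<rparr>) \<and>
        free_group (hol_aut\<lparr>carrier := generate hol_aut {translation a, F}\<rparr>) \<and>
        dense_in_compact_open (generate hol_aut {translation a, F}) shear_group)
     \<and>
     (\<exists>F \<in> carrier hol_aut.
        (\<exists>T \<in> twisted_overshears. conjugate_in hol_aut F T) \<and>
        subgroup (generate hol_aut {translation a, F}) (hol_aut\<lparr>carrier := overshear_group\<rparr>) \<and>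
        free_group (hol_aut\<lparr>carrier := generate hol_aut {translation a, F}\<rparr>) \<and>
        dense_in_compact_open (generate hol_aut {translation a, F}) overshear_group)"
  unfolding twisted_shears_def twisted_overshears_def shears_def overshears_def
    axis_shears_eq axis_overshears_eq shear_group_eq overshear_group_eq
  by (intro conjI free_dense_twisted_generator assms)

end
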